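(* Let $n$ be odd and let $\mathrm{USp}(2^n)$ be the unitary symplectic group with respect to $J=i^n\bigotimes_{j=1}^nY_j$. Let $k\ge2$, let $\varepsilon<1$ be fixed, and let $\mathcal{E}$ be an $\varepsilon$-approximate relative-error unitary $k$-design over $\mathrm{USp}(2^n)$ of depth $d$. If $\mathcal{E}$ is a generalized random brickwork over the symplectic group, then $d=\Omega(n)$ (for any architecture), with implied constant independent of $n$ (it may depend on $\varepsilon$ and on the constant gate-size $r$).
   Context: $Y_j$ is the Pauli-$Y$ matrix on qubit $j$. $\mathrm{USp}(2^n)=\{U\in\mathrm{U}(2^n):UJU^T=J\}$. For an ensemble (probability distribution) $\mathcal{E}$ of unitaries, $\Phi^{(k)}_{\mathcal{E}}(A)=\mathbb{E}_{U\sim\mathcal{E}}U^{\otimes k}A\,U^{\dagger,\otimes k}$, and $\Phi^{(k)}_G$ is the twirl over the Haar measure of $G$. $\mathcal{E}$ is an $\varepsilon$-approximate relative-error unitary $k$-design over $G$ if $\mathcal{E}$ is supported on $G$ and $(1-\varepsilon)\Phi^{(k)}_G\preceq\Phi^{(k)}_{\mathcal{E}}\preceq(1+\varepsilon)\Phi^{(k)}_G$, where $\Phi\preceq\Phi'$ means that $\Phi'-\Phi$ is completely positive. An architecture is a graph whose vertices are the $n$ qubits. Generalized random brickwork: let $A_1,\dots,A_L$ be partitions of $[n]$ whose parts $a_{i,j}\in A_i$ have size at most a constant $r$ and consist of qubits connected in the architecture. For each $a_{i,j}$, either draw (independently) a Haar-random element of the group on the qubits $a_{i,j}$, or apply the identity.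 Here the group on a set $a$ of qubits is $\{V\in\mathrm{U}(2^{|a|}):V\,Y^{\otimes|a|}V^T=Y^{\otimes|a|}\}$, which is the unitary symplectic group when $|a|$ is odd. The ensemble of circuits obtained by composing these in $L$ layers is a fixed brickwork (of depth $L$). A generalized random brickwork is a convex combination of fixed brickworks; its depth $d$ is the maximal depth of its circuits. *)

theory Defs
  imports
    "HOL-Probability.Probability"
    "HOL-Library.Disjoint_Sets"
    "Jordan_Normal_Form.Schur_Decomposition"
begin

definition kron :: "complex mat \<Rightarrow> complex mat \<Rightarrow> complex mat" where
  "kron A B = mat (dim_row A * dim_row B) (dim_col A * dim_col B)
     (\<lambda>(i, j). A $$ (i div dim_row B, j div dim_col B) * B $$ (i mod dim_row B, j mod dim_col B))"

fun kron_pow :: "complex mat \<Rightarrow> nat \<Rightarrow> complex mat" where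
  "kron_pow A 0 = 1\<^sub>m 1"
| "kron_pow A (Suc k) = kron A (kron_pow A k)"

definition pauli_Y :: "complex mat" where
  "pauli_Y = mat_of_rows_list 2 [[0, - \<i>], [\<i>, 0]]"

definition unitary_group :: "nat \<Rightarrow> complex mat set" where
  "unitary_group N = {U \<in> carrier_mat N N. U * mat_adjoint U = 1\<^sub>m N \<and> mat_adjoint U * U = 1\<^sub>m N}"

definition bilinear_isometry_group :: "nat \<Rightarrow> complex mat \<Rightarrow> complex mat set" where
  "bilinear_isometry_group N B = {U \<in> unitary_group N. U * B * transpose_mat U = B}"

definition symplectic_form :: "nat \<Rightarrow> complex mat" where
  "symplectic_form n = (\<i> ^ n) \<cdot>\<^sub>m kron_pow pauli_Y n"

definition USp :: "nat \<Rightarrow> complex mat set" where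
  "USp n = bilinear_isometry_group (2 ^ n) (symplectic_form n)"

(* The group from which gates on m qubits are drawn. For even m the form is symmetric, so this is
   a conjugate of an orthogonal group. *)
definition gate_group :: "nat \<Rightarrow> complex mat set" where
  "gate_group m = bilinear_isometry_group (2 ^ m) (kron_pow pauli_Y m)"


(* Type complex mat has no topology, so the Borel sigma-algebra on N x N matrices is pulled back
   from the product sigma-algebra along the matrix entries. *)
definition mat_borel :: "nat \<Rightarrow> complex mat measure" where
  "mat_borel N = vimage_algebra (carrier_mat N N)
     (\<lambda>A. \<lambda>p\<in>{..<N} \<times> {..<N}. A $$ p) (\<Pi>\<^sub>M p\<in>{..<N} \<times> {..<N}. borel)"

definition ensemble_on :: "nat \<Rightarrow> complex mat set \<Rightarrow> complex mat measure \<Rightarrow> bool" where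
  "ensemble_on N G E \<longleftrightarrow>
     prob_space E \<and> sets E = sets (mat_borel N) \<and> (AE U in E. U \<in> G)"

(* For a compact group G exactly one measure satisfies this predicate. *)
definition haar_measure :: "nat \<Rightarrow> complex mat set \<Rightarrow> complex mat measure \<Rightarrow> bool" where
  "haar_measure N G \<mu> \<longleftrightarrow> ensemble_on N G \<mu> \<and>
     (\<forall>U\<in>G. distr \<mu> \<mu> (\<lambda>V. U * V) = \<mu> \<and> distr \<mu> \<mu> (\<lambda>V. V * U) = \<mu>)"


definition twirl :: "nat \<Rightarrow> nat \<Rightarrow> complex mat measure \<Rightarrow> complex mat \<Rightarrow> complex mat" where
  "twirl N k E A = mat (N ^ k) (N ^ k)
     (\<lambda>p. \<integral>U. (kron_pow U k * A * kron_pow (mat_adjoint U) k) $$ p \<partial>E)"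

(* The order on complex numbers is the one of Complex_Order: 0 \<le> z says that z is real and
   nonnegative. *)
definition pos_semidef :: "nat \<Rightarrow> complex mat \<Rightarrow> bool" where
  "pos_semidef N A \<longleftrightarrow> A \<in> carrier_mat N N \<and> (\<forall>v\<in>carrier_vec N. 0 \<le> (A *\<^sub>v v) \<bullet>c v)"

(* The map \<Phi> \<otimes> id on matrices over C^D \<otimes> C^m, in the index convention of kron:
   \<Phi> acts on each of the D x D blocks obtained by fixing the indices of the second factor. *)
definition ampliation ::
    "nat \<Rightarrow> nat \<Rightarrow> (complex mat \<Rightarrow> complex mat) \<Rightarrow> complex mat \<Rightarrow> complex mat" where
  "ampliation D m \<Phi> X = mat (D * m) (D * m)
     (\<lambda>(i, j). \<Phi> (mat D D (\<lambda>(s, t). X $$ (s * m + i mod m, t * m + j mod m)))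
                 $$ (i div m, j div m))"

definition completely_positive :: "nat \<Rightarrow> (complex mat \<Rightarrow> complex mat) \<Rightarrow> bool" where
  "completely_positive D \<Phi> \<longleftrightarrow>
     (\<forall>m X. pos_semidef (D * m) X \<longrightarrow> pos_semidef (D * m) (ampliation D m \<Phi> X))"

definition cp_le ::
    "nat \<Rightarrow> (complex mat \<Rightarrow> complex mat) \<Rightarrow> (complex mat \<Rightarrow> complex mat) \<Rightarrow> bool" where
  "cp_le D \<Phi> \<Psi> \<longleftrightarrow> completely_positive D (\<lambda>A. \<Psi> A - \<Phi> A)"

definition relative_error_design ::
    "nat \<Rightarrow> complex mat set \<Rightarrow> nat \<Rightarrow> real \<Rightarrow> complex mat measure \<Rightarrow> bool" where
  "relative_error_design N G k \<epsilon> E \<longleftrightarrow> ensemble_on N G E \<and>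
     (\<exists>\<mu>. haar_measure N G \<mu> \<and>
       cp_le (N ^ k) (\<lambda>A. complex_of_real (1 - \<epsilon>) \<cdot>\<^sub>m twirl N k \<mu> A) (twirl N k E) \<and>
       cp_le (N ^ k) (twirl N k E) (\<lambda>A. complex_of_real (1 + \<epsilon>) \<cdot>\<^sub>m twirl N k \<mu> A))"


definition architecture :: "nat \<Rightarrow> (nat \<times> nat) set \<Rightarrow> bool" where
  "architecture n \<Gamma> \<longleftrightarrow> \<Gamma> \<subseteq> {..<n} \<times> {..<n} \<and> sym \<Gamma> \<and> irrefl \<Gamma>"

(* The subgraph induced on a is connected. *)
definition connected_qubits :: "(nat \<times> nat) set \<Rightarrow> nat set \<Rightarrow> bool" where
  "connected_qubits \<Gamma> a \<longleftrightarrow> (\<forall>u\<in>a. \<forall>v\<in>a. (u, v) \<in> (\<Gamma> \<inter> a \<times> a)\<^sup>*)"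

(* A layer (A, H) is a partition A of the qubits together with the set H of those parts that carry
   a Haar-random gate; the other parts carry the identity. A circuit lists its layers, the one
   applied first at the head, so its depth is its length. *)
type_synonym layer = "nat set set \<times> nat set set"
type_synonym circuit = "layer list"

definition valid_layer :: "nat \<Rightarrow> (nat \<times> nat) set \<Rightarrow> nat \<Rightarrow> layer \<Rightarrow> bool" where
  "valid_layer n \<Gamma> r l \<longleftrightarrow> partition_on {..<n} (fst l) \<and> snd l \<subseteq> fst l \<and>
     (\<forall>a\<in>fst l. card a \<le> r \<and> connected_qubits \<Gamma> a)"

(* A basis state of n qubits is a number below 2^n whose bit q is the state of qubit q. Its
   restriction to the qubits in a is the number below 2^(card a) formed by the bits at the
   positions in a, in increasing order. *)
definition restrict_bits :: "nat set \<Rightarrow> nat \<Rightarrow> nat" where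
  "restrict_bits a i = horner_sum of_bool 2 (map (bit i) (sorted_list_of_set a))"

(* The tensor product of the gates V a over the parts a of the partition A. *)
definition layer_unitary :: "nat \<Rightarrow> nat set set \<Rightarrow> (nat set \<Rightarrow> complex mat) \<Rightarrow> complex mat" where
  "layer_unitary n A V = mat (2 ^ n) (2 ^ n)
     (\<lambda>(i, j). \<Prod>a\<in>A. V a $$ (restrict_bits a i, restrict_bits a j))"

definition circuit_unitary ::
    "nat \<Rightarrow> circuit \<Rightarrow> (nat \<times> nat set \<Rightarrow> complex mat) \<Rightarrow> complex mat" where
  "circuit_unitary n C V =
     foldl (\<lambda>U l. layer_unitary n (fst (C ! l)) (\<lambda>a. V (l, a)) * U) (1\<^sub>m (2 ^ n)) [0..<length C]"

(* Here h m stands for the Haar measure on gate_group m. The product measure makes the gates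
   independent. *)
definition fixed_brickwork ::
    "(nat \<Rightarrow> complex mat measure) \<Rightarrow> nat \<Rightarrow> circuit \<Rightarrow> complex mat measure" where
  "fixed_brickwork h n C =
     distr
       (\<Pi>\<^sub>M (l, a)\<in>Sigma {..<length C} (\<lambda>l. fst (C ! l)).
          if a \<in> snd (C ! l) then h (card a)
          else return (mat_borel (2 ^ card a)) (1\<^sub>m (2 ^ card a)))
       (mat_borel (2 ^ n))
       (circuit_unitary n C)"

(* The weights p of the convex combination are a probability mass function on circuits, and d is
   the maximal depth of a circuit of positive weight. *)
definition generalized_random_brickwork ::
    "nat \<Rightarrow> (nat \<times> nat) set \<Rightarrow> nat \<Rightarrow> nat \<Rightarrow> complex mat measure \<Rightarrow> bool" where
  "generalized_random_brickwork n \<Gamma> r d E \<longleftrightarrow>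
     (\<exists>(h :: nat \<Rightarrow> complex mat measure) (p :: circuit pmf).
        (\<forall>m. haar_measure (2 ^ m) (gate_group m) (h m)) \<and>
        (\<forall>C\<in>set_pmf p. (\<forall>l\<in>set C. valid_layer n \<Gamma> r l) \<and> length C \<le> d) \<and>
        (\<exists>C\<in>set_pmf p. length C = d) \<and>
        sets E = sets (mat_borel (2 ^ n)) \<and>
        (\<forall>S\<in>sets E. emeasure E S = (\<integral>\<^sup>+ C. emeasure (fixed_brickwork h n C) S \<partial>measure_pmf p)))"

end

theory Submission
  imports Defs
begin

unbundle bit_operations_syntax

text \<open>
  For \<open>U\<close> in \<open>USp\<close> one has \<open>Y\<^sup>\<otimes>\<^sup>n U\<^sup>T = U\<^sup>\<dagger> Y\<^sup>\<otimes>\<^sup>n\<close>, so \<open>U \<otimes> U\<close> acts on the vectorisation of \<open>P Y\<^sup>\<otimes>\<^sup>n\<close> as the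
  conjugation \<open>P \<mapsto> U P U\<^sup>\<dagger>\<close>. Hence a relative-error 2-design must reproduce, up to a factor \<open>1 + \<epsilon> < 2\<close>, the
  mean of the return probability \<open>|tr (Z U Z U\<^sup>\<dagger>)|\<^sup>2\<close>, where \<open>Z\<close> is the Pauli \<open>Z\<close> on qubit 0. For Haar-random \<open>U\<close> this
  mean is at most \<open>4 \<cdot> 2\<^sup>n\<close>: by invariance it is the same for exponentially many pairwise orthogonal Paulis
  \<open>W\<^sup>\<dagger> Z W\<close> in place of the left \<open>Z\<close>, and these share a total weight of \<open>4\<^sup>n\<close>. In a brickwork, on the other
  hand, each layer touches \<open>Z\<close> with a single gate on at most \<open>r\<close> qubits, and this gate returns it to \<open>Z\<close> with
  mean probability at least \<open>4\<^sup>-\<^sup>r\<close>, independently of the other layers; so in depth \<open>d\<close> the mean is at least \<open>4\<^sup>n \<cdot> 4\<^sup>-\<^sup>r\<^sup>d\<close>.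
\<close>

section \<open>Kronecker products and unitary matrices\<close>

text \<open>Two points shape the proof. After some layers U, the operator U Z U\<dagger> has many
  Pauli components, and the next gate could make them interfere with the component along Z. The gate
  group contains every Pauli up to a phase, so Haar invariance averages the interference away, and
  convexity of the squared modulus yields |tr(B Z)|^2 / 4^m as a lower bound for the mean of |tr(B
  V\<dagger> Z V)|^2. The bound holds for every operator B, and its right side is the value at V =
  1; this is why it can be iterated over the layers. The factor 4^m is the dimension of the operator
  space on m qubits. On the Haar side, W is exp(\<i> \<pi>/4 X^s). Odd weight of s puts W into the
  group, since X^s then anticommutes with the n-fold Y; s must contain qubit 0 so that X^s
  anticommutes with Z. At least 2^(n-2) values of s qualify, and 4^n / 2^(n-2) = 4 * 2^n. Comparing,
  4^n 4^(-r d) \<le> 2 * 4 * 2^n, that is n \<le> 2 r d + 3.\<close>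

lemma mat_adjoint_carrier [simp]: "A \<in> carrier_mat r c \<Longrightarrow> mat_adjoint A \<in> carrier_mat c r"
  unfolding mat_adjoint_def by (auto simp: mat_of_rows_def)

lemma mat_adjoint_index [simp]:
  "i < dim_col A \<Longrightarrow> j < dim_row A \<Longrightarrow> mat_adjoint (A :: complex mat) $$ (i, j) = cnj (A $$ (j, i))"
  unfolding mat_adjoint_def by (simp add: mat_of_rows_index)

lemma mat_adjoint_dim [simp]:
  "dim_row (mat_adjoint (A :: complex mat)) = dim_col A" "dim_col (mat_adjoint A) = dim_row A"
  unfolding mat_adjoint_def by simp_all

lemma mat_mult_index:
  assumes "A \<in> carrier_mat a b" "B \<in> carrier_mat b c" "i < a" "j < c"
  shows "(A * B) $$ (i, j) = (\<Sum>k<b. A $$ (i, k) * B $$ (k, j))"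
  using assms by (auto simp: scalar_prod_def lessThan_atLeast0)

lemma mat_adjoint_mult:
  assumes "(A :: complex mat) \<in> carrier_mat a b" "B \<in> carrier_mat b c"
  shows "mat_adjoint (A * B) = mat_adjoint B * mat_adjoint A"
proof (rule eq_matI)
  fix i j assume "i < dim_row (mat_adjoint B * mat_adjoint A)" "j < dim_col (mat_adjoint B * mat_adjoint A)"
  then have ij: "i < c" "j < a" using assms by auto
  have 1: "mat_adjoint (A * B) $$ (i, j) = cnj ((A * B) $$ (j, i))"
    using assms ij by simp
  have 2: "(mat_adjoint B * mat_adjoint A) $$ (i, j) = (\<Sum>k<b. mat_adjoint B $$ (i, k) * mat_adjoint A $$ (k, j))"
    using assms ij by (intro mat_mult_index) auto
  show "mat_adjoint (A * B) $$ (i, j) = (mat_adjoint B * mat_adjoint A) $$ (i, j)"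
    unfolding 1 2 using assms ij by (subst mat_mult_index) (auto intro!: sum.cong)
qed (use assms in auto)

lemma mat_adjoint_one [simp]: "mat_adjoint (1\<^sub>m N :: complex mat) = 1\<^sub>m N"
  by (rule eq_matI) auto

lemma mat_adjoint_adjoint [simp]: "mat_adjoint (mat_adjoint (A :: complex mat)) = A"
  by (rule eq_matI) auto

lemma kron_carrier [simp]:
  "A \<in> carrier_mat a b \<Longrightarrow> B \<in> carrier_mat c d \<Longrightarrow> kron A B \<in> carrier_mat (a * c) (b * d)"
  unfolding kron_def by auto

lemma kron_dim [simp]:
  "dim_row (kron A B) = dim_row A * dim_row B" "dim_col (kron A B) = dim_col A * dim_col B"
  unfolding kron_def by auto

lemma div_mod_bounds:
  "(i::nat) < a * c \<Longrightarrow> i div c < a" "(i::nat) < a * c \<Longrightarrow> i mod c < c"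
  by (auto simp: less_mult_imp_div_less) (metis mod_less_divisor mult_0_right not_gr_zero not_less_zero)

lemma kron_index:
  "i < dim_row A * dim_row B \<Longrightarrow> j < dim_col A * dim_col B \<Longrightarrow>
   kron A B $$ (i, j) = A $$ (i div dim_row B, j div dim_col B) * B $$ (i mod dim_row B, j mod dim_col B)"
  unfolding kron_def by auto

lemma sum_div_mod:
  fixes f :: "nat \<Rightarrow> nat \<Rightarrow> 'a::comm_monoid_add"
  shows "(\<Sum>x<a * b. f (x div b) (x mod b)) = (\<Sum>i<a. \<Sum>j<b. f i j)"
proof -
  have "(\<Sum>x<a * b. f (x div b) (x mod b)) = (\<Sum>(i, j)\<in>{..<a} \<times> {..<b}. f i j)"
    by (rule sum.reindex_bij_witness[where i = "\<lambda>(i, j). i * b + j" and j = "\<lambda>x. (x div b, x mod b)"])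
       (auto simp: div_mod_bounds, metis (no_types) add.commute le_less_trans mult.commute
          mult_le_mono2 nat_add_left_cancel_less not_less not_less_eq_eq less_mult_imp_div_less
          Suc_leI add_less_mono1 mult_Suc less_le_trans)
  then show ?thesis by (simp add: sum.cartesian_product)
qed

lemma kron_mult:
  assumes "A \<in> carrier_mat a b" "B \<in> carrier_mat c d" "C \<in> carrier_mat b e" "D \<in> carrier_mat d f"
  shows "kron A B * kron C D = kron (A * C) (B * D)"
proof (rule eq_matI)
  fix i j assume "i < dim_row (kron (A * C) (B * D))" "j < dim_col (kron (A * C) (B * D))"
  then have ij: "i < a * c" "j < e * f" using assms by auto
  note b = div_mod_bounds[OF ij(1)] div_mod_bounds[OF ij(2)]
  have "(kron A B * kron C D) $$ (i, j) = (\<Sum>k<b * d. kron A B $$ (i, k) * kron C D $$ (k, j))"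
    using assms ij by (intro mat_mult_index) auto
  also have "\<dots> = (\<Sum>k<b * d. (A $$ (i div c, k div d) * B $$ (i mod c, k mod d)) *
                      (C $$ (k div d, j div f) * D $$ (k mod d, j mod f)))"
    using assms ij by (intro sum.cong refl) (auto simp: kron_index)
  also have "\<dots> = (\<Sum>x<b. \<Sum>y<d. (A $$ (i div c, x) * B $$ (i mod c, y)) * (C $$ (x, j div f) * D $$ (y, j mod f)))"
    by (rule sum_div_mod)
  also have "\<dots> = (\<Sum>x<b. A $$ (i div c, x) * C $$ (x, j div f)) * (\<Sum>y<d. B $$ (i mod c, y) * D $$ (y, j mod f))"
    unfolding sum_product by (intro sum.cong refl) (simp add: ac_simps)
  also have "\<dots> = (A * C) $$ (i div c, j div f) * (B * D) $$ (i mod c, j mod f)"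
    using assms b by (simp only: mat_mult_index[of A a b C e] mat_mult_index[of B c d D f])
  also have "\<dots> = kron (A * C) (B * D) $$ (i, j)"
    using assms ij by (subst kron_index) auto
  finally show "(kron A B * kron C D) $$ (i, j) = kron (A * C) (B * D) $$ (i, j)" .
qed (use assms in auto)

lemma kron_one: "kron (1\<^sub>m a) (1\<^sub>m b) = 1\<^sub>m (a * b)"
proof (rule eq_matI)
  fix i j assume "i < dim_row (1\<^sub>m (a * b) :: complex mat)" "j < dim_col (1\<^sub>m (a * b) :: complex mat)"
  then have ij: "i < a * b" "j < a * b" by auto
  have "i = j \<longleftrightarrow> i div b = j div b \<and> i mod b = j mod b"
    by (metis div_mult_mod_eq)
  then show "kron (1\<^sub>m a) (1\<^sub>m b) $$ (i, j) = 1\<^sub>m (a * b) $$ (i, j)"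
    using ij div_mod_bounds[OF ij(1)] div_mod_bounds[OF ij(2)] by (simp add: kron_index)
qed auto

lemma mat_adjoint_kron: "mat_adjoint (kron A B) = kron (mat_adjoint A) (mat_adjoint B)"
proof (rule eq_matI)
  fix i j assume "i < dim_row (kron (mat_adjoint A) (mat_adjoint B))"
    "j < dim_col (kron (mat_adjoint A) (mat_adjoint B))"
  then show "mat_adjoint (kron A B) $$ (i, j) = kron (mat_adjoint A) (mat_adjoint B) $$ (i, j)"
    by (simp add: kron_index div_mod_bounds)
qed auto

lemma kron_assoc: "kron A (kron B C) = kron (kron A B) C"
proof (rule eq_matI)
  fix i j assume ij: "i < dim_row (kron (kron A B) C)" "j < dim_col (kron (kron A B) C)"
  then have i: "i < dim_row A * (dim_row B * dim_row C)" "i < dim_row A * dim_row B * dim_row C"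
    and j: "j < dim_col A * (dim_col B * dim_col C)" "j < dim_col A * dim_col B * dim_col C"
    by (auto simp: ac_simps)
  show "kron A (kron B C) $$ (i, j) = kron (kron A B) C $$ (i, j)"
    using i j div_mod_bounds[OF i(1)] div_mod_bounds[OF i(2)] div_mod_bounds[OF j(1)] div_mod_bounds[OF j(2)]
    by (simp add: kron_index div_mult2_eq mod_mult2_eq mult.commute[of _ "dim_row C"] mult.commute[of _ "dim_col C"])
qed (auto simp: ac_simps)

lemma kron_pow_carrier [simp]: "A \<in> carrier_mat a b \<Longrightarrow> kron_pow A k \<in> carrier_mat (a ^ k) (b ^ k)"
  by (induction k) auto

lemma kron_pow_adjoint: "kron_pow (mat_adjoint A) k = mat_adjoint (kron_pow A k)"
  by (induction k) (auto simp: mat_adjoint_kron)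

lemma unitary_group_carrier: "U \<in> unitary_group N \<Longrightarrow> U \<in> carrier_mat N N"
  by (simp add: unitary_group_def)

lemma kron_unitary:
  assumes "U \<in> unitary_group a" "V \<in> unitary_group b"
  shows "kron U V \<in> unitary_group (a * b)"
proof -
  have c: "U \<in> carrier_mat a a" "V \<in> carrier_mat b b" using assms by (auto simp: unitary_group_def)
  show ?thesis
    using assms c unfolding unitary_group_def
    by (auto simp: mat_adjoint_kron kron_one kron_mult[of _ a a _ b b _ a _ b])
qed

lemma one_unitary: "1\<^sub>m N \<in> unitary_group N"
  by (simp add: unitary_group_def)

lemma kron_pow_unitary: "U \<in> unitary_group N \<Longrightarrow> kron_pow U k \<in> unitary_group (N ^ k)"
  by (induction k) (auto simp: one_unitary kron_unitary)

text \<open>This is v\<dagger> A v, kept as a finite double sum over entries so that the entrywise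
  integral of a twirl can be moved outside (\<open>quad_form_twirl\<close>).\<close>

definition quad_form :: "nat \<Rightarrow> complex mat \<Rightarrow> complex vec \<Rightarrow> complex" where
  "quad_form D A v = (\<Sum>i<D. \<Sum>j<D. cnj (v $ i) * A $$ (i, j) * v $ j)"

lemma quad_form_eq:
  assumes "A \<in> carrier_mat D D" "v \<in> carrier_vec D"
  shows "(A *\<^sub>v v) \<bullet>c v = quad_form D A v"
  using assms unfolding quad_form_def
  by (auto simp: scalar_prod_def lessThan_atLeast0 sum_distrib_left sum_distrib_right ac_simps intro!: sum.cong)

text \<open>The form v\<dagger> F F\<dagger> v is the squared norm of F\<dagger> v. This gives
  positivity of the test input and, in \<open>quad_form_test\<close>, the exact value of the
  test.\<close>

lemma quad_form_gram:
  assumes "F \<in> carrier_mat D K" "v \<in> carrier_vec D"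
  shows "quad_form D (F * mat_adjoint F) v = of_real (\<Sum>t<K. (cmod (\<Sum>i<D. cnj (F $$ (i, t)) * v $ i))\<^sup>2)"
proof -
  have e: "(F * mat_adjoint F) $$ (i, j) = (\<Sum>t<K. F $$ (i, t) * cnj (F $$ (j, t)))" if "i < D" "j < D" for i j
    using that assms mat_mult_index[of F D K "mat_adjoint F" D i j] by (auto intro!: sum.cong)
  have "quad_form D (F * mat_adjoint F) v =
    (\<Sum>i<D. \<Sum>j<D. \<Sum>t<K. (cnj (v $ i) * F $$ (i, t)) * (cnj (F $$ (j, t)) * v $ j))"
    unfolding quad_form_def
    by (intro sum.cong refl) (simp add: e sum_distrib_left sum_distrib_right ac_simps)
  also have "\<dots> = (\<Sum>t<K. \<Sum>i<D. \<Sum>j<D. (cnj (v $ i) * F $$ (i, t)) * (cnj (F $$ (j, t)) * v $ j))"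
    by (simp only: sum.swap[of _ "{..<K}"])
  also have "\<dots> = (\<Sum>t<K. (\<Sum>i<D. cnj (v $ i) * F $$ (i, t)) * (\<Sum>j<D. cnj (F $$ (j, t)) * v $ j))"
    by (simp add: sum_product)
  also have "\<dots> = (\<Sum>t<K. of_real ((cmod (\<Sum>i<D. cnj (F $$ (i, t)) * v $ i))\<^sup>2))"
  proof (rule sum.cong[OF refl])
    fix t
    have "(\<Sum>i<D. cnj (v $ i) * F $$ (i, t)) = cnj (\<Sum>i<D. cnj (F $$ (i, t)) * v $ i)"
      by (simp add: ac_simps)
    then show "(\<Sum>i<D. cnj (v $ i) * F $$ (i, t)) * (\<Sum>j<D. cnj (F $$ (j, t)) * v $ j) =
      of_real ((cmod (\<Sum>i<D. cnj (F $$ (i, t)) * v $ i))\<^sup>2)"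
      by (metis complex_norm_square mult.commute)
  qed
  finally show ?thesis by simp
qed

lemma pos_semidef_gram:
  assumes "F \<in> carrier_mat D K"
  shows "pos_semidef D (F * mat_adjoint F)"
  unfolding pos_semidef_def
proof (intro conjI ballI)
  show c: "F * mat_adjoint F \<in> carrier_mat D D" using assms by (auto intro: mult_carrier_mat)
  fix v :: "complex vec" assume v: "v \<in> carrier_vec D"
  show "0 \<le> (F * mat_adjoint F *\<^sub>v v) \<bullet>c v"
    unfolding quad_form_eq[OF c v] quad_form_gram[OF assms v]
    by (auto simp: less_eq_complex_def intro: sum_nonneg)
qed

section \<open>Paulis and the gate groups\<close>

text \<open>The diagonal of the Pauli \<open>Z\<close> on qubit 0, the lowest bit.\<close>

definition pauli_Z_sign :: "nat \<Rightarrow> complex" where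
  "pauli_Z_sign i = (if even i then 1 else -1)"

lemma pauli_Z_sign_square [simp]: "pauli_Z_sign i * pauli_Z_sign i = 1"
  and cnj_pauli_Z_sign [simp]: "cnj (pauli_Z_sign i) = pauli_Z_sign i"
  and norm_pauli_Z_sign [simp]: "cmod (pauli_Z_sign i) = 1"
  by (auto simp: pauli_Z_sign_def)

lemma xor_less_pow2: "(i::nat) < 2 ^ n \<Longrightarrow> s < 2 ^ n \<Longrightarrow> i XOR s < 2 ^ n"
  by (metis take_bit_nat_eq_self take_bit_nat_less_exp take_bit_xor)

lemma xor_cancel [simp]: "(i XOR s) XOR s = (i::nat)"
  by (simp add: xor.assoc)

lemma pauli_Z_sign_xor: "pauli_Z_sign (i XOR s) = pauli_Z_sign i * pauli_Z_sign s"
  by (auto simp: pauli_Z_sign_def even_xor_iff)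

text \<open>The character (-1)^|s|, counting the lowest n bits of s. It is the sign picked up when
  X^s moves past the n-fold Kronecker power of Y.\<close>

definition popcount_sign :: "nat \<Rightarrow> nat \<Rightarrow> complex" where
  "popcount_sign n s = (\<Prod>q<n. if bit s q then -1 else 1)"

definition Y_entry :: "bool \<Rightarrow> bool \<Rightarrow> complex" where
  "Y_entry a b = (if a = b then 0 else if a then \<i> else - \<i>)"

lemma pauli_Y_carrier [simp]: "pauli_Y \<in> carrier_mat 2 2"
  by (auto simp: pauli_Y_def mat_of_rows_list_def)

lemma pauli_Y_index:
  assumes "a < 2" "b < 2"
  shows "pauli_Y $$ (a, b) = Y_entry (odd a) (odd b)"
proof -
  have "a = 0 \<or> a = 1" "b = 0 \<or> b = 1" using assms by auto
  then show ?thesis by (auto simp: pauli_Y_def mat_of_rows_list_def Y_entry_def)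
qed

lemma kron_pow_Y_dim [simp]:
  "dim_row (kron_pow pauli_Y n) = 2 ^ n" "dim_col (kron_pow pauli_Y n) = 2 ^ n"
  using carrier_matD[OF kron_pow_carrier[OF pauli_Y_carrier, of n]] by simp_all

lemma bit_mod_pow2: "q < n \<Longrightarrow> bit (i mod 2 ^ n) q = bit (i::nat) q"
  by (simp flip: take_bit_eq_mod add: bit_take_bit_iff)

lemma kron_pow_Y_index:
  "i < 2 ^ n \<Longrightarrow> j < 2 ^ n \<Longrightarrow> kron_pow pauli_Y n $$ (i, j) = (\<Prod>q<n. Y_entry (bit i q) (bit j q))"
proof (induction n arbitrary: i j)
  case 0
  then show ?case by simp
next
  case (Suc n)
  have c: "kron_pow pauli_Y n \<in> carrier_mat (2 ^ n) (2 ^ n)" by simp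
  have b: "i div 2 ^ n < 2" "j div 2 ^ n < 2"
    using Suc.prems by (auto simp: less_mult_imp_div_less)
  \<comment> \<open>\<open>kron\<close> puts the new factor on the most significant bit, here bit
    n.\<close>
  have "kron_pow pauli_Y (Suc n) $$ (i, j) =
    pauli_Y $$ (i div 2 ^ n, j div 2 ^ n) * kron_pow pauli_Y n $$ (i mod 2 ^ n, j mod 2 ^ n)"
    using Suc.prems carrier_matD[OF pauli_Y_carrier] by (simp add: kron_index)
  also have "\<dots> = Y_entry (bit i n) (bit j n) * (\<Prod>q<n. Y_entry (bit (i mod 2 ^ n) q) (bit (j mod 2 ^ n) q))"
    using b by (simp add: Suc.IH pauli_Y_index bit_iff_odd)
  also have "\<dots> = (\<Prod>q<Suc n. Y_entry (bit i q) (bit j q))"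
    by (simp add: bit_mod_pow2)
  finally show ?case .
qed

text \<open>X and Y anticommute on each qubit, so X^s K = (-1)^|s| K X^s for K the power of Y.
  Multiplication by X^s is an XOR of an index with s.\<close>

lemma kron_pow_Y_xor:
  assumes "i < 2 ^ n" "j < 2 ^ n" "s < 2 ^ n"
  shows "kron_pow pauli_Y n $$ (i XOR s, j) = popcount_sign n s * kron_pow pauli_Y n $$ (i, j XOR s)"
proof -
  have "Y_entry (a \<noteq> c) b = (if c then -1 else 1) * Y_entry a (b \<noteq> c)" for a b c
    by (auto simp: Y_entry_def)
  then show ?thesis
    using assms by (simp add: kron_pow_Y_index xor_less_pow2 bit_xor_iff popcount_sign_def prod.distrib)
qed

text \<open>Y has zero diagonal, so its powers couple only complementary bit strings. This is what
  makes \<open>diag_gate\<close> preserve the form.\<close>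

lemma kron_pow_Y_nonzero:
  assumes "i < 2 ^ n" "j < 2 ^ n" "t < n" "kron_pow pauli_Y n $$ (i, j) \<noteq> 0"
  shows "bit i t \<noteq> bit j t"
proof -
  have "Y_entry (bit i t) (bit j t) \<noteq> 0" using assms by (simp add: kron_pow_Y_index)
  then show ?thesis unfolding Y_entry_def by metis
qed

lemma pauli_Y_unitary: "pauli_Y \<in> unitary_group 2"
proof -
  have "pauli_Y * mat_adjoint pauli_Y = 1\<^sub>m 2"
  proof (rule eq_matI)
    fix i j assume "i < dim_row (1\<^sub>m 2 :: complex mat)" "j < dim_col (1\<^sub>m 2 :: complex mat)"
    then have ij: "i < 2" "j < 2" by auto
    then have "i = 0 \<or> i = 1" "j = 0 \<or> j = 1" by auto
    moreover have "(pauli_Y * mat_adjoint pauli_Y) $$ (i, j) = (\<Sum>k<2. pauli_Y $$ (i, k) * mat_adjoint pauli_Y $$ (k, j))"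
      using ij by (intro mat_mult_index) auto
    ultimately show "(pauli_Y * mat_adjoint pauli_Y) $$ (i, j) = 1\<^sub>m 2 $$ (i, j)"
      using ij carrier_matD[OF pauli_Y_carrier]
      by (auto simp: numeral_2_eq_2 pauli_Y_index Y_entry_def)
  qed (use carrier_matD[OF pauli_Y_carrier] in auto)
  moreover have "mat_adjoint pauli_Y * pauli_Y = 1\<^sub>m 2"
  proof (rule eq_matI)
    fix i j assume "i < dim_row (1\<^sub>m 2 :: complex mat)" "j < dim_col (1\<^sub>m 2 :: complex mat)"
    then have ij: "i < 2" "j < 2" by auto
    then have "i = 0 \<or> i = 1" "j = 0 \<or> j = 1" by auto
    moreover have "(mat_adjoint pauli_Y * pauli_Y) $$ (i, j) = (\<Sum>k<2. mat_adjoint pauli_Y $$ (i, k) * pauli_Y $$ (k, j))"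
      using ij by (intro mat_mult_index) auto
    ultimately show "(mat_adjoint pauli_Y * pauli_Y) $$ (i, j) = 1\<^sub>m 2 $$ (i, j)"
      using ij carrier_matD[OF pauli_Y_carrier]
      by (auto simp: numeral_2_eq_2 pauli_Y_index Y_entry_def)
  qed (use carrier_matD[OF pauli_Y_carrier] in auto)
  ultimately show ?thesis by (simp add: unitary_group_def)
qed

section \<open>Entrywise criteria for membership in the groups\<close>

lemma form_mult_index:
  assumes "U \<in> carrier_mat N N" "K \<in> carrier_mat N N" "i < N" "j < N"
  shows "(U * K * transpose_mat U) $$ (i, j) = (\<Sum>l<N. \<Sum>k<N. U $$ (i, k) * K $$ (k, l) * U $$ (j, l))"
proof -
  have "(U * K * transpose_mat U) $$ (i, j) = (\<Sum>l<N. (U * K) $$ (i, l) * transpose_mat U $$ (l, j))"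
    using assms by (intro mat_mult_index) auto
  also have "\<dots> = (\<Sum>l<N. (\<Sum>k<N. U $$ (i, k) * K $$ (k, l)) * U $$ (j, l))"
    using assms mat_mult_index[of U N N K N] by (intro sum.cong refl) auto
  finally show ?thesis by (simp add: sum_distrib_right)
qed

lemma unitary_group_rows:
  assumes "U \<in> unitary_group N" "i < N" "j < N"
  shows "(\<Sum>k<N. U $$ (i, k) * cnj (U $$ (j, k))) = (if i = j then 1 else 0)"
proof -
  have "(U * mat_adjoint U) $$ (i, j) = (\<Sum>k<N. U $$ (i, k) * mat_adjoint U $$ (k, j))"
    using assms by (intro mat_mult_index) (auto simp: unitary_group_def)
  also have "\<dots> = (\<Sum>k<N. U $$ (i, k) * cnj (U $$ (j, k)))"
    using assms unitary_group_carrier[OF assms(1)] by (intro sum.cong refl) auto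
  finally show ?thesis using assms by (auto simp: unitary_group_def)
qed

lemma unitary_group_cols:
  assumes "U \<in> unitary_group N" "i < N" "j < N"
  shows "(\<Sum>k<N. cnj (U $$ (k, i)) * U $$ (k, j)) = (if i = j then 1 else 0)"
proof -
  have "(mat_adjoint U * U) $$ (i, j) = (\<Sum>k<N. mat_adjoint U $$ (i, k) * U $$ (k, j))"
    using assms by (intro mat_mult_index) (auto simp: unitary_group_def)
  also have "\<dots> = (\<Sum>k<N. cnj (U $$ (k, i)) * U $$ (k, j))"
    using assms unitary_group_carrier[OF assms(1)] by (intro sum.cong refl) auto
  finally show ?thesis using assms by (auto simp: unitary_group_def)
qed

lemma unitary_groupI:
  assumes "U \<in> carrier_mat N N"
    "\<And>i j. i < N \<Longrightarrow> j < N \<Longrightarrow> (\<Sum>k<N. U $$ (i, k) * cnj (U $$ (j, k))) = (if i = j then 1 else 0)"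
  shows "U \<in> unitary_group N"
proof -
  have "U * mat_adjoint U = 1\<^sub>m N"
  proof (rule eq_matI)
    fix i j assume ij: "i < dim_row (1\<^sub>m N :: complex mat)" "j < dim_col (1\<^sub>m N :: complex mat)"
    have "(U * mat_adjoint U) $$ (i, j) = (\<Sum>k<N. U $$ (i, k) * mat_adjoint U $$ (k, j))"
      using assms ij by (intro mat_mult_index) auto
    also have "\<dots> = (\<Sum>k<N. U $$ (i, k) * cnj (U $$ (j, k)))"
      using assms ij by (intro sum.cong refl) auto
    finally show "(U * mat_adjoint U) $$ (i, j) = 1\<^sub>m N $$ (i, j)" using assms ij by auto
  qed (use assms in auto)
  then show ?thesis
    using assms(1) mat_mult_left_right_inverse[of U N "mat_adjoint U"] by (auto simp: unitary_group_def)
qed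

lemma gate_groupI:
  assumes "U \<in> unitary_group (2 ^ m)"
    "\<And>i j. i < 2 ^ m \<Longrightarrow> j < 2 ^ m \<Longrightarrow>
      (\<Sum>l<2^m. \<Sum>k<2^m. U $$ (i, k) * kron_pow pauli_Y m $$ (k, l) * U $$ (j, l)) = kron_pow pauli_Y m $$ (i, j)"
  shows "U \<in> gate_group m"
proof -
  have c: "U \<in> carrier_mat (2 ^ m) (2 ^ m)" "kron_pow pauli_Y m \<in> carrier_mat (2 ^ m) (2 ^ m)"
    using unitary_group_carrier[OF assms(1)] by simp_all
  have "U * kron_pow pauli_Y m * transpose_mat U = kron_pow pauli_Y m"
    using c by (intro eq_matI) (auto simp: form_mult_index[OF c] assms(2) simp del: index_mult_mat(1))
  then show ?thesis using assms(1) by (simp add: gate_group_def bilinear_isometry_group_def)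
qed

text \<open>The nonzero scalar in front of the form cancels. The whole circuit and its gates thus
  obey the same condition, and every fact about \<open>gate_group\<close> serves both the single
  gates and the Haar measure of the design.\<close>

lemma USp_eq_gate_group: "USp n = gate_group n"
proof -
  have "U * ((\<i> ^ n) \<cdot>\<^sub>m kron_pow pauli_Y n) * transpose_mat U = (\<i> ^ n) \<cdot>\<^sub>m kron_pow pauli_Y n \<longleftrightarrow>
        U * kron_pow pauli_Y n * transpose_mat U = kron_pow pauli_Y n"
    if "U \<in> unitary_group (2 ^ n)" for U
  proof -
    have c: "U \<in> carrier_mat (2 ^ n) (2 ^ n)" "kron_pow pauli_Y n \<in> carrier_mat (2 ^ n) (2 ^ n)"
      using unitary_group_carrier[OF that] by simp_all
    have "U * ((\<i> ^ n) \<cdot>\<^sub>m kron_pow pauli_Y n) * transpose_mat U =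
      (\<i> ^ n) \<cdot>\<^sub>m (U * kron_pow pauli_Y n * transpose_mat U)"
      using c mult_smult_distrib[OF c, of "\<i> ^ n"]
        mult_smult_assoc_mat[OF mult_carrier_mat[OF c], of "transpose_mat U" "2 ^ n" "\<i> ^ n"] by simp
    moreover have "A = B" if "(\<i> ^ n) \<cdot>\<^sub>m A = (\<i> ^ n) \<cdot>\<^sub>m B" for A B :: "complex mat"
    proof -
      have "inverse (\<i> ^ n) \<cdot>\<^sub>m ((\<i> ^ n) \<cdot>\<^sub>m A) = inverse (\<i> ^ n) \<cdot>\<^sub>m ((\<i> ^ n) \<cdot>\<^sub>m B)" using that by simp
      moreover have "inverse (\<i> ^ n) \<cdot>\<^sub>m ((\<i> ^ n) \<cdot>\<^sub>m C) = C" for C :: "complex mat"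
        by (rule eq_matI) auto
      ultimately show ?thesis by simp
    qed
    ultimately show ?thesis by metis
  qed
  then show ?thesis
    by (auto simp: USp_def gate_group_def bilinear_isometry_group_def symplectic_form_def)
qed

text \<open>\<open>\<alpha> + \<beta> X\<^sup>s\<close>, where \<open>X\<^sup>s\<close> is the product of the Paulis \<open>X\<close> on the set bits of \<open>s\<close>.\<close>

definition two_term :: "nat \<Rightarrow> nat \<Rightarrow> complex \<Rightarrow> complex \<Rightarrow> complex mat" where
  "two_term n s \<alpha> \<beta> = mat (2 ^ n) (2 ^ n)
     (\<lambda>(i, j). (if j = i then \<alpha> else 0) + (if j = i XOR s then \<beta> else 0))"

lemma two_term_sum:
  assumes "i < 2 ^ n" "s < 2 ^ n"
  shows "(\<Sum>k<2^n. two_term n s \<alpha> \<beta> $$ (i, k) * f k) = \<alpha> * f i + \<beta> * f (i XOR s)"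
proof -
  have "(\<Sum>k<2^n. two_term n s \<alpha> \<beta> $$ (i, k) * f k) =
    (\<Sum>k<2^n. (if k = i then \<alpha> * f k else 0) + (if k = i XOR s then \<beta> * f k else 0))"
    using assms by (intro sum.cong refl) (auto simp: two_term_def algebra_simps)
  then show ?thesis using assms by (simp add: sum.distrib xor_less_pow2)
qed

text \<open>X^s is a real symmetric involution. With W = \<alpha> + \<beta> X^s, the conditions
  \<open>u\<close> are therefore the two coefficients of W W\<dagger> = 1, and the conditions
  \<open>f\<close> those of W K W^T = K once X^s has been moved past K. Two instances matter:
  \<alpha> = 0 gives the Paulis X^s up to phase, and equal moduli with sign -1 give the rotations of
  the Haar estimate.\<close>

lemma two_term_mem_gate_group:
  assumes s: "s < 2 ^ n"
    and u: "\<alpha> * cnj \<alpha> + \<beta> * cnj \<beta> = 1" "\<alpha> * cnj \<beta> + \<beta> * cnj \<alpha> = 0"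
    and f: "\<alpha> * \<alpha> + popcount_sign n s * (\<beta> * \<beta>) = 1" "\<alpha> * \<beta> * (1 + popcount_sign n s) = 0"
  shows "two_term n s \<alpha> \<beta> \<in> gate_group n"
proof (rule gate_groupI)
  let ?W = "two_term n s \<alpha> \<beta>" and ?K = "kron_pow pauli_Y n"
  show "?W \<in> unitary_group (2 ^ n)"
  proof (rule unitary_groupI)
    show "?W \<in> carrier_mat (2 ^ n) (2 ^ n)" by (simp add: two_term_def)
    fix i j :: nat assume ij: "i < 2 ^ n" "j < 2 ^ n"
    note x = xor_less_pow2[OF ij(1) s]
    have eq: "i = j XOR s \<longleftrightarrow> i XOR s = j" by (metis xor_cancel)
    have eq': "i XOR s = j XOR s \<longleftrightarrow> i = j" by (metis xor_cancel)
    have "(\<Sum>k<2^n. ?W $$ (i, k) * cnj (?W $$ (j, k))) = \<alpha> * cnj (?W $$ (j, i)) + \<beta> * cnj (?W $$ (j, i XOR s))"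
      by (rule two_term_sum[OF ij(1) s])
    also have "\<dots> = (if i = j then \<alpha> * cnj \<alpha> + \<beta> * cnj \<beta> else 0) + (if i XOR s = j then \<alpha> * cnj \<beta> + \<beta> * cnj \<alpha> else 0)"
      using ij x eq eq' by (auto simp: two_term_def algebra_simps)
    finally show "(\<Sum>k<2^n. ?W $$ (i, k) * cnj (?W $$ (j, k))) = (if i = j then 1 else 0)"
      using u by simp
  qed
  fix i j :: nat assume ij: "i < 2 ^ n" "j < 2 ^ n"
  note x = xor_less_pow2[OF ij(1) s] xor_less_pow2[OF ij(2) s]
  have "(\<Sum>l<2^n. \<Sum>k<2^n. ?W $$ (i, k) * ?K $$ (k, l) * ?W $$ (j, l)) =
    (\<Sum>l<2^n. ?W $$ (j, l) * (\<Sum>k<2^n. ?W $$ (i, k) * ?K $$ (k, l)))"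
    by (simp add: sum_distrib_left ac_simps)
  also have "\<dots> = \<alpha> * (\<alpha> * ?K $$ (i, j) + \<beta> * ?K $$ (i XOR s, j)) + \<beta> * (\<alpha> * ?K $$ (i, j XOR s) + \<beta> * ?K $$ (i XOR s, j XOR s))"
    by (simp only: two_term_sum[OF ij(1) s] two_term_sum[OF ij(2) s])
  also have "?K $$ (i XOR s, j) = popcount_sign n s * ?K $$ (i, j XOR s)"
    using ij s by (rule kron_pow_Y_xor)
  also have "?K $$ (i XOR s, j XOR s) = popcount_sign n s * ?K $$ (i, j)"
    using kron_pow_Y_xor[OF ij(1) x(2) s] by simp
  also have "\<alpha> * (\<alpha> * ?K $$ (i, j) + \<beta> * (popcount_sign n s * ?K $$ (i, j XOR s))) +
      \<beta> * (\<alpha> * ?K $$ (i, j XOR s) + \<beta> * (popcount_sign n s * ?K $$ (i, j))) =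
    (\<alpha> * \<alpha> + popcount_sign n s * (\<beta> * \<beta>)) * ?K $$ (i, j) +
    (\<alpha> * \<beta> * (1 + popcount_sign n s)) * ?K $$ (i, j XOR s)"
    by (simp add: algebra_simps)
  finally show "(\<Sum>l<2^n. \<Sum>k<2^n. ?W $$ (i, k) * ?K $$ (k, l) * ?W $$ (j, l)) = ?K $$ (i, j)"
    using f by simp
qed

text \<open>This is \<i> times the Pauli Z on qubit t. Since Z Y Z = -Y, and the phase enters the
  bilinear condition squared, the factor \<i> repairs the sign.\<close>

definition diag_gate :: "nat \<Rightarrow> nat \<Rightarrow> complex mat" where
  "diag_gate n t = mat (2 ^ n) (2 ^ n) (\<lambda>(i, j). if j = i then (if bit i t then - \<i> else \<i>) else 0)"

lemma diag_gate_sum: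
  assumes "i < 2 ^ n"
  shows "(\<Sum>k<2^n. diag_gate n t $$ (i, k) * f k) = (if bit i t then - \<i> else \<i>) * f i"
proof -
  have "(\<Sum>k<2^n. diag_gate n t $$ (i, k) * f k) = (\<Sum>k<2^n. if k = i then (if bit i t then - \<i> else \<i>) * f k else 0)"
    using assms by (intro sum.cong refl) (auto simp: diag_gate_def)
  then show ?thesis using assms by simp
qed

lemma diag_gate_mem_gate_group:
  assumes t: "t < n"
  shows "diag_gate n t \<in> gate_group n"
proof (rule gate_groupI)
  let ?W = "diag_gate n t" and ?K = "kron_pow pauli_Y n"
  show "?W \<in> unitary_group (2 ^ n)"
  proof (rule unitary_groupI)
    show "?W \<in> carrier_mat (2 ^ n) (2 ^ n)" by (simp add: diag_gate_def)
    fix i j :: nat assume ij: "i < 2 ^ n" "j < 2 ^ n"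
    show "(\<Sum>k<2^n. ?W $$ (i, k) * cnj (?W $$ (j, k))) = (if i = j then 1 else 0)"
      unfolding diag_gate_sum[OF ij(1)] using ij by (auto simp: diag_gate_def)
  qed
  fix i j :: nat assume ij: "i < 2 ^ n" "j < 2 ^ n"
  have "(\<Sum>l<2^n. \<Sum>k<2^n. ?W $$ (i, k) * ?K $$ (k, l) * ?W $$ (j, l)) =
    (\<Sum>l<2^n. ?W $$ (j, l) * (\<Sum>k<2^n. ?W $$ (i, k) * ?K $$ (k, l)))"
    by (simp add: sum_distrib_left ac_simps)
  also have "\<dots> = (if bit j t then - \<i> else \<i>) * ((if bit i t then - \<i> else \<i>) * ?K $$ (i, j))"
    by (simp only: diag_gate_sum[OF ij(1)] diag_gate_sum[OF ij(2)])
  also have "\<dots> = ?K $$ (i, j)"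
    using kron_pow_Y_nonzero[OF ij t] by (cases "?K $$ (i, j) = 0") auto
  finally show "(\<Sum>l<2^n. \<Sum>k<2^n. ?W $$ (i, k) * ?K $$ (k, l) * ?W $$ (j, l)) = ?K $$ (i, j)" .
qed

lemma popcount_sign_square: "popcount_sign n s * popcount_sign n s = 1"
  unfolding popcount_sign_def prod.distrib[symmetric] by (rule prod.neutral) auto

lemma popcount_sign_cases: "popcount_sign n s = 1 \<or> popcount_sign n s = -1"
  using popcount_sign_square[of n s] by (metis square_eq_1_iff)

lemma gate_group_unitary: "U \<in> gate_group m \<Longrightarrow> U \<in> unitary_group (2 ^ m)"
  by (simp add: gate_group_def bilinear_isometry_group_def)

lemma square_mult_carrier:
  "A \<in> carrier_mat N N \<Longrightarrow> B \<in> carrier_mat N N \<Longrightarrow> A * B \<in> carrier_mat N N"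
  by (rule mult_carrier_mat)

lemma unitary_group_mult:
  assumes "U \<in> unitary_group N" "V \<in> unitary_group N"
  shows "U * V \<in> unitary_group N"
proof -
  have c: "U \<in> carrier_mat N N" "V \<in> carrier_mat N N"
    "mat_adjoint U \<in> carrier_mat N N" "mat_adjoint V \<in> carrier_mat N N"
    using assms by (auto simp: unitary_group_def)
  have "U * V * (mat_adjoint V * mat_adjoint U) = U * (V * mat_adjoint V) * mat_adjoint U"
    using c by (simp add: assoc_mult_mat[of _ N N _ N _ N] square_mult_carrier[of _ N])
  moreover have "mat_adjoint V * mat_adjoint U * (U * V) = mat_adjoint V * (mat_adjoint U * U) * V"
    using c by (simp add: assoc_mult_mat[of _ N N _ N _ N] square_mult_carrier[of _ N])
  ultimately show ?thesis
    using assms c by (simp add: unitary_group_def mat_adjoint_mult[OF c(1,2)])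
qed

lemma unitary_group_adjoint: "U \<in> unitary_group N \<Longrightarrow> mat_adjoint U \<in> unitary_group N"
  by (auto simp: unitary_group_def)

lemma gate_group_adjoint:
  assumes "U \<in> gate_group m"
  shows "mat_adjoint U \<in> gate_group m"
proof -
  let ?K = "kron_pow pauli_Y m" and ?N = "2 ^ m"
  have u: "U \<in> unitary_group ?N" and e: "U * ?K * transpose_mat U = ?K"
    using assms by (auto simp: gate_group_def bilinear_isometry_group_def)
  have c: "U \<in> carrier_mat ?N ?N" "?K \<in> carrier_mat ?N ?N" "mat_adjoint U \<in> carrier_mat ?N ?N"
    "transpose_mat U \<in> carrier_mat ?N ?N" "transpose_mat (mat_adjoint U) \<in> carrier_mat ?N ?N"
    using unitary_group_carrier[OF u] by auto
  have t: "transpose_mat U * transpose_mat (mat_adjoint U) = 1\<^sub>m ?N"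
    using transpose_mult[OF c(3,1)] u by (simp add: unitary_group_def)
  have "mat_adjoint U * ?K * transpose_mat (mat_adjoint U) =
     mat_adjoint U * (U * ?K * transpose_mat U) * transpose_mat (mat_adjoint U)"
    by (simp add: e)
  also have "\<dots> = (mat_adjoint U * U) * ?K * (transpose_mat U * transpose_mat (mat_adjoint U))"
    using c by (simp add: assoc_mult_mat[of _ ?N ?N _ ?N _ ?N] square_mult_carrier[of _ ?N])
  also have "\<dots> = ?K" using u c t by (simp add: unitary_group_def)
  finally show ?thesis
    using unitary_group_adjoint[OF u] by (simp add: gate_group_def bilinear_isometry_group_def)
qed

lemma one_gate_group: "1\<^sub>m (2 ^ m) \<in> gate_group m"
  using left_mult_one_mat[of "kron_pow pauli_Y m" "2 ^ m" "2 ^ m"] kron_pow_carrier[OF pauli_Y_carrier, of m]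
  by (simp add: gate_group_def bilinear_isometry_group_def one_unitary)

lemma unitary_group_entry_le:
  assumes "U \<in> unitary_group N" "i < N" "j < N"
  shows "cmod (U $$ (i, j)) \<le> 1"
proof -
  have "of_real (\<Sum>k<N. (cmod (U $$ (i, k)))\<^sup>2) = (1 :: complex)"
    using unitary_group_rows[OF assms(1,2,2)] by (simp add: complex_norm_square del: of_real_power)
  then have "(\<Sum>k<N. (cmod (U $$ (i, k)))\<^sup>2) = 1" by (simp only: of_real_eq_1_iff)
  moreover have "(cmod (U $$ (i, j)))\<^sup>2 \<le> (\<Sum>k<N. (cmod (U $$ (i, k)))\<^sup>2)"
    using assms by (intro member_le_sum) auto
  ultimately have "(cmod (U $$ (i, j)))\<^sup>2 \<le> 1\<^sup>2" by simp
  then show ?thesis by (rule power2_le_imp_le) simp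
qed

lemma unitary_group_frobenius:
  assumes "U \<in> unitary_group N"
  shows "(\<Sum>i<N. \<Sum>j<N. (cmod (U $$ (i, j)))\<^sup>2) = real N"
proof -
  have "(\<Sum>k<N. (cmod (U $$ (i, k)))\<^sup>2) = 1" if "i < N" for i
  proof -
    have "of_real (\<Sum>k<N. (cmod (U $$ (i, k)))\<^sup>2) = (1 :: complex)"
      using unitary_group_rows[OF assms that that] by (simp add: complex_norm_square del: of_real_power)
    then show ?thesis by (simp only: of_real_eq_1_iff)
  qed
  then show ?thesis by simp
qed

section \<open>Random unitaries\<close>

lemma space_mat_borel [simp]: "space (mat_borel N) = carrier_mat N N"
  by (simp add: mat_borel_def)

lemma measurable_mat_borel_entry:
  assumes "i < N" "j < N"
  shows "(\<lambda>A. A $$ (i, j)) \<in> borel_measurable (mat_borel N)"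
proof -
  have "(\<lambda>A. \<lambda>p\<in>{..<N} \<times> {..<N}. A $$ p) \<in> carrier_mat N N \<rightarrow> space (\<Pi>\<^sub>M p\<in>{..<N} \<times> {..<N}. (borel :: complex measure))"
    by (auto simp: space_PiM)
  then have "(\<lambda>A. \<lambda>p\<in>{..<N} \<times> {..<N}. A $$ p) \<in> mat_borel N \<rightarrow>\<^sub>M (\<Pi>\<^sub>M p\<in>{..<N} \<times> {..<N}. borel)"
    unfolding mat_borel_def by (rule measurable_vimage_algebra1)
  from measurable_compose[OF this measurable_component_singleton[of "(i, j)"]]
  show ?thesis using assms by simp
qed

lemma measurable_into_mat_borel:
  assumes "\<And>x. x \<in> space M \<Longrightarrow> f x \<in> carrier_mat N N"
    "\<And>i j. i < N \<Longrightarrow> j < N \<Longrightarrow> (\<lambda>x. f x $$ (i, j)) \<in> borel_measurable M"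
  shows "f \<in> M \<rightarrow>\<^sub>M mat_borel N"
  unfolding mat_borel_def
proof (rule measurable_vimage_algebra2)
  show "f \<in> space M \<rightarrow> carrier_mat N N" using assms by auto
  show "(\<lambda>x. \<lambda>p\<in>{..<N} \<times> {..<N}. f x $$ p) \<in> M \<rightarrow>\<^sub>M (\<Pi>\<^sub>M p\<in>{..<N} \<times> {..<N}. borel)"
    by (rule measurable_restrict) (use assms in auto)
qed

text \<open>A sufficient condition for integrability that is closed under ring operations and
  conjugation, hence passes to all polynomials in matrix entries. The bound holds almost everywhere
  because an ensemble lies in its group only almost surely.\<close>

definition bdd_meas :: "'w measure \<Rightarrow> ('w \<Rightarrow> 'b::{real_normed_field,banach,second_countable_topology}) \<Rightarrow> bool" where
  "bdd_meas M f \<longleftrightarrow> f \<in> borel_measurable M \<and> (\<exists>B. AE x in M. norm (f x) \<le> B)"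

lemma bdd_meas_integrable: "finite_measure M \<Longrightarrow> bdd_meas M f \<Longrightarrow> integrable M f"
  unfolding bdd_meas_def by (auto intro: finite_measure.integrable_const_bound)

lemma bdd_meas_const [simp]: "bdd_meas M (\<lambda>x. c)"
  unfolding bdd_meas_def by auto

lemma bdd_meas_add: "bdd_meas M f \<Longrightarrow> bdd_meas M g \<Longrightarrow> bdd_meas M (\<lambda>x. f x + g x)"
  unfolding bdd_meas_def
proof (elim conjE exE, intro conjI)
  fix B C assume "AE x in M. norm (f x) \<le> B" "AE x in M. norm (g x) \<le> C"
  then have "AE x in M. norm (f x + g x) \<le> B + C"
    by eventually_elim (rule norm_triangle_mono)
  then show "\<exists>B. AE x in M. norm (f x + g x) \<le> B" ..
qed auto

lemma bdd_meas_mult: "bdd_meas M f \<Longrightarrow> bdd_meas M g \<Longrightarrow> bdd_meas M (\<lambda>x. f x * g x)"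
  unfolding bdd_meas_def
proof (elim conjE exE, intro conjI)
  fix B C assume "AE x in M. norm (f x) \<le> B" "AE x in M. norm (g x) \<le> C"
  then have "AE x in M. norm (f x * g x) \<le> \<bar>B\<bar> * C"
    by eventually_elim (auto simp: norm_mult intro: mult_mono)
  then show "\<exists>B. AE x in M. norm (f x * g x) \<le> B" ..
qed auto

lemma bdd_meas_sum: "(\<And>i. i \<in> I \<Longrightarrow> bdd_meas M (f i)) \<Longrightarrow> bdd_meas M (\<lambda>x. \<Sum>i\<in>I. f i x)"
  by (induction I rule: infinite_finite_induct) (auto intro: bdd_meas_add)

lemma bdd_meas_cnj: "bdd_meas M f \<Longrightarrow> bdd_meas M (\<lambda>x. cnj (f x))"
  unfolding bdd_meas_def by (auto intro!: borel_measurable_continuous_on[of cnj] continuous_intros)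

lemma bdd_meas_norm_square: "bdd_meas M f \<Longrightarrow> bdd_meas M (\<lambda>x. (cmod (f x))\<^sup>2)"
  unfolding bdd_meas_def
proof (elim conjE exE, intro conjI)
  fix B assume "AE x in M. cmod (f x) \<le> B"
  then have "AE x in M. norm ((cmod (f x))\<^sup>2) \<le> B\<^sup>2"
    by eventually_elim (auto intro: power_mono)
  then show "\<exists>B. AE x in M. norm ((cmod (f x))\<^sup>2) \<le> B" ..
qed auto

lemmas bdd_meas_intros = bdd_meas_const bdd_meas_add bdd_meas_mult bdd_meas_sum bdd_meas_cnj bdd_meas_norm_square

lemma ensemble_on_space: "ensemble_on N G E \<Longrightarrow> space E = carrier_mat N N"
  unfolding ensemble_on_def using sets_eq_imp_space_eq[of E "mat_borel N"] by simp

lemma ensemble_on_prob: "ensemble_on N G E \<Longrightarrow> prob_space E"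
  and ensemble_on_sets: "ensemble_on N G E \<Longrightarrow> sets E = sets (mat_borel N)"
  and ensemble_on_AE: "ensemble_on N G E \<Longrightarrow> AE U in E. U \<in> G"
  unfolding ensemble_on_def by auto

lemma ensemble_on_measurable_entry:
  assumes "ensemble_on N G E" "i < N" "j < N"
  shows "(\<lambda>A. A $$ (i, j)) \<in> borel_measurable E"
  using measurable_mat_borel_entry[OF assms(2,3)] measurable_cong_sets[OF ensemble_on_sets[OF assms(1)] refl]
  by blast

lemma bdd_meas_entry:
  assumes "ensemble_on N G E" "G \<subseteq> unitary_group N" "i < N" "j < N"
  shows "bdd_meas E (\<lambda>A. A $$ (i, j))"
  unfolding bdd_meas_def
proof (intro conjI exI)
  show "AE x in E. cmod (x $$ (i, j)) \<le> 1"
    using ensemble_on_AE[OF assms(1)] by eventually_elim (use assms unitary_group_entry_le in blast)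
qed (rule ensemble_on_measurable_entry[OF assms(1,3,4)])

lemma haar_measure_ensemble: "haar_measure N G \<mu> \<Longrightarrow> ensemble_on N G \<mu>"
  by (simp add: haar_measure_def)

text \<open>A change of variables. It needs translations to be measurable, which holds because the
  entries of a translate are linear in the entries of V.\<close>

lemma haar_integral_translate:
  fixes f :: "complex mat \<Rightarrow> 'b::{banach,second_countable_topology}"
  assumes h: "haar_measure N G \<mu>" and W: "W \<in> G" "W \<in> carrier_mat N N" and f: "f \<in> borel_measurable \<mu>"
  shows "(\<integral>V. f (V * W) \<partial>\<mu>) = (\<integral>V. f V \<partial>\<mu>)" "(\<integral>V. f (W * V) \<partial>\<mu>) = (\<integral>V. f V \<partial>\<mu>)"
proof -
  note e = haar_measure_ensemble[OF h]
  have s: "sets \<mu> = sets (mat_borel N)" by (rule ensemble_on_sets[OF e])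
  have m: "(\<lambda>V. V * W) \<in> \<mu> \<rightarrow>\<^sub>M \<mu>" "(\<lambda>V. W * V) \<in> \<mu> \<rightarrow>\<^sub>M \<mu>"
  proof -
    have "(\<lambda>V. V * W) \<in> \<mu> \<rightarrow>\<^sub>M mat_borel N" "(\<lambda>V. W * V) \<in> \<mu> \<rightarrow>\<^sub>M mat_borel N"
    proof (rule_tac [!] measurable_into_mat_borel)
      fix i j assume ij: "i < N" "j < N"
      have "(\<lambda>V. \<Sum>k<N. V $$ (i, k) * W $$ (k, j)) \<in> borel_measurable \<mu>"
        by (intro borel_measurable_sum borel_measurable_times borel_measurable_const
              ensemble_on_measurable_entry[OF e]) (use ij in auto)
      then show "(\<lambda>V. (V * W) $$ (i, j)) \<in> borel_measurable \<mu>"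
        by (subst measurable_cong[where g = "\<lambda>V. \<Sum>k<N. V $$ (i, k) * W $$ (k, j)"])
           (use W ij ensemble_on_space[OF e] in \<open>auto intro!: mat_mult_index simp del: index_mult_mat(1)\<close>)
      have "(\<lambda>V. \<Sum>k<N. W $$ (i, k) * V $$ (k, j)) \<in> borel_measurable \<mu>"
        by (intro borel_measurable_sum borel_measurable_times borel_measurable_const
              ensemble_on_measurable_entry[OF e]) (use ij in auto)
      then show "(\<lambda>V. (W * V) $$ (i, j)) \<in> borel_measurable \<mu>"
        by (subst measurable_cong[where g = "\<lambda>V. \<Sum>k<N. W $$ (i, k) * V $$ (k, j)"])
           (use W ij ensemble_on_space[OF e] in \<open>auto intro!: mat_mult_index simp del: index_mult_mat(1)\<close>)
    qed (use W ensemble_on_space[OF e] in auto)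
    then show "(\<lambda>V. V * W) \<in> \<mu> \<rightarrow>\<^sub>M \<mu>" "(\<lambda>V. W * V) \<in> \<mu> \<rightarrow>\<^sub>M \<mu>"
      using measurable_cong_sets[OF refl s] by auto
  qed
  show "(\<integral>V. f (V * W) \<partial>\<mu>) = (\<integral>V. f V \<partial>\<mu>)"
    using integral_distr[OF m(1) f] h W by (simp add: haar_measure_def)
  show "(\<integral>V. f (W * V) \<partial>\<mu>) = (\<integral>V. f V \<partial>\<mu>)"
    using integral_distr[OF m(2) f] h W by (simp add: haar_measure_def)
qed

section \<open>The Pauli Z under a Haar-random gate\<close>

text \<open>The matrix V\<dagger> Z V, as a function of its indices.\<close>

definition conj_Z :: "nat \<Rightarrow> complex mat \<Rightarrow> nat \<Rightarrow> nat \<Rightarrow> complex" where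
  "conj_Z N V i j = (\<Sum>k<N. cnj (V $$ (k, i)) * pauli_Z_sign k * V $$ (k, j))"

text \<open>\<open>tr (B V\<^sup>\<dagger>ZV)\<close>.\<close>

definition overlap :: "nat \<Rightarrow> (nat \<Rightarrow> nat \<Rightarrow> complex) \<Rightarrow> complex mat \<Rightarrow> complex" where
  "overlap N B V = (\<Sum>i<N. \<Sum>j<N. B i j * conj_Z N V j i)"

definition Z_mat :: "nat \<Rightarrow> complex mat" where
  "Z_mat N = mat N N (\<lambda>(i, j). if i = j then pauli_Z_sign i else 0)"

lemma Z_mat_mult_index:
  assumes "V \<in> carrier_mat N N" "i < N" "j < N"
  shows "(Z_mat N * V) $$ (i, j) = pauli_Z_sign i * V $$ (i, j)"
proof -
  have "(Z_mat N * V) $$ (i, j) = (\<Sum>k<N. Z_mat N $$ (i, k) * V $$ (k, j))"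
    using assms by (intro mat_mult_index) (auto simp: Z_mat_def)
  also have "\<dots> = (\<Sum>k<N. if k = i then pauli_Z_sign k * V $$ (k, j) else 0)"
    using assms by (intro sum.cong refl) (auto simp: Z_mat_def)
  finally show ?thesis using assms by simp
qed

lemma Z_mat_unitary: "Z_mat N \<in> unitary_group N"
proof (rule unitary_groupI)
  show c: "Z_mat N \<in> carrier_mat N N" by (simp add: Z_mat_def)
  fix i j assume ij: "i < N" "j < N"
  have "(\<Sum>k<N. Z_mat N $$ (i, k) * cnj (Z_mat N $$ (j, k))) = (\<Sum>k<N. if k = i then (if i = j then 1 else 0) else 0)"
    using ij by (intro sum.cong refl) (auto simp: Z_mat_def)
  then show "(\<Sum>k<N. Z_mat N $$ (i, k) * cnj (Z_mat N $$ (j, k))) = (if i = j then 1 else 0)"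
    using ij by simp
qed

lemma conj_Z_mat:
  assumes "V \<in> carrier_mat N N" "i < N" "j < N"
  shows "conj_Z N V i j = (mat_adjoint V * (Z_mat N * V)) $$ (i, j)"
proof -
  have "(mat_adjoint V * (Z_mat N * V)) $$ (i, j) = (\<Sum>k<N. mat_adjoint V $$ (i, k) * (Z_mat N * V) $$ (k, j))"
    using assms by (intro mat_mult_index) (auto simp: Z_mat_def)
  also have "\<dots> = (\<Sum>k<N. cnj (V $$ (k, i)) * (pauli_Z_sign k * V $$ (k, j)))"
    using assms by (intro sum.cong refl) (simp add: Z_mat_mult_index del: index_mult_mat(1))
  finally show ?thesis by (simp add: conj_Z_def mult.assoc)
qed

text \<open>V\<dagger> Z V is itself unitary, so each of its N rows has norm 1.\<close>

lemma conj_Z_frobenius: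
  assumes "V \<in> unitary_group N"
  shows "(\<Sum>i<N. \<Sum>j<N. (cmod (conj_Z N V i j))\<^sup>2) = real N"
proof -
  have "mat_adjoint V * (Z_mat N * V) \<in> unitary_group N"
    using assms by (intro unitary_group_mult unitary_group_adjoint Z_mat_unitary)
  from unitary_group_frobenius[OF this] show ?thesis
    using unitary_group_carrier[OF assms] by (simp add: conj_Z_mat del: index_mult_mat(1))
qed

lemma conj_Z_hermitian: "conj_Z N V j i = cnj (conj_Z N V i j)"
  by (simp add: conj_Z_def ac_simps)

lemma sum_swap_pairs:
  "(\<Sum>i\<in>A. \<Sum>j\<in>B. \<Sum>a\<in>C. \<Sum>b\<in>D. f i j a b) = (\<Sum>a\<in>C. \<Sum>b\<in>D. \<Sum>i\<in>A. \<Sum>j\<in>B. f i j a b)"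
  by (simp only: sum.swap[of _ C B] sum.swap[of _ C A] sum.swap[of _ D B] sum.swap[of _ D A])

lemma sum_mult_sum:
  fixes f g :: "'i \<Rightarrow> 'a::comm_semiring_0"
  shows "(\<Sum>a\<in>A. f a) * z * (\<Sum>b\<in>B. g b) = (\<Sum>a\<in>A. \<Sum>b\<in>B. f a * z * g b)"
  by (simp only: sum_distrib_right[of f A z] sum_product)

lemma conj_Z_mult:
  assumes "V \<in> carrier_mat N N" "W \<in> carrier_mat N N" "i < N" "j < N"
  shows "conj_Z N (V * W) i j = (\<Sum>a<N. \<Sum>b<N. cnj (W $$ (a, i)) * conj_Z N V a b * W $$ (b, j))"
proof -
  have "conj_Z N (V * W) i j = (\<Sum>k<N. (\<Sum>a<N. cnj (V $$ (k, a)) * cnj (W $$ (a, i))) * pauli_Z_sign k *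
      (\<Sum>b<N. V $$ (k, b) * W $$ (b, j)))"
    unfolding conj_Z_def using assms
    by (intro sum.cong refl) (simp add: mat_mult_index[of V N N W N] del: index_mult_mat(1))
  also have "\<dots> = (\<Sum>k<N. \<Sum>a<N. \<Sum>b<N. cnj (W $$ (a, i)) * (cnj (V $$ (k, a)) * pauli_Z_sign k * V $$ (k, b)) * W $$ (b, j))"
    by (simp only: sum_mult_sum) (simp add: ac_simps)
  also have "\<dots> = (\<Sum>a<N. \<Sum>b<N. \<Sum>k<N. cnj (W $$ (a, i)) * (cnj (V $$ (k, a)) * pauli_Z_sign k * V $$ (k, b)) * W $$ (b, j))"
    by (subst sum.swap) (rule sum.cong[OF refl], rule sum.swap)
  finally show ?thesis by (simp add: conj_Z_def sum_distrib_left sum_distrib_right)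
qed

lemma overlap_one: "overlap N B (1\<^sub>m N) = (\<Sum>i<N. pauli_Z_sign i * B i i)"
proof -
  have "conj_Z N (1\<^sub>m N) j i = (if i = j then pauli_Z_sign i else 0)" if "i < N" "j < N" for i j
  proof -
    have "conj_Z N (1\<^sub>m N) j i = (\<Sum>k<N. if k = i then (if i = j then pauli_Z_sign i else 0) else 0)"
      unfolding conj_Z_def using that by (intro sum.cong refl) auto
    then show ?thesis using that by simp
  qed
  then have "overlap N B (1\<^sub>m N) = (\<Sum>i<N. \<Sum>j<N. if j = i then pauli_Z_sign i * B i i else 0)"
    unfolding overlap_def by (intro sum.cong refl) auto
  then show ?thesis by simp
qed

text \<open>The phase of \<open>diag_gate\<close> meets its conjugate, so only the conjugation by
  the Pauli Z on qubit t remains.\<close>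

lemma conj_Z_mult_diag_gate:
  assumes "V \<in> carrier_mat (2 ^ m) (2 ^ m)" "i < 2 ^ m" "j < 2 ^ m"
  shows "conj_Z (2 ^ m) (V * diag_gate m t) i j = (if bit i t = bit j t then 1 else -1) * conj_Z (2 ^ m) V i j"
proof -
  have e: "(V * diag_gate m t) $$ (k, i) = V $$ (k, i) * (if bit i t then - \<i> else \<i>)" if "k < 2 ^ m" "i < 2 ^ m" for k i
  proof -
    have "(V * diag_gate m t) $$ (k, i) = (\<Sum>l<2^m. V $$ (k, l) * diag_gate m t $$ (l, i))"
      using assms that by (intro mat_mult_index) (auto simp: diag_gate_def)
    also have "\<dots> = (\<Sum>l<2^m. if l = i then V $$ (k, i) * (if bit i t then - \<i> else \<i>) else 0)"
      using that by (intro sum.cong refl) (auto simp: diag_gate_def)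
    finally show ?thesis using that by simp
  qed
  show ?thesis
    unfolding conj_Z_def sum_distrib_left using assms
    by (intro sum.cong refl) (simp add: e del: index_mult_mat(1))
qed

lemma conj_Z_mult_shift:
  assumes "V \<in> carrier_mat (2 ^ m) (2 ^ m)" "i < 2 ^ m" "j < 2 ^ m" "s < 2 ^ m" "\<beta> * cnj \<beta> = 1"
  shows "conj_Z (2 ^ m) (V * two_term m s 0 \<beta>) i j = conj_Z (2 ^ m) V (i XOR s) (j XOR s)"
proof -
  have e: "(V * two_term m s 0 \<beta>) $$ (k, i) = V $$ (k, i XOR s) * \<beta>" if "k < 2 ^ m" "i < 2 ^ m" for k i
  proof -
    have t: "two_term m s 0 \<beta> $$ (l, i) = (if l = i XOR s then \<beta> else 0)" if "l < 2 ^ m" for l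
    proof -
      have "i = l XOR s \<longleftrightarrow> l = i XOR s" by (metis xor_cancel)
      then show ?thesis using that \<open>i < 2 ^ m\<close> by (simp add: two_term_def)
    qed
    have "(V * two_term m s 0 \<beta>) $$ (k, i) = (\<Sum>l<2^m. V $$ (k, l) * two_term m s 0 \<beta> $$ (l, i))"
      using assms that by (intro mat_mult_index) (auto simp: two_term_def)
    also have "\<dots> = (\<Sum>l<2^m. if l = i XOR s then V $$ (k, l) * \<beta> else 0)"
      using that by (intro sum.cong refl) (auto simp: t)
    finally show ?thesis using xor_less_pow2[OF that(2) assms(4)] by simp
  qed
  have "cnj (x * \<beta>) * z * (y * \<beta>) = cnj x * z * y" for x y z
    using assms(5) by (simp add: ac_simps)
  then show ?thesis
    unfolding conj_Z_def using assms
    by (intro sum.cong refl) (simp only: e lessThan_iff)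
qed

text \<open>Cyclicity of the trace: tr(B W\<dagger> V\<dagger> Z V W) = tr(W B W\<dagger> V\<dagger>
  Z V).\<close>

lemma overlap_mult:
  assumes "V \<in> carrier_mat N N" "W \<in> carrier_mat N N"
  shows "overlap N B (V * W) = overlap N (\<lambda>b a. \<Sum>i<N. \<Sum>j<N. W $$ (b, i) * B i j * cnj (W $$ (a, j))) V"
proof -
  have "overlap N B (V * W) = (\<Sum>i<N. \<Sum>j<N. \<Sum>a<N. \<Sum>b<N. (W $$ (b, i) * B i j * cnj (W $$ (a, j))) * conj_Z N V a b)"
    unfolding overlap_def using assms
    by (intro sum.cong refl) (simp add: conj_Z_mult sum_distrib_left ac_simps)
  also have "\<dots> = (\<Sum>a<N. \<Sum>b<N. \<Sum>i<N. \<Sum>j<N. (W $$ (b, i) * B i j * cnj (W $$ (a, j))) * conj_Z N V a b)"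
    by (rule sum_swap_pairs)
  also have "\<dots> = (\<Sum>b<N. \<Sum>a<N. \<Sum>i<N. \<Sum>j<N. (W $$ (b, i) * B i j * cnj (W $$ (a, j))) * conj_Z N V a b)"
    by (rule sum.swap)
  finally show ?thesis by (simp add: overlap_def sum_distrib_right)
qed

lemma bdd_meas_conj_Z:
  assumes "ensemble_on N G E" "G \<subseteq> unitary_group N" "i < N" "j < N"
  shows "bdd_meas E (\<lambda>V. conj_Z N V i j)"
  unfolding conj_Z_def by (intro bdd_meas_intros bdd_meas_entry[OF assms(1,2)]) (use assms in auto)

lemma bdd_meas_overlap:
  assumes "ensemble_on N G E" "G \<subseteq> unitary_group N"
  shows "bdd_meas E (overlap N B)"
  unfolding overlap_def[abs_def] by (intro bdd_meas_intros bdd_meas_conj_Z[OF assms]) auto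

section \<open>Second moments of the overlap under Haar measure\<close>

definition mean_overlap :: "nat \<Rightarrow> complex mat measure \<Rightarrow> (nat \<Rightarrow> nat \<Rightarrow> complex) \<Rightarrow> real" where
  "mean_overlap N \<mu> B = (\<integral>V. (cmod (overlap N B V))\<^sup>2 \<partial>\<mu>)"

lemma norm_square_average_le:
  fixes f :: "'i \<Rightarrow> complex"
  assumes "finite S" "S \<noteq> {}" "\<And>s. s \<in> S \<Longrightarrow> cmod (c s) \<le> 1"
  shows "(cmod ((\<Sum>s\<in>S. c s * f s) / of_nat (card S)))\<^sup>2 \<le> (\<Sum>s\<in>S. (cmod (f s))\<^sup>2) / real (card S)"
proof -
  have n: "real (card S) > 0" using assms by (simp add: card_gt_0_iff)
  have "cmod (\<Sum>s\<in>S. c s * f s) \<le> (\<Sum>s\<in>S. cmod (f s) * 1)"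
    by (rule sum_norm_le) (use assms in \<open>auto simp: norm_mult intro!: mult_left_le_one_le\<close>)
  then have "(cmod (\<Sum>s\<in>S. c s * f s))\<^sup>2 \<le> (\<Sum>s\<in>S. cmod (f s) * 1)\<^sup>2"
    by (rule power_mono) simp
  also have "\<dots> \<le> (\<Sum>s\<in>S. (cmod (f s))\<^sup>2) * (\<Sum>s\<in>S. 1\<^sup>2)"
    by (rule Cauchy_Schwarz_ineq_sum)
  finally have "(cmod (\<Sum>s\<in>S. c s * f s))\<^sup>2 \<le> (\<Sum>s\<in>S. (cmod (f s))\<^sup>2) * real (card S)"
    by simp
  then show ?thesis
    using n by (simp add: norm_divide power_divide pos_divide_le_eq) (simp add: power2_eq_square)
qed

text \<open>By right invariance every translate \<open>V * W s\<close> has the same second moment,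
  and the squared modulus of an average is at most the average of the squared moduli. Replacing B by
  a weighted average of its conjugates under the group can therefore only lower the second moment,
  which is the right direction for a lower bound.\<close>

lemma mean_overlap_average_le:
  assumes h: "haar_measure N G \<mu>" and G: "G \<subseteq> unitary_group N"
    and S: "finite S" "S \<noteq> {}" "\<And>s. s \<in> S \<Longrightarrow> W s \<in> G" "\<And>s. s \<in> S \<Longrightarrow> cmod (c s) \<le> 1"
    and B: "\<And>V. V \<in> carrier_mat N N \<Longrightarrow>
      overlap N B' V = (\<Sum>s\<in>S. c s * overlap N B (V * W s)) / of_nat (card S)"
  shows "mean_overlap N \<mu> B' \<le> mean_overlap N \<mu> B"
proof -
  note e = haar_measure_ensemble[OF h]
  have fin: "finite_measure \<mu>" using ensemble_on_prob[OF e] by (simp add: prob_space_def)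
  have Wc: "W s \<in> carrier_mat N N" if "s \<in> S" for s
    using S(3)[OF that] G unitary_group_carrier by blast
  have bm: "bdd_meas \<mu> (\<lambda>V. (cmod (overlap N B V))\<^sup>2)" for B
    by (intro bdd_meas_norm_square bdd_meas_overlap[OF e G])
  have int: "integrable \<mu> (\<lambda>V. (cmod (overlap N B (V * W s)))\<^sup>2)" if "s \<in> S" for s
  proof -
    let ?B = "\<lambda>b a. \<Sum>i<N. \<Sum>j<N. W s $$ (b, i) * B i j * cnj (W s $$ (a, j))"
    have "integrable \<mu> (\<lambda>V. (cmod (overlap N ?B V))\<^sup>2)"
      by (rule bdd_meas_integrable[OF fin bm])
    moreover have "integrable \<mu> (\<lambda>V. (cmod (overlap N B (V * W s)))\<^sup>2) \<longleftrightarrow> integrable \<mu> (\<lambda>V. (cmod (overlap N ?B V))\<^sup>2)"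
      by (rule Bochner_Integration.integrable_cong[OF refl]) (use ensemble_on_space[OF e] Wc[OF that] in \<open>auto simp: overlap_mult\<close>)
    ultimately show ?thesis by simp
  qed
  have "mean_overlap N \<mu> B' \<le> (\<integral>V. (\<Sum>s\<in>S. (cmod (overlap N B (V * W s)))\<^sup>2) / real (card S) \<partial>\<mu>)"
    unfolding mean_overlap_def
  proof (rule integral_mono)
    show "integrable \<mu> (\<lambda>V. (cmod (overlap N B' V))\<^sup>2)" by (rule bdd_meas_integrable[OF fin bm])
    show "integrable \<mu> (\<lambda>V. (\<Sum>s\<in>S. (cmod (overlap N B (V * W s)))\<^sup>2) / real (card S))"
      using int by auto
    fix V assume "V \<in> space \<mu>"
    then show "(cmod (overlap N B' V))\<^sup>2 \<le> (\<Sum>s\<in>S. (cmod (overlap N B (V * W s)))\<^sup>2) / real (card S)"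
      using norm_square_average_le[OF S(1,2,4)] by (simp add: B ensemble_on_space[OF e])
  qed
  also have "\<dots> = (\<Sum>s\<in>S. (\<integral>V. (cmod (overlap N B (V * W s)))\<^sup>2 \<partial>\<mu>)) / real (card S)"
    using int by simp
  also have "\<dots> = (\<Sum>s\<in>S. mean_overlap N \<mu> B) / real (card S)"
    unfolding mean_overlap_def
    by (intro arg_cong2[where f = "(/)"] sum.cong refl haar_integral_translate(1)[OF h])
       (use S Wc bm[unfolded bdd_meas_def] in auto)
  also have "\<dots> = mean_overlap N \<mu> B" using S by simp
  finally show ?thesis .
qed

lemma gate_group_subset_unitary: "gate_group m \<subseteq> unitary_group (2 ^ m)"
  using gate_group_unitary by blast

lemma nat_eq_of_bits:
  assumes "(i::nat) < 2 ^ m" "j < 2 ^ m" "\<And>u. u < m \<Longrightarrow> bit i u = bit j u"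
  shows "i = j"
proof -
  have "take_bit m i = take_bit m j" using assms(3) by (auto simp: bit_eq_iff bit_take_bit_iff)
  then show ?thesis using assms(1,2) by (simp add: take_bit_nat_eq_self)
qed

text \<open>Averaging over the identity and \<open>diag_gate m t\<close> deletes the entries of B
  whose indices differ in bit t. One such average per bit leaves, at t = m, only the diagonal of
  B.\<close>

lemma mean_overlap_pinch:
  assumes h: "haar_measure (2 ^ m) (gate_group m) \<mu>" and "t \<le> m"
  shows "mean_overlap (2 ^ m) \<mu> (\<lambda>i j. if \<forall>u<t. bit i u = bit j u then B i j else 0) \<le> mean_overlap (2 ^ m) \<mu> B"
  using assms(2)
proof (induction t)
  case 0
  then show ?case by simp
next
  case (Suc t)
  let ?B = "\<lambda>t i j. if \<forall>u<t. bit i u = bit j u then B i j else 0"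
  define W where "W s = (if s then diag_gate m t else 1\<^sub>m (2 ^ m))" for s
  have "mean_overlap (2 ^ m) \<mu> (?B (Suc t)) \<le> mean_overlap (2 ^ m) \<mu> (?B t)"
  proof (rule mean_overlap_average_le[OF h gate_group_subset_unitary, where S = UNIV and W = W and c = "\<lambda>_. 1"])
    show "W s \<in> gate_group m" for s
      using Suc.prems by (auto simp: W_def one_gate_group diag_gate_mem_gate_group)
    fix V :: "complex mat" assume V: "V \<in> carrier_mat (2 ^ m) (2 ^ m)"
    have "overlap (2 ^ m) (?B (Suc t)) V =
      (overlap (2 ^ m) (?B t) V + overlap (2 ^ m) (?B t) (V * diag_gate m t)) / 2"
      unfolding overlap_def sum.distrib[symmetric] sum_divide_distrib using V
      by (intro sum.cong refl) (auto simp: conj_Z_mult_diag_gate less_Suc_eq)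
    then show "overlap (2 ^ m) (?B (Suc t)) V = (\<Sum>s\<in>UNIV. 1 * overlap (2 ^ m) (?B t) (V * W s)) / of_nat (card (UNIV :: bool set))"
      using V by (simp add: UNIV_bool W_def add.commute)
  qed auto
  with Suc show ?case by simp
qed

lemma sum_xor:
  fixes f :: "nat \<Rightarrow> 'a::comm_monoid_add"
  assumes "i < 2 ^ m"
  shows "(\<Sum>s<2^m. f (i XOR s)) = (\<Sum>k<2^m. f k)"
  by (rule sum.reindex_bij_witness[where i = "\<lambda>k. i XOR k" and j = "\<lambda>s. i XOR s"])
     (use assms in \<open>auto simp: xor_less_pow2 simp flip: xor.assoc\<close>)

text \<open>X^s preserves the form up to the sign \<open>popcount_sign m s\<close>; if the sign is
  -1, the phase \<i> compensates it, and it cancels again in conjugations.\<close>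

lemma shift_mem_gate_group:
  assumes "s < 2 ^ m"
  obtains \<beta> where "two_term m s 0 \<beta> \<in> gate_group m" "\<beta> * cnj \<beta> = 1"
proof -
  have "two_term m s 0 (if popcount_sign m s = 1 then 1 else \<i>) \<in> gate_group m"
    using popcount_sign_cases[of m s] by (intro two_term_mem_gate_group[OF assms]) auto
  then show ?thesis by (rule that) auto
qed

text \<open>Twirling by the Paulis, which lie in the gate group up to a phase, projects \<open>B\<close> onto its
  component along the Pauli \<open>Z\<close>.\<close>

lemma mean_overlap_twirl:
  assumes h: "haar_measure (2 ^ m) (gate_group m) \<mu>"
    and b: "b = (\<Sum>i<2^m. pauli_Z_sign i * B i i) / 2 ^ m"
  shows "mean_overlap (2 ^ m) \<mu> (\<lambda>i j. if i = j then b * pauli_Z_sign i else 0) \<le> mean_overlap (2 ^ m) \<mu> B"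
proof -
  let ?D = "\<lambda>i j. if \<forall>u<m. bit i u = bit j u then B i j else 0"
  have diag: "overlap (2 ^ m) (\<lambda>i j. if i = j then f i else 0) V = (\<Sum>i<2^m. f i * conj_Z (2 ^ m) V i i)" for f V
  proof -
    have "overlap (2 ^ m) (\<lambda>i j. if i = j then f i else 0) V =
      (\<Sum>i<2^m. \<Sum>j<2^m. if j = i then f i * conj_Z (2 ^ m) V i i else 0)"
      unfolding overlap_def by (intro sum.cong refl) auto
    then show ?thesis by simp
  qed
  have D: "overlap (2 ^ m) ?D V = (\<Sum>i<2^m. B i i * conj_Z (2 ^ m) V i i)" for V
    unfolding diag[symmetric] overlap_def
    by (intro sum.cong refl arg_cong2[where f = "(*)"]) (auto dest: nat_eq_of_bits)
  have "\<forall>s\<in>{..<2^m}. \<exists>\<beta>. two_term m s 0 \<beta> \<in> gate_group m \<and> \<beta> * cnj \<beta> = 1"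
    by (auto elim: shift_mem_gate_group)
  then obtain \<beta> where \<beta>: "\<And>s. s < 2 ^ m \<Longrightarrow> two_term m s 0 (\<beta> s) \<in> gate_group m"
    "\<And>s. s < 2 ^ m \<Longrightarrow> \<beta> s * cnj (\<beta> s) = 1"
    unfolding bchoice_iff by auto
  \<comment> \<open>The weight \<open>pauli_Z_sign s\<close> is the sign with which X^s commutes
    past Z. Averaging the shifted diagonals against this character retains exactly the component
    along Z, with coefficient b = tr(B Z) / 2^m.\<close>
  have "mean_overlap (2 ^ m) \<mu> (\<lambda>i j. if i = j then b * pauli_Z_sign i else 0) \<le> mean_overlap (2 ^ m) \<mu> ?D"
  proof (rule mean_overlap_average_le[OF h gate_group_subset_unitary, where S = "{..<2^m}"
        and W = "\<lambda>s. two_term m s 0 (\<beta> s)" and c = pauli_Z_sign])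
    fix V :: "complex mat" assume V: "V \<in> carrier_mat (2 ^ m) (2 ^ m)"
    have "(\<Sum>s<2^m. pauli_Z_sign s * overlap (2 ^ m) ?D (V * two_term m s 0 (\<beta> s))) =
      (\<Sum>s<2^m. \<Sum>i<2^m. pauli_Z_sign s * (B (i XOR s) (i XOR s) * conj_Z (2 ^ m) V i i))"
    proof (rule sum.cong[OF refl])
      fix s :: nat assume s: "s \<in> {..<2^m}"
      have "overlap (2 ^ m) ?D (V * two_term m s 0 (\<beta> s)) =
        (\<Sum>i<2^m. B i i * conj_Z (2 ^ m) V (i XOR s) (i XOR s))"
        unfolding D using V s \<beta>(2) by (intro sum.cong refl) (simp add: conj_Z_mult_shift)
      also have "\<dots> = (\<Sum>i<2^m. B (i XOR s) (i XOR s) * conj_Z (2 ^ m) V i i)"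
        by (rule sum.reindex_bij_witness[where i = "\<lambda>i. i XOR s" and j = "\<lambda>i. i XOR s"])
           (use s in \<open>auto simp: xor_less_pow2\<close>)
      finally show "pauli_Z_sign s * overlap (2 ^ m) ?D (V * two_term m s 0 (\<beta> s)) =
        (\<Sum>i<2^m. pauli_Z_sign s * (B (i XOR s) (i XOR s) * conj_Z (2 ^ m) V i i))"
        by (simp add: sum_distrib_left)
    qed
    also have "\<dots> = (\<Sum>i<2^m. (\<Sum>s<2^m. pauli_Z_sign s * B (i XOR s) (i XOR s)) * conj_Z (2 ^ m) V i i)"
      by (subst sum.swap) (simp add: sum_distrib_right mult.assoc)
    also have "\<dots> = (\<Sum>i<2^m. 2 ^ m * (b * pauli_Z_sign i) * conj_Z (2 ^ m) V i i)"
    proof (intro sum.cong refl arg_cong2[where f = "(*)"])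
      fix i :: nat assume i: "i \<in> {..<2^m}"
      have "pauli_Z_sign s = pauli_Z_sign i * pauli_Z_sign (i XOR s)" for s
        by (simp add: pauli_Z_sign_xor flip: mult.assoc)
      then have "(\<Sum>s<2^m. pauli_Z_sign s * B (i XOR s) (i XOR s)) =
        (\<Sum>s<2^m. pauli_Z_sign i * (pauli_Z_sign (i XOR s) * B (i XOR s) (i XOR s)))"
        by (intro sum.cong refl) (metis mult.assoc)
      also have "\<dots> = pauli_Z_sign i * (\<Sum>s<2^m. pauli_Z_sign (i XOR s) * B (i XOR s) (i XOR s))"
        by (simp only: sum_distrib_left)
      also have "(\<Sum>s<2^m. pauli_Z_sign (i XOR s) * B (i XOR s) (i XOR s)) = (\<Sum>k<2^m. pauli_Z_sign k * B k k)"
        using i by (intro sum_xor) auto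
      finally show "(\<Sum>s<2^m. pauli_Z_sign s * B (i XOR s) (i XOR s)) = 2 ^ m * (b * pauli_Z_sign i)"
        by (simp add: b)
    qed
    finally show "overlap (2 ^ m) (\<lambda>i j. if i = j then b * pauli_Z_sign i else 0) V =
      (\<Sum>s<2^m. pauli_Z_sign s * overlap (2 ^ m) ?D (V * two_term m s 0 (\<beta> s))) / of_nat (card {..<(2::nat)^m})"
      by (simp add: diag mult.assoc flip: sum_distrib_left)
  qed (use \<beta> in \<open>auto intro: order_refl simp: lessThan_empty_iff\<close>)
  also have "\<dots> \<le> mean_overlap (2 ^ m) \<mu> B"
    by (rule mean_overlap_pinch[OF h order_refl])
  finally show ?thesis .
qed

text \<open>Cyclicity moves W from the operator to the argument V, where right invariance under the
  adjoint of W removes it. Since W is arbitrary in the group, one may afterwards average over it as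
  well.\<close>

lemma mean_overlap_conj_Z:
  assumes h: "haar_measure (2 ^ m) (gate_group m) \<mu>" and W: "W \<in> gate_group m"
  shows "mean_overlap (2 ^ m) \<mu> (conj_Z (2 ^ m) W) = mean_overlap (2 ^ m) \<mu> (\<lambda>i j. if i = j then pauli_Z_sign i else 0)"
proof -
  let ?Z = "\<lambda>i j. if i = j then pauli_Z_sign i else (0::complex)"
  note e = haar_measure_ensemble[OF h]
  have Wc: "W \<in> carrier_mat (2 ^ m) (2 ^ m)" "mat_adjoint W \<in> carrier_mat (2 ^ m) (2 ^ m)"
    using unitary_group_carrier[OF gate_group_unitary[OF W]] by simp_all
  have "overlap (2 ^ m) ?Z (V * mat_adjoint W) = overlap (2 ^ m) (conj_Z (2 ^ m) W) V"
    if "V \<in> carrier_mat (2 ^ m) (2 ^ m)" for V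
  proof -
    have "(\<Sum>i<2^m. \<Sum>j<2^m. mat_adjoint W $$ (b, i) * ?Z i j * cnj (mat_adjoint W $$ (a, j))) = conj_Z (2 ^ m) W b a"
      if "a < 2 ^ m" "b < 2 ^ m" for a b
    proof -
      have "(\<Sum>i<2^m. \<Sum>j<2^m. mat_adjoint W $$ (b, i) * ?Z i j * cnj (mat_adjoint W $$ (a, j))) =
        (\<Sum>i<2^m. \<Sum>j<2^m. if j = i then cnj (W $$ (i, b)) * pauli_Z_sign i * W $$ (i, a) else 0)"
        using that Wc by (intro sum.cong refl) auto
      then show ?thesis by (simp add: conj_Z_def)
    qed
    then show ?thesis
      unfolding overlap_mult[OF that Wc(2)] by (simp add: overlap_def)
  qed
  then have "mean_overlap (2 ^ m) \<mu> (conj_Z (2 ^ m) W) = (\<integral>V. (cmod (overlap (2 ^ m) ?Z (V * mat_adjoint W)))\<^sup>2 \<partial>\<mu>)"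
    unfolding mean_overlap_def
    by (intro Bochner_Integration.integral_cong refl) (simp add: ensemble_on_space[OF e])
  also have "\<dots> = mean_overlap (2 ^ m) \<mu> ?Z"
    unfolding mean_overlap_def
    by (rule haar_integral_translate(1)[OF h gate_group_adjoint[OF W] Wc(2)])
       (use bdd_meas_norm_square[OF bdd_meas_overlap[OF e gate_group_subset_unitary]] in \<open>auto simp: bdd_meas_def\<close>)
  finally show ?thesis .
qed

text \<open>With \<open>C = \<integral> |V\<^sup>\<dagger>ZV\<rangle>\<langle>V\<^sup>\<dagger>ZV|\<close>, invariance turns the mean return probability into the purity
  of \<open>C\<close>, which is at least the squared trace of \<open>C\<close> over its dimension.\<close>

lemma mean_overlap_Z_ge_1:
  assumes h: "haar_measure (2 ^ m) (gate_group m) \<mu>"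
  shows "mean_overlap (2 ^ m) \<mu> (\<lambda>i j. if i = j then pauli_Z_sign i else 0) \<ge> 1"
proof -
  define q where "q = mean_overlap (2 ^ m) \<mu> (\<lambda>i j. if i = j then pauli_Z_sign i else 0)"
  define P where "P = {..<(2::nat) ^ m} \<times> {..<(2::nat) ^ m}"
  define a where "a x V = conj_Z (2 ^ m) V (fst x) (snd x)" for x V
  define C where "C x y = (\<integral>V. a x V * cnj (a y V) \<partial>\<mu>)" for x y
  note e = haar_measure_ensemble[OF h]
  interpret prob_space \<mu> by (rule ensemble_on_prob[OF e])
  note bdd = bdd_meas_integrable[OF finite_measure_axioms]
  have ba: "bdd_meas \<mu> (a x)" if "x \<in> P" for x
    using that unfolding a_def[abs_def] P_def
    by (auto intro: bdd_meas_conj_Z[OF e gate_group_subset_unitary])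
  have C_cnj: "C y x = cnj (C x y)" for x y
    unfolding C_def Bochner_Integration.integral_cnj[symmetric] by (simp add: mult.commute)
  have ov: "overlap (2 ^ m) (conj_Z (2 ^ m) W) V = (\<Sum>x\<in>P. a x W * cnj (a x V))" for V W
    unfolding overlap_def P_def a_def sum.cartesian_product
    by (intro sum.cong refl) (auto simp flip: conj_Z_hermitian)
  \<comment> \<open>The value q does not depend on W. Integrating this identity over a second
    Haar-random W turns the factor \<open>a x W * cnj (a y W)\<close> into \<open>C x y\<close>, and
    the right side into the purity of C.\<close>
  have "complex_of_real q = (\<Sum>x\<in>P. \<Sum>y\<in>P. (a x W * cnj (a y W)) * C y x)" if W: "W \<in> gate_group m" for W
  proof -
    have sq: "complex_of_real ((cmod (overlap (2 ^ m) (conj_Z (2 ^ m) W) V))\<^sup>2) =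
      (\<Sum>x\<in>P. \<Sum>y\<in>P. (a x W * cnj (a y W)) * (a y V * cnj (a x V)))" for V
      unfolding complex_norm_square ov cnj_sum sum_product
      by (intro sum.cong refl) (simp add: ac_simps)
    have "complex_of_real q = complex_of_real (mean_overlap (2 ^ m) \<mu> (conj_Z (2 ^ m) W))"
      unfolding q_def mean_overlap_conj_Z[OF h W] ..
    also have "\<dots> = (\<integral>V. complex_of_real ((cmod (overlap (2 ^ m) (conj_Z (2 ^ m) W) V))\<^sup>2) \<partial>\<mu>)"
      unfolding mean_overlap_def by (rule integral_complex_of_real[symmetric])
    also have "\<dots> = (\<Sum>x\<in>P. \<integral>V. (\<Sum>y\<in>P. (a x W * cnj (a y W)) * (a y V * cnj (a x V))) \<partial>\<mu>)"
      unfolding sq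
      by (rule Bochner_Integration.integral_sum, rule bdd) (intro bdd_meas_intros ba)
    also have "\<dots> = (\<Sum>x\<in>P. \<Sum>y\<in>P. \<integral>V. (a x W * cnj (a y W)) * (a y V * cnj (a x V)) \<partial>\<mu>)"
      by (intro sum.cong refl Bochner_Integration.integral_sum, rule bdd) (intro bdd_meas_intros ba)
    finally show ?thesis by (simp add: C_def)
  qed
  then have "AE W in \<mu>. complex_of_real q = (\<Sum>x\<in>P. \<Sum>y\<in>P. (a x W * cnj (a y W)) * C y x)"
    using ensemble_on_AE[OF e] by auto
  moreover have bs: "bdd_meas \<mu> (\<lambda>W. \<Sum>x\<in>P. \<Sum>y\<in>P. (a x W * cnj (a y W)) * C y x)"
    by (intro bdd_meas_intros ba)
  ultimately have "(\<integral>W. complex_of_real q \<partial>\<mu>) = (\<integral>W. (\<Sum>x\<in>P. \<Sum>y\<in>P. (a x W * cnj (a y W)) * C y x) \<partial>\<mu>)"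
    by (intro integral_cong_AE) (auto simp: bdd_meas_def)
  also have "\<dots> = (\<Sum>x\<in>P. \<integral>W. (\<Sum>y\<in>P. (a x W * cnj (a y W)) * C y x) \<partial>\<mu>)"
    by (rule Bochner_Integration.integral_sum, rule bdd) (intro bdd_meas_intros ba)
  also have "\<dots> = (\<Sum>x\<in>P. \<Sum>y\<in>P. \<integral>W. (a x W * cnj (a y W)) * C y x \<partial>\<mu>)"
    by (intro sum.cong refl Bochner_Integration.integral_sum, rule bdd) (intro bdd_meas_intros ba)
  also have "\<dots> = (\<Sum>x\<in>P. \<Sum>y\<in>P. complex_of_real ((cmod (C x y))\<^sup>2))"
  proof (intro sum.cong refl)
    fix x y assume "x \<in> P" "y \<in> P"
    have "(\<integral>W. (a x W * cnj (a y W)) * C y x \<partial>\<mu>) = C x y * C y x"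
      unfolding C_def[of x y] by simp
    then show "(\<integral>W. (a x W * cnj (a y W)) * C y x \<partial>\<mu>) = complex_of_real ((cmod (C x y))\<^sup>2)"
      unfolding complex_norm_square C_cnj[of y x] .
  qed
  finally have "complex_of_real q = complex_of_real (\<Sum>x\<in>P. \<Sum>y\<in>P. (cmod (C x y))\<^sup>2)"
    by (simp add: prob_space)
  then have q: "q = (\<Sum>x\<in>P. \<Sum>y\<in>P. (cmod (C x y))\<^sup>2)" by (simp only: of_real_eq_iff)
  have Cxx: "C x x = complex_of_real (\<integral>V. (cmod (a x V))\<^sup>2 \<partial>\<mu>)" for x
    unfolding C_def complex_norm_square[symmetric] by (rule integral_complex_of_real)
  have "(\<Sum>x\<in>P. \<integral>V. (cmod (a x V))\<^sup>2 \<partial>\<mu>) = (\<integral>V. (\<Sum>x\<in>P. (cmod (a x V))\<^sup>2) \<partial>\<mu>)"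
    by (rule Bochner_Integration.integral_sum[symmetric], rule bdd) (intro bdd_meas_intros ba)
  also have "\<dots> = (\<integral>V. 2 ^ m \<partial>\<mu>)"
  proof (rule integral_cong_AE)
    have "bdd_meas \<mu> (\<lambda>V. \<Sum>x\<in>P. (cmod (a x V))\<^sup>2)" by (intro bdd_meas_intros ba)
    then show "(\<lambda>V. \<Sum>x\<in>P. (cmod (a x V))\<^sup>2) \<in> borel_measurable \<mu>" by (simp add: bdd_meas_def)
    show "AE V in \<mu>. (\<Sum>x\<in>P. (cmod (a x V))\<^sup>2) = 2 ^ m"
      using ensemble_on_AE[OF e]
    proof eventually_elim
      case (elim V)
      then have "(\<Sum>i<2^m. \<Sum>j<2^m. (cmod (conj_Z (2 ^ m) V i j))\<^sup>2) = real (2 ^ m)"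
        by (intro conj_Z_frobenius gate_group_unitary)
      then show ?case by (simp add: P_def a_def sum.cartesian_product case_prod_beta)
    qed
  qed auto
  finally have tr: "(\<Sum>x\<in>P. \<integral>V. (cmod (a x V))\<^sup>2 \<partial>\<mu>) = 2 ^ m" by (simp add: prob_space)
  \<comment> \<open>The diagonal of C has 4^m entries with sum 2^m, so its squares alone contribute
    at least (2^m)^2 / 4^m = 1 to the purity.\<close>
  have "(\<Sum>x\<in>P. (\<integral>V. (cmod (a x V))\<^sup>2 \<partial>\<mu>) * 1)\<^sup>2 \<le> (\<Sum>x\<in>P. (\<integral>V. (cmod (a x V))\<^sup>2 \<partial>\<mu>)\<^sup>2) * (\<Sum>x\<in>P. 1\<^sup>2)"
    by (rule Cauchy_Schwarz_ineq_sum)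
  also have "(\<Sum>x\<in>P. (\<integral>V. (cmod (a x V))\<^sup>2 \<partial>\<mu>)\<^sup>2) \<le> q"
    unfolding q
  proof (rule sum_mono)
    fix x assume x: "x \<in> P"
    have "(\<integral>V. (cmod (a x V))\<^sup>2 \<partial>\<mu>)\<^sup>2 = (cmod (C x x))\<^sup>2" by (simp add: Cxx)
    also have "\<dots> \<le> (\<Sum>y\<in>P. (cmod (C x y))\<^sup>2)"
      by (rule member_le_sum) (use x in \<open>auto simp: P_def\<close>)
    finally show "(\<integral>V. (cmod (a x V))\<^sup>2 \<partial>\<mu>)\<^sup>2 \<le> (\<Sum>y\<in>P. (cmod (C x y))\<^sup>2)" .
  qed
  finally have "((2::real) ^ m)\<^sup>2 \<le> q * (2 ^ m)\<^sup>2"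
    by (simp add: tr) (simp add: P_def power2_eq_square)
  then show ?thesis unfolding q_def[symmetric] by simp
qed

text \<open>Twirling reduces B to b Z with b = tr(B Z) / 2^m, and the operator Z has second moment
  at least 1. The numerator on the left is |tr(B Z)|^2, written as the overlap at V = 1 so that
  gates which are the identity fit the same bound.\<close>

lemma mean_overlap_ge:
  assumes h: "haar_measure (2 ^ m) (gate_group m) \<mu>"
  shows "(cmod (overlap (2 ^ m) B (1\<^sub>m (2 ^ m))))\<^sup>2 / (2 ^ m)\<^sup>2 \<le> mean_overlap (2 ^ m) \<mu> B"
proof -
  define b where "b = (\<Sum>i<2^m. pauli_Z_sign i * B i i) / 2 ^ m"
  have "overlap (2 ^ m) (\<lambda>i j. if i = j then b * pauli_Z_sign i else 0) V =
      b * overlap (2 ^ m) (\<lambda>i j. if i = j then pauli_Z_sign i else 0) V" for V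
    unfolding overlap_def sum_distrib_left by (intro sum.cong refl) auto
  then have "mean_overlap (2 ^ m) \<mu> (\<lambda>i j. if i = j then b * pauli_Z_sign i else 0) =
     (cmod b)\<^sup>2 * mean_overlap (2 ^ m) \<mu> (\<lambda>i j. if i = j then pauli_Z_sign i else 0)"
    by (simp add: mean_overlap_def norm_mult power_mult_distrib)
  moreover have "(cmod b)\<^sup>2 * 1 \<le> (cmod b)\<^sup>2 * mean_overlap (2 ^ m) \<mu> (\<lambda>i j. if i = j then pauli_Z_sign i else 0)"
    by (intro mult_left_mono mean_overlap_Z_ge_1[OF h]) simp
  moreover have "(cmod b)\<^sup>2 = (cmod (overlap (2 ^ m) B (1\<^sub>m (2 ^ m))))\<^sup>2 / (2 ^ m)\<^sup>2"
    by (simp add: b_def overlap_one norm_divide power_divide norm_power)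
  ultimately show ?thesis
    using mean_overlap_twirl[where B = B and b = b, OF h b_def] by linarith
qed

section \<open>Brickworks\<close>

lemma restrict_bits_less: "restrict_bits a i < 2 ^ card a"
proof -
  have "take_bit (card a) (restrict_bits a i) = restrict_bits a i"
    by (auto simp: bit_eq_iff bit_take_bit_iff restrict_bits_def bit_horner_sum_bit_iff)
  then show ?thesis by (metis take_bit_nat_less_exp)
qed

lemma bit_restrict_bits:
  "bit (restrict_bits a i) t \<longleftrightarrow> t < card a \<and> bit i (sorted_list_of_set a ! t)"
  by (auto simp: restrict_bits_def bit_horner_sum_bit_iff)

lemma restrict_bits_eqD:
  assumes "restrict_bits a i = restrict_bits a j" "finite a" "q \<in> a"
  shows "bit i q = bit j q"
proof -
  obtain t where "t < card a" "sorted_list_of_set a ! t = q"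
    using assms(2,3) by (metis in_set_conv_nth length_sorted_list_of_set set_sorted_list_of_set)
  then show ?thesis
    using assms(1) bit_restrict_bits[of a i t] bit_restrict_bits[of a j t] by simp
qed

text \<open>Qubit 0 is the least element of any part containing it, hence the lowest local bit. This
  is the reason for choosing qubit 0: the global Z on it is the local Z of the same form.\<close>

lemma even_restrict_bits:
  assumes "finite a" "0 \<in> a"
  shows "even (restrict_bits a i) = even i"
proof -
  have "sorted_list_of_set a = Min a # sorted_list_of_set (a - {Min a})"
    using assms by (intro sorted_list_of_set_nonempty) auto
  moreover have "Min a = 0" using assms by (metis Min_eqI le0)
  ultimately have "sorted_list_of_set a ! 0 = 0" by simp
  moreover have "card a > 0" using assms by (auto simp: card_gt_0_iff)
  ultimately show ?thesis using bit_restrict_bits[of a i 0] by (auto simp: bit_0)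
qed

lemma partition_finite:
  assumes "partition_on {..<n::nat} A"
  shows "finite A" "a \<in> A \<Longrightarrow> finite a"
proof -
  show "finite A" using assms finite_elements by blast
  show "finite a" if "a \<in> A"
    using that partition_onD1[OF assms] by (metis Sup_upper finite_lessThan finite_subset)
qed

lemma restrict_bits_partition_eq:
  assumes A: "partition_on {..<n} A" and ij: "i < 2 ^ n" "j < 2 ^ n"
    and eq: "\<And>a. a \<in> A \<Longrightarrow> restrict_bits a i = restrict_bits a j"
  shows "i = j"
proof (rule nat_eq_of_bits[OF ij])
  fix u assume "u < n"
  then obtain a where "a \<in> A" "u \<in> a" using partition_onD1[OF A] by blast
  then show "bit i u = bit j u"
    using restrict_bits_eqD[OF eq partition_finite(2)[OF A]] by blast
qed

text \<open>A basis state is the tuple of its restrictions. The map is injective because the parts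
  cover all n bits, and surjective by counting, since the part sizes add up to n.\<close>

lemma restrict_bits_bij:
  assumes A: "partition_on {..<n} A"
  shows "bij_betw (\<lambda>i. \<lambda>a\<in>A. restrict_bits a i) {..<2 ^ n} (PiE A (\<lambda>a. {..<2 ^ card a}))"
proof -
  have inj: "inj_on (\<lambda>i. \<lambda>a\<in>A. restrict_bits a i) {..<2 ^ n}"
  proof (rule inj_onI)
    fix i j :: nat
    assume ij: "i \<in> {..<2 ^ n}" "j \<in> {..<2 ^ n}" and e: "(\<lambda>a\<in>A. restrict_bits a i) = (\<lambda>a\<in>A. restrict_bits a j)"
    have "restrict_bits a i = restrict_bits a j" if "a \<in> A" for a
      using fun_cong[OF e, of a] that by simp
    then show "i = j" using restrict_bits_partition_eq[OF A] ij by blast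
  qed
  have fin: "finite (PiE A (\<lambda>a. {..<(2::nat) ^ card a}))"
    using partition_finite[OF A] by (intro finite_PiE) auto
  have "card (PiE A (\<lambda>a. {..<(2::nat) ^ card a})) = 2 ^ (\<Sum>a\<in>A. card a)"
    using partition_finite[OF A] by (simp add: card_PiE power_sum)
  also have "(\<Sum>a\<in>A. card a) = n"
    using product_partition[OF A] partition_finite(2)[OF A] by simp
  finally have "card (PiE A (\<lambda>a. {..<(2::nat) ^ card a})) \<le> card ((\<lambda>i. \<lambda>a\<in>A. restrict_bits a i) ` {..<2 ^ n})"
    using inj by (simp add: card_image)
  moreover have "(\<lambda>i. \<lambda>a\<in>A. restrict_bits a i) ` {..<2 ^ n} \<subseteq> PiE A (\<lambda>a. {..<2 ^ card a})"
    by (auto simp: restrict_bits_less)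
  ultimately have "(\<lambda>i. \<lambda>a\<in>A. restrict_bits a i) ` {..<2 ^ n} = PiE A (\<lambda>a. {..<2 ^ card a})"
    using fin card_seteq by blast
  then show ?thesis using inj by (simp add: bij_betw_def)
qed

text \<open>Distributivity along this bijection; sums over basis states of a tensor product factor
  over the parts.\<close>

lemma sum_prod_restrict_bits:
  fixes f :: "nat set \<Rightarrow> nat \<Rightarrow> 'a::comm_semiring_1"
  assumes A: "partition_on {..<n} A"
  shows "(\<Sum>k<2^n. \<Prod>a\<in>A. f a (restrict_bits a k)) = (\<Prod>a\<in>A. \<Sum>x<2^card a. f a x)"
proof -
  have "(\<Prod>a\<in>A. \<Sum>x<2^card a. f a x) = (\<Sum>g\<in>PiE A (\<lambda>a. {..<2 ^ card a}). \<Prod>a\<in>A. f a (g a))"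
    using partition_finite[OF A] by (intro prod_sum_PiE) auto
  also have "\<dots> = (\<Sum>k<2^n. \<Prod>a\<in>A. f a ((\<lambda>a\<in>A. restrict_bits a k) a))"
    by (rule sum.reindex_bij_betw[OF restrict_bits_bij[OF A], symmetric])
  finally show ?thesis by simp
qed

lemma layer_unitary_carrier [simp]: "layer_unitary n A V \<in> carrier_mat (2 ^ n) (2 ^ n)"
  by (simp add: layer_unitary_def)

lemma layer_unitary_index:
  "i < 2 ^ n \<Longrightarrow> j < 2 ^ n \<Longrightarrow>
   layer_unitary n A V $$ (i, j) = (\<Prod>a\<in>A. V a $$ (restrict_bits a i, restrict_bits a j))"
  by (simp add: layer_unitary_def)

lemma layer_unitary_one:
  assumes A: "partition_on {..<n} A"
  shows "layer_unitary n A (\<lambda>a. 1\<^sub>m (2 ^ card a)) = 1\<^sub>m (2 ^ n)"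
proof (rule eq_matI)
  fix i j assume "i < dim_row (1\<^sub>m (2 ^ n) :: complex mat)" "j < dim_col (1\<^sub>m (2 ^ n) :: complex mat)"
  then have ij: "i < 2 ^ n" "j < 2 ^ n" by auto
  show "layer_unitary n A (\<lambda>a. 1\<^sub>m (2 ^ card a)) $$ (i, j) = (1\<^sub>m (2 ^ n) :: complex mat) $$ (i, j)"
  proof (cases "i = j")
    case True
    then show ?thesis using ij by (simp add: layer_unitary_index restrict_bits_less)
  next
    case False
    then obtain a where a: "a \<in> A" "restrict_bits a i \<noteq> restrict_bits a j"
      using restrict_bits_partition_eq[OF A ij] by blast
    then have "(1\<^sub>m (2 ^ card a) :: complex mat) $$ (restrict_bits a i, restrict_bits a j) = 0"
      by (simp add: restrict_bits_less)
    then show ?thesis using ij False a partition_finite(1)[OF A]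
      by (auto simp: layer_unitary_index)
  qed
qed (auto simp: layer_unitary_def)

text \<open>The sum over basis states factors over the parts. A part other than \<open>a0\<close>
  contributes an entry of V\<dagger> V = 1, hence a Kronecker delta; the sign of Z depends only on
  the lowest local bit of \<open>a0\<close>.\<close>

lemma conj_Z_layer:
  assumes A: "partition_on {..<n} A" and a0: "a0 \<in> A" "0 \<in> a0"
    and V: "\<And>a. a \<in> A - {a0} \<Longrightarrow> V a \<in> unitary_group (2 ^ card a)"
    and ij: "i < 2 ^ n" "j < 2 ^ n"
  shows "conj_Z (2 ^ n) (layer_unitary n A V) i j =
    (if \<forall>a\<in>A - {a0}. restrict_bits a i = restrict_bits a j
     then conj_Z (2 ^ card a0) (V a0) (restrict_bits a0 i) (restrict_bits a0 j) else 0)"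
proof -
  define f where "f a x = cnj (V a $$ (x, restrict_bits a i)) * (if a = a0 then pauli_Z_sign x else 1)
    * V a $$ (x, restrict_bits a j)" for a x
  have fin: "finite A" by (rule partition_finite(1)[OF A])
  have z: "(\<Prod>a\<in>A. if a = a0 then pauli_Z_sign (restrict_bits a k) else 1) = pauli_Z_sign k" for k
    using fin a0 even_restrict_bits[OF partition_finite(2)[OF A a0(1)] a0(2)]
    by (simp add: pauli_Z_sign_def if_distrib cong: if_cong)
  have "conj_Z (2 ^ n) (layer_unitary n A V) i j = (\<Sum>k<2^n. \<Prod>a\<in>A. f a (restrict_bits a k))"
    unfolding conj_Z_def
  proof (rule sum.cong[OF refl])
    fix k :: nat assume k: "k \<in> {..<2^n}"
    have "(\<Prod>a\<in>A. f a (restrict_bits a k)) =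
      (\<Prod>a\<in>A. cnj (V a $$ (restrict_bits a k, restrict_bits a i))) * pauli_Z_sign k *
      (\<Prod>a\<in>A. V a $$ (restrict_bits a k, restrict_bits a j))"
      unfolding f_def prod.distrib z ..
    then show "cnj (layer_unitary n A V $$ (k, i)) * pauli_Z_sign k * layer_unitary n A V $$ (k, j) =
      (\<Prod>a\<in>A. f a (restrict_bits a k))"
      using k ij by (simp add: layer_unitary_index)
  qed
  also have "\<dots> = (\<Prod>a\<in>A. \<Sum>x<2^card a. f a x)" by (rule sum_prod_restrict_bits[OF A])
  also have "\<dots> = (\<Sum>x<2^card a0. f a0 x) * (\<Prod>a\<in>A - {a0}. \<Sum>x<2^card a. f a x)"
    using fin a0 by (intro prod.remove)
  also have "(\<Sum>x<2^card a0. f a0 x) = conj_Z (2 ^ card a0) (V a0) (restrict_bits a0 i) (restrict_bits a0 j)"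
    by (simp add: f_def conj_Z_def)
  also have "(\<Prod>a\<in>A - {a0}. \<Sum>x<2^card a. f a x) = (\<Prod>a\<in>A - {a0}. if restrict_bits a i = restrict_bits a j then 1 else 0)"
  proof (rule prod.cong[OF refl])
    fix a assume a: "a \<in> A - {a0}"
    then have "(\<Sum>x<2^card a. f a x) = (\<Sum>x<2^card a. cnj (V a $$ (x, restrict_bits a i)) * V a $$ (x, restrict_bits a j))"
      by (intro sum.cong refl) (auto simp: f_def)
    then show "(\<Sum>x<2^card a. f a x) = (if restrict_bits a i = restrict_bits a j then 1 else 0)"
      using unitary_group_cols[OF V[OF a] restrict_bits_less restrict_bits_less] by simp
  qed
  also have "\<dots> = (if \<forall>a\<in>A - {a0}. restrict_bits a i = restrict_bits a j then 1 else 0)"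
  proof (cases "\<forall>a\<in>A - {a0}. restrict_bits a i = restrict_bits a j")
    case True
    then have "(\<Prod>a\<in>A - {a0}. if restrict_bits a i = restrict_bits a j then 1 else (0::complex)) = 1"
      by (intro prod.neutral) auto
    with True show ?thesis by simp
  next
    case False
    then obtain a where a: "a \<in> A - {a0}" "restrict_bits a i \<noteq> restrict_bits a j" by blast
    then have "(\<Prod>a\<in>A - {a0}. if restrict_bits a i = restrict_bits a j then 1 else (0::complex)) = 0"
      using fin by (intro prod_zero) (auto intro!: bexI[of _ a])
    then show ?thesis using False by simp
  qed
  finally show ?thesis by simp
qed

text \<open>The partial trace of \<open>B\<close> over the qubits outside \<open>a\<close>.\<close>

definition reduced :: "nat \<Rightarrow> nat set set \<Rightarrow> nat set \<Rightarrow> (nat \<Rightarrow> nat \<Rightarrow> complex) \<Rightarrow> nat \<Rightarrow> nat \<Rightarrow> complex" where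
  "reduced n A a B x y = (\<Sum>i<2^n. \<Sum>j<2^n.
     if x = restrict_bits a i \<and> y = restrict_bits a j \<and> (\<forall>b\<in>A - {a}. restrict_bits b j = restrict_bits b i)
     then B i j else 0)"

lemma sum_double_delta:
  fixes g :: "nat \<Rightarrow> nat \<Rightarrow> complex"
  assumes "p < M" "q < M"
  shows "(\<Sum>x<M. \<Sum>y<M. if x = p \<and> y = q \<and> r then g y x else 0) = (if r then g q p else 0)"
proof -
  have "(\<Sum>x<M. \<Sum>y<M. if x = p \<and> y = q \<and> r then g y x else 0) =
    (\<Sum>x<M. if x = p then (\<Sum>y<M. if y = q then (if r then g y x else 0) else 0) else 0)"
    by (intro sum.cong refl) (auto intro!: sum.cong)
  then show ?thesis using assms by simp
qed

text \<open>The defining property of the partial trace: pairing B with an operator that is the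
  identity outside \<open>a0\<close> only sees the reduction of B to \<open>a0\<close>.\<close>

lemma overlap_layer:
  assumes A: "partition_on {..<n} A" and a0: "a0 \<in> A" "0 \<in> a0"
    and V: "\<And>a. a \<in> A - {a0} \<Longrightarrow> V a \<in> unitary_group (2 ^ card a)"
  shows "overlap (2 ^ n) B (layer_unitary n A V) = overlap (2 ^ card a0) (reduced n A a0 B) (V a0)"
proof -
  let ?m = "(2::nat) ^ card a0"
  let ?R = "\<lambda>i j. \<forall>b\<in>A - {a0}. restrict_bits b j = restrict_bits b i"
  let ?c = "conj_Z ?m (V a0)"
  have "overlap ?m (reduced n A a0 B) (V a0) =
    (\<Sum>x<?m. \<Sum>y<?m. \<Sum>i<2^n. \<Sum>j<2^n. if x = restrict_bits a0 i \<and> y = restrict_bits a0 j \<and> ?R i j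
      then B i j * ?c y x else 0)"
    unfolding overlap_def reduced_def sum_distrib_right
    by (intro sum.cong refl) auto
  also have "\<dots> = (\<Sum>i<2^n. \<Sum>j<2^n. \<Sum>x<?m. \<Sum>y<?m. if x = restrict_bits a0 i \<and> y = restrict_bits a0 j \<and> ?R i j
      then B i j * ?c y x else 0)"
    by (rule sum_swap_pairs)
  also have "\<dots> = (\<Sum>i<2^n. \<Sum>j<2^n. if ?R i j then B i j * ?c (restrict_bits a0 j) (restrict_bits a0 i) else 0)"
    by (intro sum.cong refl sum_double_delta restrict_bits_less)
  also have "\<dots> = overlap (2 ^ n) B (layer_unitary n A V)"
    unfolding overlap_def
  proof (intro sum.cong refl)
    fix i j :: nat assume "i \<in> {..<2 ^ n}" "j \<in> {..<2 ^ n}"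
    then have "conj_Z (2 ^ n) (layer_unitary n A V) j i =
      (if ?R i j then ?c (restrict_bits a0 j) (restrict_bits a0 i) else 0)"
      using V by (intro conj_Z_layer[OF A a0]) auto
    then show "(if ?R i j then B i j * ?c (restrict_bits a0 j) (restrict_bits a0 i) else 0) =
      B i j * conj_Z (2 ^ n) (layer_unitary n A V) j i"
      by simp
  qed
  finally show ?thesis ..
qed

text \<open>The case of identity gates shows that reduction preserves tr(B Z). It translates the
  right side of the one-gate bound back to all n qubits.\<close>

lemma overlap_layer_one:
  assumes A: "partition_on {..<n} A" and a0: "a0 \<in> A" "0 \<in> a0"
  shows "overlap (2 ^ card a0) (reduced n A a0 B) (1\<^sub>m (2 ^ card a0)) = overlap (2 ^ n) B (1\<^sub>m (2 ^ n))"
  using overlap_layer[OF A a0, of "\<lambda>a. 1\<^sub>m (2 ^ card a)" B] layer_unitary_one[OF A]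
  by (simp add: one_unitary)

text \<open>\<open>tr (Z U\<^sup>\<dagger>ZU)\<close>.\<close>

definition Z_return :: "nat \<Rightarrow> complex mat \<Rightarrow> complex" where
  "Z_return N U = overlap N (\<lambda>i j. if i = j then pauli_Z_sign i else 0) U"

lemma Z_return_mult:
  assumes "U \<in> carrier_mat N N" "W \<in> carrier_mat N N"
  shows "Z_return N (U * W) = overlap N (\<lambda>b a. \<Sum>i<N. \<Sum>j<N. W $$ (b, i) * (if i = j then pauli_Z_sign i else 0) * cnj (W $$ (a, j))) U"
  unfolding Z_return_def by (rule overlap_mult[OF assms])

lemma Z_return_one: "Z_return N (1\<^sub>m N) = of_nat N"
  by (simp add: Z_return_def overlap_one)

text \<open>Independence in the form needed here: refreshing one coordinate by an independent copy
  leaves the product measure unchanged. The inner integral is the mean over one gate with all other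
  gates fixed.\<close>

lemma nn_integral_PiM_resample:
  assumes I: "finite I" "x \<in> I" and M: "\<And>i. prob_space (M i)"
    and f[measurable]: "f \<in> borel_measurable (PiM I M)"
  shows "(\<integral>\<^sup>+\<omega>. f \<omega> \<partial>PiM I M) = (\<integral>\<^sup>+\<omega>. (\<integral>\<^sup>+y. f (fun_upd \<omega> x y) \<partial>M x) \<partial>PiM I M)"
proof -
  interpret product_sigma_finite M
    using M by (intro product_sigma_finite.intro) (simp add: prob_space_imp_sigma_finite)
  interpret Mx: prob_space "M x" by (rule M)
  let ?J = "I - {x}"
  have ins: "insert x ?J = I" "insert x I = I" and J: "finite ?J" "x \<notin> ?J" using I by auto
  have f': "f \<in> borel_measurable (PiM (insert x ?J) M)" using f ins by simp
  have "(\<lambda>(\<omega>, y). fun_upd \<omega> x y) \<in> PiM I M \<Otimes>\<^sub>M M x \<rightarrow>\<^sub>M PiM I M"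
    using measurable_add_dim[of x I M] ins by simp
  from measurable_compose[OF this f]
  have "(\<lambda>(\<omega>, y). f (fun_upd \<omega> x y)) \<in> borel_measurable (PiM I M \<Otimes>\<^sub>M M x)"
    by (simp add: case_prod_beta')
  then have g: "(\<lambda>\<omega>. \<integral>\<^sup>+y. f (fun_upd \<omega> x y) \<partial>M x) \<in> borel_measurable (PiM I M)"
    by measurable
  then have g': "(\<lambda>\<omega>. \<integral>\<^sup>+y. f (fun_upd \<omega> x y) \<partial>M x) \<in> borel_measurable (PiM (insert x ?J) M)"
    using ins by simp
  have "(\<integral>\<^sup>+\<omega>. f \<omega> \<partial>PiM I M) = (\<integral>\<^sup>+\<omega>. (\<integral>\<^sup>+y. f (fun_upd \<omega> x y) \<partial>M x) \<partial>PiM ?J M)"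
    using product_nn_integral_insert[OF J f'] ins by simp
  \<comment> \<open>The inner mean no longer depends on the old value z at x, so an integral of
    total mass 1 over z may be inserted.\<close>
  also have "\<dots> = (\<integral>\<^sup>+\<omega>. (\<integral>\<^sup>+z. (\<integral>\<^sup>+y. f (fun_upd (fun_upd \<omega> x z) x y) \<partial>M x) \<partial>M x) \<partial>PiM ?J M)"
    by (simp add: Mx.emeasure_space_1)
  also have "\<dots> = (\<integral>\<^sup>+\<omega>. (\<integral>\<^sup>+y. f (fun_upd \<omega> x y) \<partial>M x) \<partial>PiM I M)"
    using product_nn_integral_insert[OF J g'] ins by simp
  finally show ?thesis .
qed

lemma measurable_overlap:
  assumes "\<And>i j. i < N \<Longrightarrow> j < N \<Longrightarrow> (\<lambda>x. f x $$ (i, j)) \<in> borel_measurable M"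
  shows "(\<lambda>x. overlap N B (f x)) \<in> borel_measurable M"
  unfolding overlap_def conj_Z_def
  by (intro borel_measurable_sum borel_measurable_times borel_measurable_const
        borel_measurable_continuous_on[of cnj] continuous_intros assms) auto

text \<open>For a Haar-random gate this is \<open>mean_overlap_ge\<close>. An identity gate attains
  the numerator itself, and dividing by a number that is at least 1 only weakens the bound.\<close>

lemma gate_mean_ge:
  assumes M: "haar_measure (2 ^ m) (gate_group m) M \<or> M = return (mat_borel (2 ^ m)) (1\<^sub>m (2 ^ m))"
  shows "(\<integral>\<^sup>+y. ennreal ((cmod (overlap (2 ^ m) B y))\<^sup>2) \<partial>M) \<ge>
    ennreal ((cmod (overlap (2 ^ m) B (1\<^sub>m (2 ^ m))))\<^sup>2 / (2 ^ m)\<^sup>2)"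
  using M
proof
  assume h: "haar_measure (2 ^ m) (gate_group m) M"
  note e = haar_measure_ensemble[OF h]
  interpret prob_space M by (rule ensemble_on_prob[OF e])
  have "integrable M (\<lambda>y. (cmod (overlap (2 ^ m) B y))\<^sup>2)"
    by (intro bdd_meas_integrable[OF finite_measure_axioms] bdd_meas_norm_square
          bdd_meas_overlap[OF e gate_group_subset_unitary])
  then have "(\<integral>\<^sup>+y. ennreal ((cmod (overlap (2 ^ m) B y))\<^sup>2) \<partial>M) = ennreal (mean_overlap (2 ^ m) M B)"
    unfolding mean_overlap_def by (intro nn_integral_eq_integral) auto
  then show ?thesis using mean_overlap_ge[OF h] by (simp add: ennreal_leI)
next
  assume M: "M = return (mat_borel (2 ^ m)) (1\<^sub>m (2 ^ m))"
  have "(\<lambda>y. overlap (2 ^ m) B y) \<in> borel_measurable (mat_borel (2 ^ m))"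
    by (intro measurable_overlap measurable_mat_borel_entry)
  then have "(\<integral>\<^sup>+y. ennreal ((cmod (overlap (2 ^ m) B y))\<^sup>2) \<partial>M) = ennreal ((cmod (overlap (2 ^ m) B (1\<^sub>m (2 ^ m))))\<^sup>2)"
    unfolding M by (intro nn_integral_return) auto
  moreover have "(cmod (overlap (2 ^ m) B (1\<^sub>m (2 ^ m))))\<^sup>2 / (2 ^ m)\<^sup>2 \<le> (cmod (overlap (2 ^ m) B (1\<^sub>m (2 ^ m))))\<^sup>2 / 1"
    by (intro divide_left_mono) auto
  ultimately show ?thesis by (simp add: ennreal_leI)
qed

section \<open>Return probability layer by layer\<close>

definition gate_index :: "circuit \<Rightarrow> (nat \<times> nat set) set" where
  "gate_index C = Sigma {..<length C} (\<lambda>l. fst (C ! l))"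

definition gate_law :: "(nat \<Rightarrow> complex mat measure) \<Rightarrow> circuit \<Rightarrow> nat \<times> nat set \<Rightarrow> complex mat measure" where
  "gate_law h C = (\<lambda>(l, a). if a \<in> snd (C ! l) then h (card a)
     else return (mat_borel (2 ^ card a)) (1\<^sub>m (2 ^ card a)))"

lemma fixed_brickwork_eq:
  "fixed_brickwork h n C = distr (PiM (gate_index C) (gate_law h C)) (mat_borel (2 ^ n)) (circuit_unitary n C)"
  by (simp add: fixed_brickwork_def gate_index_def gate_law_def)

text \<open>The partial circuit is a function of the gates of the whole circuit. The induction over
  layers thus stays on one product space.\<close>

definition prefix_unitary :: "nat \<Rightarrow> circuit \<Rightarrow> (nat \<times> nat set \<Rightarrow> complex mat) \<Rightarrow> nat \<Rightarrow> complex mat" where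
  "prefix_unitary n C V l' =
     foldl (\<lambda>U l. layer_unitary n (fst (C ! l)) (\<lambda>a. V (l, a)) * U) (1\<^sub>m (2 ^ n)) [0..<l']"

lemma prefix_unitary_0: "prefix_unitary n C V 0 = 1\<^sub>m (2 ^ n)"
  and prefix_unitary_Suc: "prefix_unitary n C V (Suc l) =
    layer_unitary n (fst (C ! l)) (\<lambda>a. V (l, a)) * prefix_unitary n C V l"
  and circuit_unitary_prefix: "circuit_unitary n C V = prefix_unitary n C V (length C)"
  by (simp_all add: prefix_unitary_def circuit_unitary_def)

lemma prefix_unitary_carrier: "prefix_unitary n C V l \<in> carrier_mat (2 ^ n) (2 ^ n)"
  by (induction l) (auto simp: prefix_unitary_0 prefix_unitary_Suc intro: mult_carrier_mat[OF layer_unitary_carrier])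

lemma prefix_unitary_upd:
  "l \<le> l' \<Longrightarrow> prefix_unitary n C (fun_upd V (l', a) y) l = prefix_unitary n C V l"
  by (induction l) (auto simp: prefix_unitary_0 prefix_unitary_Suc)

text \<open>Measurability is known only for entries, so the event V = 1 is expressed by finitely
  many entries; the carrier supplies the dimensions.\<close>

lemma AE_return_one: "AE V in return (mat_borel N) (1\<^sub>m N). V = 1\<^sub>m N"
proof -
  let ?P = "\<lambda>V :: complex mat. \<forall>p\<in>{..<N} \<times> {..<N}. V $$ p = 1\<^sub>m N $$ p"
  have meas: "{V \<in> space (mat_borel N). V $$ p = 1\<^sub>m N $$ p} \<in> sets (mat_borel N)" if "p \<in> {..<N} \<times> {..<N}" for p
  proof -
    have "(\<lambda>V. V $$ p) -` {1\<^sub>m N $$ p} \<inter> space (mat_borel N) \<in> sets (mat_borel N)"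
      using that measurable_mat_borel_entry[of "fst p" N "snd p"] by (intro measurable_sets[where A = borel]) auto
    moreover have "{V \<in> space (mat_borel N). V $$ p = 1\<^sub>m N $$ p} = (\<lambda>V. V $$ p) -` {1\<^sub>m N $$ p} \<inter> space (mat_borel N)"
      by blast
    ultimately show ?thesis by simp
  qed
  have "{V \<in> space (mat_borel N). ?P V} \<in> sets (mat_borel N)"
    by (rule sets.sets_Collect_finite_All[OF meas]) simp_all
  then have pred: "Measurable.pred (mat_borel N) ?P" by (rule Measurable.pred_def[THEN iffD2])
  have "1\<^sub>m N \<in> space (mat_borel N)" by simp
  from AE_return[OF this pred] have "AE V in return (mat_borel N) (1\<^sub>m N). ?P V" by blast
  then show ?thesis
  proof (rule AE_mp, intro AE_I2 impI)
    fix V assume "V \<in> space (return (mat_borel N) (1\<^sub>m N))" "?P V"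
    then show "V = 1\<^sub>m N" by (intro eq_matI) auto
  qed
qed

locale brickwork =
  fixes n :: nat and \<Gamma> r and C :: circuit and h :: "nat \<Rightarrow> complex mat measure"
  assumes h: "\<And>m. haar_measure (2 ^ m) (gate_group m) (h m)"
    and C: "\<And>l. l \<in> set C \<Longrightarrow> valid_layer n \<Gamma> r l"
    and n: "n > 0"
begin

abbreviation "gates \<equiv> PiM (gate_index C) (gate_law h C)"

lemma partition: "l < length C \<Longrightarrow> partition_on {..<n} (fst (C ! l))"
  using C[OF nth_mem] by (simp add: valid_layer_def)

lemma finite_gate_index: "finite (gate_index C)"
  unfolding gate_index_def using partition partition_finite(1) by (intro finite_SigmaI) auto

lemma gate_law_cases:
  "haar_measure (2 ^ card a) (gate_group (card a)) (gate_law h C (l, a)) \<or>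
   gate_law h C (l, a) = return (mat_borel (2 ^ card a)) (1\<^sub>m (2 ^ card a))"
  using h by (simp add: gate_law_def)

lemma prob_space_gate_law: "prob_space (gate_law h C x)"
  using gate_law_cases[of "snd x" "fst x"]
  by (auto intro!: prob_space_return intro: ensemble_on_prob haar_measure_ensemble)

lemma sets_gate_law: "sets (gate_law h C (l, a)) = sets (mat_borel (2 ^ card a))"
  using gate_law_cases[of a l] by (auto dest: ensemble_on_sets haar_measure_ensemble)

lemma AE_gate_unitary: "AE V in gate_law h C (l, a). V \<in> unitary_group (2 ^ card a)"
  using gate_law_cases[of a l]
proof
  assume "haar_measure (2 ^ card a) (gate_group (card a)) (gate_law h C (l, a))"
  from ensemble_on_AE[OF haar_measure_ensemble[OF this]] show ?thesis
    by eventually_elim (rule gate_group_unitary)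
next
  assume e: "gate_law h C (l, a) = return (mat_borel (2 ^ card a)) (1\<^sub>m (2 ^ card a))"
  show ?thesis unfolding e using AE_return_one by eventually_elim (simp add: one_unitary)
qed

lemma prob_space_gates: "prob_space gates"
  by (intro prob_space_PiM prob_space_gate_law)

lemma measurable_gate_entry:
  assumes "(l, a) \<in> gate_index C" "i < 2 ^ card a" "j < 2 ^ card a"
  shows "(\<lambda>V. V (l, a) $$ (i, j)) \<in> borel_measurable gates"
proof -
  have "(\<lambda>A. A $$ (i, j)) \<in> borel_measurable (gate_law h C (l, a))"
    using measurable_mat_borel_entry[OF assms(2,3)] measurable_cong_sets[OF sets_gate_law refl] by blast
  from measurable_compose[OF measurable_component_singleton[OF assms(1), of "gate_law h C"] this] show ?thesis .
qed

lemma measurable_prefix_entry: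
  "l \<le> length C \<Longrightarrow> i < 2 ^ n \<Longrightarrow> j < 2 ^ n \<Longrightarrow> (\<lambda>V. prefix_unitary n C V l $$ (i, j)) \<in> borel_measurable gates"
proof (induction l arbitrary: i j)
  case 0
  then show ?case by (simp add: prefix_unitary_0)
next
  case (Suc l)
  have "(\<lambda>V. prefix_unitary n C V (Suc l) $$ (i, j)) = (\<lambda>V. \<Sum>k<2^n.
    (\<Prod>a\<in>fst (C ! l). V (l, a) $$ (restrict_bits a i, restrict_bits a k)) * prefix_unitary n C V l $$ (k, j))"
    unfolding prefix_unitary_Suc using Suc.prems
    by (subst mat_mult_index[OF layer_unitary_carrier prefix_unitary_carrier])
       (auto simp: layer_unitary_index)
  also have "\<dots> \<in> borel_measurable gates"
    using Suc.prems
    by (intro borel_measurable_sum borel_measurable_times borel_measurable_prod Suc.IH measurable_gate_entry)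
       (auto simp: gate_index_def restrict_bits_less)
  finally show ?case .
qed

lemma measurable_circuit_unitary: "circuit_unitary n C \<in> gates \<rightarrow>\<^sub>M mat_borel (2 ^ n)"
  by (rule measurable_into_mat_borel)
     (auto simp: circuit_unitary_prefix prefix_unitary_carrier intro: measurable_prefix_entry)

lemma prob_space_fixed_brickwork: "prob_space (fixed_brickwork h n C)"
  unfolding fixed_brickwork_eq
  by (rule prob_space.prob_space_distr[OF prob_space_gates measurable_circuit_unitary])

abbreviation "mean_return l \<equiv> \<integral>\<^sup>+V. ennreal ((cmod (Z_return (2 ^ n) (prefix_unitary n C V l)))\<^sup>2) \<partial>gates"

lemma measurable_Z_return_prefix:
  "l \<le> length C \<Longrightarrow> (\<lambda>V. ennreal ((cmod (Z_return (2 ^ n) (prefix_unitary n C V l)))\<^sup>2)) \<in> borel_measurable gates"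
proof -
  assume "l \<le> length C"
  then have "(\<lambda>V. Z_return (2 ^ n) (prefix_unitary n C V l)) \<in> borel_measurable gates"
    unfolding Z_return_def by (intro measurable_overlap measurable_prefix_entry)
  then show ?thesis by simp
qed

text \<open>Only the gate on the part containing qubit 0 moves the Pauli \<open>Z\<close> on that qubit.\<close>

lemma mean_return_Suc:
  assumes l: "l < length C"
  shows "mean_return (Suc l) \<ge> ennreal (1 / 4 ^ r) * mean_return l"
proof -
  let ?A = "fst (C ! l)"
  have A: "partition_on {..<n} ?A" by (rule partition[OF l])
  obtain a0 where a0: "a0 \<in> ?A" "0 \<in> a0"
    using partition_onD1[OF A] n by (metis UnionE lessThan_iff)
  have card: "card a0 \<le> r" using C[OF nth_mem[OF l]] a0 by (simp add: valid_layer_def)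
  have ix: "(l, a0) \<in> gate_index C" using l a0 by (simp add: gate_index_def)
  let ?M = "gate_law h C (l, a0)"
  let ?f = "\<lambda>V l. ennreal ((cmod (Z_return (2 ^ n) (prefix_unitary n C V l)))\<^sup>2)"
  \<comment> \<open>The other gates of the layer must be unitary to cancel in
    \<open>conj_Z_layer\<close>, which holds almost surely.\<close>
  have AE: "AE V in gates. \<forall>a\<in>?A. V (l, a) \<in> unitary_group (2 ^ card a)"
    using partition_finite(1)[OF A] l
    by (intro AE_finite_allI AE_PiM_component prob_space_gate_law AE_gate_unitary) (auto simp: gate_index_def)
  have step: "ennreal (1 / 4 ^ r) * ?f V l \<le> (\<integral>\<^sup>+y. ?f (fun_upd V (l, a0) y) (Suc l) \<partial>?M)"
    if V: "\<forall>a\<in>?A. V (l, a) \<in> unitary_group (2 ^ card a)" for V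
  proof -
    define U where "U = prefix_unitary n C V l"
    have U: "U \<in> carrier_mat (2 ^ n) (2 ^ n)" by (simp add: U_def prefix_unitary_carrier)
    \<comment> \<open>B is U Z U\<dagger> for the first l layers. With all gates but the one on
      \<open>a0\<close> fixed, the return amplitude after the next layer is linear in the conjugated
      local Z, and the one-gate bound applies to the reduction of B.\<close>
    define B where "B = (\<lambda>b a. \<Sum>i<2^n. \<Sum>j<2^n. U $$ (b, i) * (if i = j then pauli_Z_sign i else 0) * cnj (U $$ (a, j)))"
    have Zr: "Z_return (2 ^ n) (W * U) = overlap (2 ^ n) B W" if "W \<in> carrier_mat (2 ^ n) (2 ^ n)" for W
      unfolding B_def by (rule Z_return_mult[OF that U])
    have "Z_return (2 ^ n) (prefix_unitary n C (fun_upd V (l, a0) y) (Suc l)) =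
      overlap (2 ^ card a0) (reduced n ?A a0 B) y" for y
    proof -
      have "Z_return (2 ^ n) (prefix_unitary n C (fun_upd V (l, a0) y) (Suc l)) =
        overlap (2 ^ n) B (layer_unitary n ?A (\<lambda>a. fun_upd V (l, a0) y (l, a)))"
        unfolding prefix_unitary_Suc prefix_unitary_upd[OF order_refl] U_def[symmetric]
        by (rule Zr) simp
      also have "\<dots> = overlap (2 ^ card a0) (reduced n ?A a0 B) (fun_upd V (l, a0) y (l, a0))"
        by (rule overlap_layer[OF A a0]) (use V in auto)
      finally show ?thesis by simp
    qed
    then have "(\<integral>\<^sup>+y. ?f (fun_upd V (l, a0) y) (Suc l) \<partial>?M) \<ge>
      ennreal ((cmod (overlap (2 ^ card a0) (reduced n ?A a0 B) (1\<^sub>m (2 ^ card a0))))\<^sup>2 / (2 ^ card a0)\<^sup>2)"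
      using gate_mean_ge[OF gate_law_cases] by simp
    also have "overlap (2 ^ card a0) (reduced n ?A a0 B) (1\<^sub>m (2 ^ card a0)) = Z_return (2 ^ n) U"
      using Zr[of "1\<^sub>m (2 ^ n)"] U by (simp add: overlap_layer_one[OF A a0])
    finally have "ennreal ((cmod (Z_return (2 ^ n) U))\<^sup>2 / (2 ^ card a0)\<^sup>2) \<le>
      (\<integral>\<^sup>+y. ?f (fun_upd V (l, a0) y) (Suc l) \<partial>?M)" .
    moreover have "1 / 4 ^ r * (cmod (Z_return (2 ^ n) U))\<^sup>2 \<le> (cmod (Z_return (2 ^ n) U))\<^sup>2 / (2 ^ card a0)\<^sup>2"
    proof -
      have "((2::real) ^ card a0)\<^sup>2 = 4 ^ card a0" by (simp add: power2_eq_square flip: power_mult_distrib)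
      also have "\<dots> \<le> 4 ^ r" using card by (simp add: power_increasing)
      finally have "(cmod (Z_return (2 ^ n) U))\<^sup>2 / 4 ^ r \<le> (cmod (Z_return (2 ^ n) U))\<^sup>2 / (2 ^ card a0)\<^sup>2"
        by (intro divide_left_mono) auto
      then show ?thesis by simp
    qed
    ultimately show ?thesis
      unfolding U_def[symmetric] by (subst ennreal_mult[symmetric]) (auto intro: order_trans ennreal_leI)
  qed
  have "ennreal (1 / 4 ^ r) * mean_return l = (\<integral>\<^sup>+V. ennreal (1 / 4 ^ r) * ?f V l \<partial>gates)"
    using measurable_Z_return_prefix[of l] l by (intro nn_integral_cmult[symmetric]) auto
  also have "\<dots> \<le> (\<integral>\<^sup>+V. (\<integral>\<^sup>+y. ?f (fun_upd V (l, a0) y) (Suc l) \<partial>?M) \<partial>gates)"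
    by (rule nn_integral_mono_AE) (use AE in eventually_elim, use step in blast)
  \<comment> \<open>Refreshing the gate at \<open>(l, a0)\<close> does not affect the first l
    layers, so the estimate with a fresh gate is one for the original circuit.\<close>
  also have "\<dots> = mean_return (Suc l)"
    by (rule nn_integral_PiM_resample[OF finite_gate_index ix prob_space_gate_law measurable_Z_return_prefix, symmetric])
       (use l in auto)
  finally show ?thesis .
qed

lemma mean_return_ge: "l \<le> length C \<Longrightarrow> mean_return l \<ge> ennreal ((2 ^ n)\<^sup>2 * (1 / 4 ^ r) ^ l)"
proof (induction l)
  case 0
  interpret prob_space gates by (rule prob_space_gates)
  show ?case by (simp add: prefix_unitary_0 Z_return_one norm_power emeasure_space_1)
next
  case (Suc l)
  have "ennreal ((2 ^ n)\<^sup>2 * (1 / 4 ^ r) ^ Suc l) = ennreal (1 / 4 ^ r) * ennreal ((2 ^ n)\<^sup>2 * (1 / 4 ^ r) ^ l)"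
    by (subst ennreal_mult[symmetric]) (auto simp: ac_simps)
  also have "\<dots> \<le> ennreal (1 / 4 ^ r) * mean_return l"
    using Suc by (intro mult_left_mono) auto
  also have "\<dots> \<le> mean_return (Suc l)"
    using Suc by (intro mean_return_Suc) auto
  finally show ?case .
qed

lemma fixed_brickwork_return:
  "(\<integral>\<^sup>+U. ennreal ((cmod (Z_return (2 ^ n) U))\<^sup>2) \<partial>fixed_brickwork h n C) \<ge> ennreal ((2 ^ n)\<^sup>2 * (1 / 4 ^ r) ^ length C)"
proof -
  have "(\<lambda>U. Z_return (2 ^ n) U) \<in> borel_measurable (mat_borel (2 ^ n))"
    unfolding Z_return_def by (intro measurable_overlap measurable_mat_borel_entry)
  then have "(\<integral>\<^sup>+U. ennreal ((cmod (Z_return (2 ^ n) U))\<^sup>2) \<partial>fixed_brickwork h n C) = mean_return (length C)"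
    unfolding fixed_brickwork_eq
    by (subst nn_integral_distr[OF measurable_circuit_unitary]) (auto simp: circuit_unitary_prefix)
  then show ?thesis using mean_return_ge[OF order_refl] by simp
qed

end

lemma random_brickwork_return:
  assumes E: "generalized_random_brickwork n \<Gamma> r d E" and n: "n > 0"
  shows "(\<integral>\<^sup>+U. ennreal ((cmod (Z_return (2 ^ n) U))\<^sup>2) \<partial>E) \<ge> ennreal ((2 ^ n)\<^sup>2 * (1 / 4 ^ r) ^ d)"
proof -
  obtain h and p :: "circuit pmf" where h: "\<And>m. haar_measure (2 ^ m) (gate_group m) (h m)"
    and p: "\<And>C. C \<in> set_pmf p \<Longrightarrow> (\<forall>l\<in>set C. valid_layer n \<Gamma> r l) \<and> length C \<le> d"
    and sE: "sets E = sets (mat_borel (2 ^ n))"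
    and eE: "\<And>S. S \<in> sets E \<Longrightarrow> emeasure E S = (\<integral>\<^sup>+ C. emeasure (fixed_brickwork h n C) S \<partial>measure_pmf p)"
    using E unfolding generalized_random_brickwork_def by metis
  have bw: "brickwork n \<Gamma> r C h" if "C \<in> set_pmf p" for C
    using h p[OF that] n by unfold_locales auto
  obtain C0 where C0: "C0 \<in> set_pmf p" using set_pmf_not_empty[of p] by blast
  \<comment> \<open>The mixture is rewritten as a monadic bind, whose kernel must be a probability
    measure at every circuit. Outside the support a circuit may have invalid layers, so its value
    there is replaced by that of a valid circuit; this changes nothing almost everywhere.\<close>
  define F where "F C = (if C \<in> set_pmf p then fixed_brickwork h n C else fixed_brickwork h n C0)" for C
  have F: "prob_space (F C)" "sets (F C) = sets (mat_borel (2 ^ n))" for C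
    using brickwork.prob_space_fixed_brickwork[OF bw] C0 by (simp add: F_def, simp add: F_def fixed_brickwork_def)
  have Fm: "F \<in> measure_pmf p \<rightarrow>\<^sub>M subprob_algebra (mat_borel (2 ^ n))"
    using F by (auto simp: space_subprob_algebra intro: prob_space_imp_subprob_space)
  have AE: "AE C in measure_pmf p. F C = fixed_brickwork h n C"
    by (simp add: AE_measure_pmf_iff F_def)
  have EF: "E = measure_pmf p \<bind> F"
  proof (rule measure_eqI)
    have "sets (measure_pmf p \<bind> F) = sets (mat_borel (2 ^ n))"
      by (rule sets_bind) (use F in auto)
    then show "sets E = sets (measure_pmf p \<bind> F)" by (simp add: sE)
    fix S assume S: "S \<in> sets E"
    have "emeasure (measure_pmf p \<bind> F) S = (\<integral>\<^sup>+ C. emeasure (F C) S \<partial>measure_pmf p)"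
      by (rule emeasure_bind[OF _ Fm]) (use S sE in auto)
    also have "\<dots> = (\<integral>\<^sup>+ C. emeasure (fixed_brickwork h n C) S \<partial>measure_pmf p)"
      by (rule nn_integral_cong_AE) (use AE in auto)
    finally show "emeasure E S = emeasure (measure_pmf p \<bind> F) S" using eE[OF S] by simp
  qed
  have m: "(\<lambda>U. ennreal ((cmod (Z_return (2 ^ n) U))\<^sup>2)) \<in> borel_measurable (mat_borel (2 ^ n))"
  proof -
    have "(\<lambda>U. Z_return (2 ^ n) U) \<in> borel_measurable (mat_borel (2 ^ n))"
      unfolding Z_return_def by (intro measurable_overlap measurable_mat_borel_entry)
    then show ?thesis by simp
  qed
  have "ennreal ((2 ^ n)\<^sup>2 * (1 / 4 ^ r) ^ d) = (\<integral>\<^sup>+C. ennreal ((2 ^ n)\<^sup>2 * (1 / 4 ^ r) ^ d) \<partial>measure_pmf p)"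
    by simp
  also have "\<dots> \<le> (\<integral>\<^sup>+C. (\<integral>\<^sup>+U. ennreal ((cmod (Z_return (2 ^ n) U))\<^sup>2) \<partial>F C) \<partial>measure_pmf p)"
  proof (rule nn_integral_mono_AE, unfold AE_measure_pmf_iff, rule ballI)
    fix C assume C: "C \<in> set_pmf p"
    \<comment> \<open>A circuit shorter than d only has a better bound, since 1 / 4^r is at most
      1.\<close>
    have le: "(2 ^ n)\<^sup>2 * (1 / 4 ^ r) ^ d \<le> ((2 ^ n)\<^sup>2 * (1 / 4 ^ r) ^ length C :: real)"
      using p[OF C] by (intro mult_left_mono power_decreasing) auto
    then show "ennreal ((2 ^ n)\<^sup>2 * (1 / 4 ^ r) ^ d) \<le> (\<integral>\<^sup>+U. ennreal ((cmod (Z_return (2 ^ n) U))\<^sup>2) \<partial>F C)"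
      using order_trans[OF ennreal_leI[OF le] brickwork.fixed_brickwork_return[OF bw[OF C]]] C
      by (simp add: F_def)
  qed
  also have "\<dots> = (\<integral>\<^sup>+U. ennreal ((cmod (Z_return (2 ^ n) U))\<^sup>2) \<partial>E)"
    unfolding EF by (rule nn_integral_bind[OF m Fm, symmetric])
  finally show ?thesis .
qed

section \<open>The Haar measure on the symplectic group\<close>

text \<open>The two numbers differ in bit 1 only, and n \<ge> 2 makes that bit count.\<close>

lemma popcount_sign_flip:
  assumes "n \<ge> 2"
  shows "popcount_sign n (4 * t + 3) = - popcount_sign n (4 * t + 1)"
proof -
  have b: "bit (4 * t + 3) q \<longleftrightarrow> (bit (4 * t + 1) q \<noteq> (q = 1))" for q :: nat
  proof -
    have d: "(4 * t + 3) div 2 = 2 * t + 1" "(4 * t + 1) div 2 = 2 * t" "(2 * t + 1) div 2 = t" "(2 * t) div 2 = t"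
      by simp_all
    consider "q = 0" | "q = Suc 0" | p where "q = Suc (Suc p)" by (metis not0_implies_Suc)
    then show ?thesis
    proof cases
      case 1 then show ?thesis by (simp add: bit_0)
    next
      case 2 then show ?thesis by (simp only: bit_Suc d bit_0) simp
    next
      case 3 then show ?thesis by (simp only: bit_Suc d) simp
    qed
  qed
  have "popcount_sign n (4 * t + 3) = (\<Prod>q<n. (if bit (4 * t + 1) q then -1 else 1) * (if q = 1 then -1 else 1))"
    unfolding popcount_sign_def b by (intro prod.cong refl) auto
  also have "\<dots> = popcount_sign n (4 * t + 1) * (\<Prod>q<n. if q = 1 then -1 else 1)"
    by (simp only: prod.distrib popcount_sign_def)
  also have "(\<Prod>q<n. if q = 1 then -1 else 1) = (-1 :: complex)"
    using assms by (subst prod.delta) auto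
  finally show ?thesis by simp
qed

lemma power2_minus_2:
  assumes "n \<ge> 2"
  shows "(2::'a::comm_semiring_1) ^ n = 4 * 2 ^ (n - 2)"
proof -
  obtain m where "n = 2 + m" using assms le_Suc_ex by blast
  then show ?thesis by (simp flip: mult.assoc)
qed

text \<open>Each block of four consecutive numbers contains the odd pair 4t + 1, 4t + 3, exactly one
  of which has odd weight; \<open>g\<close> selects it. There are 2^(n-2) blocks. Odd s means that
  X^s anticommutes with Z on qubit 0, odd weight that the rotation preserves the form.\<close>

lemma card_odd_popcount:
  assumes n: "n \<ge> 2"
  shows "2 ^ (n - 2) \<le> card {s. s < 2 ^ n \<and> odd s \<and> popcount_sign n s = -1}"
proof -
  define g where "g t = (if popcount_sign n (4 * t + 1) = -1 then 4 * t + 1 else 4 * t + 3)" for t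
  have inj: "inj_on g {..<2 ^ (n - 2)}"
  proof (rule inj_onI)
    have "g t div 4 = t" for t
    proof -
      have "(4 * t + 1) div 4 = t" "(4 * t + 3) div 4 = t" by linarith+
      then show ?thesis unfolding g_def by (cases "popcount_sign n (4 * t + 1) = - 1") (simp_all only: if_True if_False simp_thms)
    qed
    then show "t = u" if "g t = g u" for t u using that by metis
  qed
  have "g ` {..<2 ^ (n - 2)} \<subseteq> {s. s < 2 ^ n \<and> odd s \<and> popcount_sign n s = -1}"
  proof (rule image_subsetI)
    fix t :: nat assume "t \<in> {..<2 ^ (n - 2)}"
    moreover have "(2::nat) ^ n = 4 * 2 ^ (n - 2)"
      by (rule power2_minus_2[OF n])
    ultimately have "4 * t + 3 < 2 ^ n" by simp
    moreover have "popcount_sign n (g t) = -1"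
      using popcount_sign_cases[of n "4 * t + 1"] popcount_sign_flip[OF n, of t] by (auto simp: g_def)
    ultimately show "g t \<in> {s. s < 2 ^ n \<and> odd s \<and> popcount_sign n s = -1}"
      by (auto simp: g_def)
  qed
  then have "card {..<(2::nat) ^ (n - 2)} \<le> card {s. s < 2 ^ n \<and> odd s \<and> popcount_sign n s = -1}"
    by (intro card_inj_on_le[OF inj]) auto
  then show ?thesis by simp
qed

text \<open>\<open>exp (\<i> \<pi>/4 X\<^sup>s)\<close>; for odd \<open>s\<close> it conjugates the Pauli \<open>Z\<close> to \<open>\<i> Z X\<^sup>s\<close>.\<close>

definition rotation :: "nat \<Rightarrow> nat \<Rightarrow> complex mat" where
  "rotation n s = two_term n s (of_real (sqrt (1/2))) (\<i> * of_real (sqrt (1/2)))"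

lemma sqrt_half_square: "complex_of_real (sqrt (1/2)) * complex_of_real (sqrt (1/2)) = 1/2"
  by (simp flip: of_real_mult)

text \<open>Odd weight makes X^s anticommute with the form, so the transposed factor on the right
  acts as the inverse of the left one. In the conditions, 1/2 + 1/2 = 1 and the cross term carries 1
  - 1 = 0.\<close>

lemma rotation_mem_gate_group:
  assumes "s < 2 ^ n" "popcount_sign n s = -1"
  shows "rotation n s \<in> gate_group n"
proof -
  define \<alpha> where "\<alpha> = complex_of_real (sqrt (1/2))"
  have a: "\<alpha> * \<alpha> = 1/2" unfolding \<alpha>_def by (rule sqrt_half_square)
  have c: "cnj \<alpha> = \<alpha>" by (simp add: \<alpha>_def)
  have "two_term n s \<alpha> (\<i> * \<alpha>) \<in> gate_group n"
    using a by (intro two_term_mem_gate_group[OF assms(1)]) (simp_all add: assms(2) c algebra_simps)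
  then show ?thesis by (simp add: rotation_def \<alpha>_def)
qed

text \<open>Write W for the rotation. Z anticommutes with X^s for odd s, so W\<dagger> Z = Z W and
  the result is Z W^2, where W^2 = \<i> X^s.\<close>

lemma conj_Z_rotation:
  assumes s: "s < 2 ^ n" "odd s" and ij: "i < 2 ^ n" "j < 2 ^ n"
  shows "conj_Z (2 ^ n) (rotation n s) j i = (if i = j XOR s then \<i> * pauli_Z_sign j else 0)"
proof -
  define \<alpha> where "\<alpha> = complex_of_real (sqrt (1/2))"
  have a: "\<alpha> * \<alpha> = 1/2" unfolding \<alpha>_def by (rule sqrt_half_square)
  have c: "cnj \<alpha> = \<alpha>" by (simp add: \<alpha>_def)
  let ?W = "two_term n s \<alpha> (\<i> * \<alpha>)"
  have x: "j XOR s < 2 ^ n" using xor_less_pow2 ij s by blast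
  have ne: "j XOR s \<noteq> j"
  proof
    assume "j XOR s = j"
    then have "even (j XOR s) = even j" by simp
    then show False using s(2) by (simp add: even_xor_iff)
  qed
  have z: "pauli_Z_sign (j XOR s) = - pauli_Z_sign j"
    unfolding pauli_Z_sign_xor using s(2) by (simp add: pauli_Z_sign_def)
  have col: "cnj (?W $$ (k, j)) = (if k = j then \<alpha> else 0) + (if k = j XOR s then - \<i> * \<alpha> else 0)" if "k < 2 ^ n" for k
  proof -
    have "j = k XOR s \<longleftrightarrow> k = j XOR s" by (metis xor_cancel)
    then show ?thesis using that ij c by (auto simp: two_term_def)
  qed
  have "conj_Z (2 ^ n) ?W j i = (\<Sum>k<2^n. (if k = j then \<alpha> * pauli_Z_sign k * ?W $$ (k, i) else 0)
     + (if k = j XOR s then - \<i> * \<alpha> * pauli_Z_sign k * ?W $$ (k, i) else 0))"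
  proof -
    have "((if a then p else 0) + (if b then q else 0)) * z * w = (if a then p * z * w else 0) + (if b then q * z * w else 0)"
      for a b and p q z w :: complex by (simp add: distrib_right)
    then show ?thesis unfolding conj_Z_def by (intro sum.cong refl) (simp only: col lessThan_iff)
  qed
  also have "\<dots> = \<alpha> * pauli_Z_sign j * ?W $$ (j, i) - \<i> * \<alpha> * pauli_Z_sign (j XOR s) * ?W $$ (j XOR s, i)"
  proof -
    have "(\<Sum>k<2^n. if k = j then f k else 0) = f j" "(\<Sum>k<2^n. if k = j XOR s then f k else 0) = f (j XOR s)"
      for f :: "nat \<Rightarrow> complex"
      using ij x by simp_all
    then show ?thesis unfolding sum.distrib by (simp only: mult_minus_left diff_conv_add_uminus)
  qed
  also have "\<dots> = \<alpha> * pauli_Z_sign j * ?W $$ (j, i) + \<i> * \<alpha> * pauli_Z_sign j * ?W $$ (j XOR s, i)"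
    by (simp add: z)
  also have "?W $$ (j, i) = (if i = j then \<alpha> else 0) + (if i = j XOR s then \<i> * \<alpha> else 0)"
    using ij by (simp add: two_term_def)
  also have "?W $$ (j XOR s, i) = (if i = j XOR s then \<alpha> else 0) + (if i = j then \<i> * \<alpha> else 0)"
    using ij x by (simp add: two_term_def)
  also have "\<alpha> * pauli_Z_sign j * ((if i = j then \<alpha> else 0) + (if i = j XOR s then \<i> * \<alpha> else 0)) +
    \<i> * \<alpha> * pauli_Z_sign j * ((if i = j XOR s then \<alpha> else 0) + (if i = j then \<i> * \<alpha> else 0)) =
    (if i = j XOR s then \<i> * pauli_Z_sign j * (\<alpha> * \<alpha> + \<alpha> * \<alpha>) else 0)"
    using ne by (auto simp: algebra_simps)
  also have "\<dots> = (if i = j XOR s then \<i> * pauli_Z_sign j else 0)" by (simp add: a)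
  finally show ?thesis by (simp add: rotation_def \<alpha>_def)
qed

text \<open>A Bessel inequality for B = U Z U\<dagger> against the orthogonal operators \<i> Z X^s.
  The term for s involves only the entries of B at positions (j XOR s, j), which are disjoint for
  different s; Cauchy-Schwarz costs a factor 2^n, and the squared Frobenius norm of B is
  2^n.\<close>

lemma sum_rotation_return_le:
  assumes U: "U \<in> unitary_group (2 ^ n)" and S: "S \<subseteq> {s. s < 2 ^ n \<and> odd s}"
  shows "(\<Sum>s\<in>S. (cmod (Z_return (2 ^ n) (rotation n s * U)))\<^sup>2) \<le> (2 ^ n)\<^sup>2"
proof -
  define B where "B = conj_Z (2 ^ n) (mat_adjoint U)"
  note Uc = unitary_group_carrier[OF U]
  have Z: "Z_return (2 ^ n) (rotation n s * U) = (\<Sum>j<2^n. \<i> * pauli_Z_sign j * B (j XOR s) j)"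
    if s: "s \<in> S" for s
  proof -
    have s': "s < 2 ^ n" "odd s" using s S by auto
    have e: "(\<Sum>i<2^n. \<Sum>j<2^n. U $$ (b, i) * (if i = j then pauli_Z_sign i else 0) * cnj (U $$ (a, j))) = B b a"
      if "a < 2 ^ n" "b < 2 ^ n" for a b
    proof -
      have "(\<Sum>i<2^n. \<Sum>j<2^n. U $$ (b, i) * (if i = j then pauli_Z_sign i else 0) * cnj (U $$ (a, j))) =
        (\<Sum>i<2^n. \<Sum>j<2^n. if j = i then U $$ (b, i) * pauli_Z_sign i * cnj (U $$ (a, i)) else 0)"
        by (intro sum.cong refl) auto
      also have "\<dots> = (\<Sum>i<2^n. U $$ (b, i) * pauli_Z_sign i * cnj (U $$ (a, i)))" by simp
      also have "\<dots> = B b a"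
        unfolding B_def conj_Z_def using Uc that by (intro sum.cong refl) auto
      finally show ?thesis .
    qed
    have "Z_return (2 ^ n) (rotation n s * U) = (\<Sum>i<2^n. \<Sum>j<2^n. B i j * conj_Z (2 ^ n) (rotation n s) j i)"
      by (subst Z_return_mult[OF _ Uc]) (auto simp: overlap_def e rotation_def two_term_def)
    also have "\<dots> = (\<Sum>j<2^n. \<Sum>i<2^n. if i = j XOR s then \<i> * pauli_Z_sign j * B i j else 0)"
      by (subst sum.swap) (intro sum.cong refl, auto simp: conj_Z_rotation[OF s'])
    also have "\<dots> = (\<Sum>j<2^n. \<i> * pauli_Z_sign j * B (j XOR s) j)"
      by (intro sum.cong refl) (simp add: xor_less_pow2 s'(1))
    finally show ?thesis .
  qed
  have "(cmod (Z_return (2 ^ n) (rotation n s * U)))\<^sup>2 \<le> 2 ^ n * (\<Sum>j<2^n. (cmod (B (j XOR s) j))\<^sup>2)"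
    if s: "s \<in> S" for s
  proof -
    have "cmod (Z_return (2 ^ n) (rotation n s * U)) \<le> (\<Sum>j<2^n. cmod (B (j XOR s) j) * 1)"
      unfolding Z[OF s] by (rule sum_norm_le) (simp add: norm_mult)
    then have "(cmod (Z_return (2 ^ n) (rotation n s * U)))\<^sup>2 \<le> (\<Sum>j<2^n. cmod (B (j XOR s) j) * 1)\<^sup>2"
      by (rule power_mono) simp
    also have "\<dots> \<le> (\<Sum>j<2^n. (cmod (B (j XOR s) j))\<^sup>2) * (\<Sum>j<(2::nat)^n. 1\<^sup>2)"
      by (rule Cauchy_Schwarz_ineq_sum)
    finally show ?thesis by (simp add: mult.commute)
  qed
  then have "(\<Sum>s\<in>S. (cmod (Z_return (2 ^ n) (rotation n s * U)))\<^sup>2) \<le>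
    (\<Sum>s\<in>S. 2 ^ n * (\<Sum>j<2^n. (cmod (B (j XOR s) j))\<^sup>2))"
    by (rule sum_mono)
  also have "\<dots> \<le> (\<Sum>s<2^n. 2 ^ n * (\<Sum>j<2^n. (cmod (B (j XOR s) j))\<^sup>2))"
    by (rule sum_mono2) (use S in \<open>auto intro!: mult_nonneg_nonneg sum_nonneg\<close>)
  also have "\<dots> = 2 ^ n * (\<Sum>j<2^n. \<Sum>s<2^n. (cmod (B (j XOR s) j))\<^sup>2)"
    by (simp only: sum_distrib_left[symmetric]) (subst sum.swap, rule refl)
  \<comment> \<open>For fixed j, XOR with j permutes the indices s, so every entry of B is counted
    once.\<close>
  also have "(\<Sum>j<2^n. \<Sum>s<2^n. (cmod (B (j XOR s) j))\<^sup>2) = (\<Sum>j<2^n. \<Sum>i<2^n. (cmod (B i j))\<^sup>2)"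
    by (intro sum.cong refl sum_xor) auto
  also have "\<dots> = 2 ^ n"
    unfolding B_def by (subst sum.swap) (simp add: conj_Z_frobenius[OF unitary_group_adjoint[OF U]])
  finally show ?thesis by (simp add: power2_eq_square)
qed

text \<open>By left invariance all rotated returns have the same mean q, so
  \<open>card S * q\<close> is at most 4^n, and \<open>card S\<close> is at least 2^(n-2) = 2^n /
  4.\<close>

lemma haar_Z_return_le:
  assumes h: "haar_measure (2 ^ n) (gate_group n) \<mu>" and n: "n \<ge> 2"
  shows "(\<integral>U. (cmod (Z_return (2 ^ n) U))\<^sup>2 \<partial>\<mu>) \<le> 4 * 2 ^ n"
proof -
  define S where "S = {s. s < 2 ^ n \<and> odd s \<and> popcount_sign n s = -1}"
  define q where "q = (\<integral>U. (cmod (Z_return (2 ^ n) U))\<^sup>2 \<partial>\<mu>)"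
  note e = haar_measure_ensemble[OF h]
  interpret prob_space \<mu> by (rule ensemble_on_prob[OF e])
  have bm: "bdd_meas \<mu> (\<lambda>U. (cmod (overlap (2 ^ n) B U))\<^sup>2)" for B
    by (intro bdd_meas_norm_square bdd_meas_overlap[OF e gate_group_subset_unitary])
  have R: "rotation n s \<in> gate_group n" "rotation n s \<in> carrier_mat (2 ^ n) (2 ^ n)" if "s \<in> S" for s
    using that rotation_mem_gate_group by (auto simp: S_def rotation_def two_term_def)
  have tr: "(\<integral>U. (cmod (Z_return (2 ^ n) (rotation n s * U)))\<^sup>2 \<partial>\<mu>) = q" if "s \<in> S" for s
    unfolding q_def
    by (rule haar_integral_translate(2)[OF h R[OF that]])
       (use bm in \<open>simp add: Z_return_def bdd_meas_def\<close>)
  have int: "integrable \<mu> (\<lambda>U. (cmod (Z_return (2 ^ n) (rotation n s * U)))\<^sup>2)" if "s \<in> S" for s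
  proof (rule bdd_meas_integrable[OF finite_measure_axioms bdd_meas_norm_square])
    \<comment> \<open>By cyclicity the rotated amplitude is a polynomial in the entries of U and
      their conjugates, which gives its integrability.\<close>
    have "bdd_meas \<mu> (\<lambda>U. \<Sum>i<2^n. \<Sum>j<2^n. (\<Sum>a<2^n. \<Sum>b<2^n. U $$ (i, a) *
      (if a = b then pauli_Z_sign a else 0) * cnj (U $$ (j, b))) * conj_Z (2 ^ n) (rotation n s) j i)"
      by (intro bdd_meas_intros bdd_meas_entry[OF e gate_group_subset_unitary]) auto
    then show "bdd_meas \<mu> (\<lambda>U. Z_return (2 ^ n) (rotation n s * U))"
      unfolding bdd_meas_def
    proof (elim conjE exE, intro conjI exI)
      let ?f = "\<lambda>U. \<Sum>i<2^n. \<Sum>j<2^n. (\<Sum>a<2^n. \<Sum>b<2^n. U $$ (i, a) *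
        (if a = b then pauli_Z_sign a else 0) * cnj (U $$ (j, b))) * conj_Z (2 ^ n) (rotation n s) j i"
      have eq: "Z_return (2 ^ n) (rotation n s * U) = ?f U" if "U \<in> space \<mu>" for U
        using that Z_return_mult[OF R(2)[OF \<open>s \<in> S\<close>]] by (simp add: ensemble_on_space[OF e] overlap_def)
      assume "?f \<in> borel_measurable \<mu>"
      then show "(\<lambda>U. Z_return (2 ^ n) (rotation n s * U)) \<in> borel_measurable \<mu>"
        by (subst measurable_cong[OF eq])
      fix K assume "AE U in \<mu>. cmod (?f U) \<le> K"
      then show "AE U in \<mu>. cmod (Z_return (2 ^ n) (rotation n s * U)) \<le> K"
        by (rule AE_mp) (intro AE_I2 impI, simp only: eq)
    qed
  qed
  have "real (card S) * q = (\<Sum>s\<in>S. \<integral>U. (cmod (Z_return (2 ^ n) (rotation n s * U)))\<^sup>2 \<partial>\<mu>)"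
    by (simp add: tr)
  also have "\<dots> = (\<integral>U. (\<Sum>s\<in>S. (cmod (Z_return (2 ^ n) (rotation n s * U)))\<^sup>2) \<partial>\<mu>)"
    by (rule Bochner_Integration.integral_sum[symmetric]) (rule int)
  also have "\<dots> \<le> (\<integral>U. (2 ^ n)\<^sup>2 \<partial>\<mu>)"
  proof (rule integral_mono_AE)
    show "AE U in \<mu>. (\<Sum>s\<in>S. (cmod (Z_return (2 ^ n) (rotation n s * U)))\<^sup>2) \<le> (2 ^ n)\<^sup>2"
      using ensemble_on_AE[OF e]
      by eventually_elim (rule sum_rotation_return_le, auto simp: gate_group_unitary S_def)
  qed (use int in auto)
  finally have le: "real (card S) * q \<le> (2 ^ n)\<^sup>2" by (simp add: prob_space)
  have "(2::real) ^ n = 4 * 2 ^ (n - 2)"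
    by (rule power2_minus_2[OF n])
  moreover have "2 ^ (n - 2) \<le> real (card S)"
    using card_odd_popcount[OF n] unfolding S_def by (metis of_nat_le_iff of_nat_numeral of_nat_power)
  moreover have "q \<ge> 0" unfolding q_def by (rule integral_nonneg_AE) simp
  ultimately have "2 ^ n * q \<le> 4 * real (card S) * q" by (intro mult_right_mono) auto
  also have "\<dots> \<le> 2 ^ n * (4 * 2 ^ n)" using le by (simp add: power2_eq_square)
  finally show ?thesis unfolding q_def[symmetric] by simp
qed

section \<open>Relative-error designs\<close>

text \<open>Entrywise version of \<open>bdd_meas\<close>. The dimensions must hold at every point,
  so that entries of products and Kronecker products can be expanded; the integrand of a twirl is
  then covered by its structure.\<close>

definition bdd_meas_mat :: "'w measure \<Rightarrow> nat \<Rightarrow> nat \<Rightarrow> ('w \<Rightarrow> complex mat) \<Rightarrow> bool" where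
  "bdd_meas_mat M a b f \<longleftrightarrow> (\<forall>x\<in>space M. f x \<in> carrier_mat a b) \<and>
     (\<forall>i<a. \<forall>j<b. bdd_meas M (\<lambda>x. f x $$ (i, j)))"

lemma bdd_meas_cong:
  assumes "\<And>x. x \<in> space M \<Longrightarrow> f x = g x" "bdd_meas M g"
  shows "bdd_meas M f"
  unfolding bdd_meas_def
proof
  show "f \<in> borel_measurable M"
    using assms by (subst measurable_cong[where g = g]) (auto simp: bdd_meas_def)
  obtain B where "AE x in M. norm (g x) \<le> B" using assms(2) by (auto simp: bdd_meas_def)
  then have "AE x in M. norm (f x) \<le> B" by (rule AE_mp) (use assms(1) in auto)
  then show "\<exists>B. AE x in M. norm (f x) \<le> B" ..
qed

lemma bdd_meas_mat_const: "A \<in> carrier_mat a b \<Longrightarrow> bdd_meas_mat M a b (\<lambda>_. A)"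
  by (simp add: bdd_meas_mat_def)

lemma bdd_meas_mat_mult:
  assumes "bdd_meas_mat M a b f" "bdd_meas_mat M b c g"
  shows "bdd_meas_mat M a c (\<lambda>x. f x * g x)"
  unfolding bdd_meas_mat_def
proof (intro conjI ballI allI impI)
  show "f x * g x \<in> carrier_mat a c" if "x \<in> space M" for x
    using assms that by (auto simp: bdd_meas_mat_def intro: mult_carrier_mat)
  show "bdd_meas M (\<lambda>x. (f x * g x) $$ (i, j))" if "i < a" "j < c" for i j
  proof (rule bdd_meas_cong)
    show "(f x * g x) $$ (i, j) = (\<Sum>k<b. f x $$ (i, k) * g x $$ (k, j))" if "x \<in> space M" for x
      using assms that \<open>i < a\<close> \<open>j < c\<close> by (intro mat_mult_index) (auto simp: bdd_meas_mat_def)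
    show "bdd_meas M (\<lambda>x. \<Sum>k<b. f x $$ (i, k) * g x $$ (k, j))"
      using assms that by (intro bdd_meas_intros) (auto simp: bdd_meas_mat_def)
  qed
qed

lemma bdd_meas_mat_kron:
  assumes "bdd_meas_mat M a b f" "bdd_meas_mat M c d g"
  shows "bdd_meas_mat M (a * c) (b * d) (\<lambda>x. kron (f x) (g x))"
  unfolding bdd_meas_mat_def
proof (intro conjI ballI allI impI)
  show "kron (f x) (g x) \<in> carrier_mat (a * c) (b * d)" if "x \<in> space M" for x
    using assms that by (auto simp: bdd_meas_mat_def)
  show "bdd_meas M (\<lambda>x. kron (f x) (g x) $$ (i, j))" if ij: "i < a * c" "j < b * d" for i j
  proof (rule bdd_meas_cong)
    show "kron (f x) (g x) $$ (i, j) = f x $$ (i div c, j div d) * g x $$ (i mod c, j mod d)" if "x \<in> space M" for x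
    proof -
      have "f x \<in> carrier_mat a b" "g x \<in> carrier_mat c d" using assms that by (auto simp: bdd_meas_mat_def)
      then show ?thesis using ij by (auto simp: kron_index)
    qed
    show "bdd_meas M (\<lambda>x. f x $$ (i div c, j div d) * g x $$ (i mod c, j mod d))"
      using assms div_mod_bounds[OF ij(1)] div_mod_bounds[OF ij(2)]
      by (intro bdd_meas_intros) (auto simp: bdd_meas_mat_def)
  qed
qed

lemma bdd_meas_mat_kron_pow:
  assumes "bdd_meas_mat M a b f"
  shows "bdd_meas_mat M (a ^ k) (b ^ k) (\<lambda>x. kron_pow (f x) k)"
  by (induction k) (auto intro: bdd_meas_mat_kron assms bdd_meas_mat_const)

lemma bdd_meas_mat_adjoint:
  assumes "bdd_meas_mat M a b f"
  shows "bdd_meas_mat M b a (\<lambda>x. mat_adjoint (f x))"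
  unfolding bdd_meas_mat_def
proof (intro conjI ballI allI impI)
  show "mat_adjoint (f x) \<in> carrier_mat b a" if "x \<in> space M" for x
    using assms that by (auto simp: bdd_meas_mat_def)
  show "bdd_meas M (\<lambda>x. mat_adjoint (f x) $$ (i, j))" if ij: "i < b" "j < a" for i j
  proof (rule bdd_meas_cong)
    show "mat_adjoint (f x) $$ (i, j) = cnj (f x $$ (j, i))" if "x \<in> space M" for x
    proof -
      have "f x \<in> carrier_mat a b" using assms that by (auto simp: bdd_meas_mat_def)
      then show ?thesis using ij by auto
    qed
    show "bdd_meas M (\<lambda>x. cnj (f x $$ (j, i)))"
      using assms ij by (intro bdd_meas_intros) (auto simp: bdd_meas_mat_def)
  qed
qed

lemma bdd_meas_mat_ensemble:
  assumes "ensemble_on N G E" "G \<subseteq> unitary_group N"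
  shows "bdd_meas_mat E N N (\<lambda>U. U)"
  using bdd_meas_entry[OF assms] by (simp add: bdd_meas_mat_def ensemble_on_space[OF assms(1)])

lemma twirl_carrier [simp]: "twirl N k E A \<in> carrier_mat (N ^ k) (N ^ k)"
  by (simp add: twirl_def)

lemma bdd_meas_mat_twirl:
  assumes E: "ensemble_on N G E" "G \<subseteq> unitary_group N" and A: "A \<in> carrier_mat (N ^ k) (N ^ k)"
  shows "bdd_meas_mat E (N ^ k) (N ^ k) (\<lambda>U. kron_pow U k * A * kron_pow (mat_adjoint U) k)"
proof (rule bdd_meas_mat_mult[OF bdd_meas_mat_mult[OF _ bdd_meas_mat_const[OF A]]])
  note I = bdd_meas_mat_ensemble[OF E]
  show "bdd_meas_mat E (N ^ k) (N ^ k) (\<lambda>U. kron_pow U k)" by (rule bdd_meas_mat_kron_pow[OF I])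
  show "bdd_meas_mat E (N ^ k) (N ^ k) (\<lambda>U. kron_pow (mat_adjoint U) k)"
    by (rule bdd_meas_mat_kron_pow[OF bdd_meas_mat_adjoint[OF I]])
qed

lemma quad_form_twirl:
  assumes E: "ensemble_on N G E" "G \<subseteq> unitary_group N" and A: "A \<in> carrier_mat (N ^ k) (N ^ k)"
  shows "quad_form (N ^ k) (twirl N k E A) v =
    (\<integral>U. quad_form (N ^ k) (kron_pow U k * A * kron_pow (mat_adjoint U) k) v \<partial>E)"
proof -
  interpret prob_space E by (rule ensemble_on_prob[OF E(1)])
  let ?F = "\<lambda>U. kron_pow U k * A * kron_pow (mat_adjoint U) k"
  have "bdd_meas_mat E (N ^ k) (N ^ k) ?F"
    by (rule bdd_meas_mat_twirl[OF E A])
  then have b: "bdd_meas E (\<lambda>U. ?F U $$ (i, j))" if "i < N ^ k" "j < N ^ k" for i j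
    using that by (simp add: bdd_meas_mat_def)
  note int = bdd_meas_integrable[OF finite_measure_axioms]
  have "(\<integral>U. quad_form (N ^ k) (?F U) v \<partial>E) =
    (\<Sum>i<N^k. \<integral>U. (\<Sum>j<N^k. cnj (v $ i) * ?F U $$ (i, j) * v $ j) \<partial>E)"
    unfolding quad_form_def
    by (rule Bochner_Integration.integral_sum, rule int) (intro bdd_meas_intros b; simp)
  also have "\<dots> = (\<Sum>i<N^k. \<Sum>j<N^k. \<integral>U. cnj (v $ i) * ?F U $$ (i, j) * v $ j \<partial>E)"
    by (intro sum.cong refl Bochner_Integration.integral_sum, rule int) (intro bdd_meas_intros b; simp)
  also have "\<dots> = quad_form (N ^ k) (twirl N k E A) v"
    unfolding quad_form_def twirl_def by (intro sum.cong refl) simp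
  finally show ?thesis ..
qed

text \<open>With a one-dimensional second factor the ampliation is the map itself, so complete
  positivity yields positivity.\<close>

lemma ampliation_1:
  assumes "X \<in> carrier_mat D D" "\<Phi> X \<in> carrier_mat D D"
  shows "ampliation D 1 \<Phi> X = \<Phi> X"
proof -
  have "mat D D (\<lambda>(s, t). X $$ (s, t)) = X" using assms by (intro eq_matI) auto
  then show ?thesis unfolding ampliation_def using assms by (intro eq_matI) auto
qed

lemma quad_form_diff:
  assumes "A \<in> carrier_mat D D" "B \<in> carrier_mat D D"
  shows "quad_form D (c \<cdot>\<^sub>m A - B) v = c * quad_form D A v - quad_form D B v"
  unfolding quad_form_def sum_distrib_left sum_subtractf[symmetric] using assms
  by (intro sum.cong refl) (auto simp: algebra_simps)

text \<open>The order on maps becomes a numerical inequality once a positive input and a test vector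
  are chosen.\<close>

lemma cp_le_quad_form:
  assumes cp: "cp_le D \<Phi> (\<lambda>A. c \<cdot>\<^sub>m \<Psi> A)" and X: "pos_semidef D X" and v: "v \<in> carrier_vec D"
    and c: "\<Phi> X \<in> carrier_mat D D" "\<Psi> X \<in> carrier_mat D D"
  shows "quad_form D (\<Phi> X) v \<le> c * quad_form D (\<Psi> X) v"
proof -
  let ?Y = "c \<cdot>\<^sub>m \<Psi> X - \<Phi> X"
  have Xc: "X \<in> carrier_mat D D" using X by (simp add: pos_semidef_def)
  have Y: "?Y \<in> carrier_mat D D" using c by auto
  have "pos_semidef (D * 1) (ampliation D 1 (\<lambda>A. c \<cdot>\<^sub>m \<Psi> A - \<Phi> A) X)"
    using cp X unfolding cp_le_def completely_positive_def by (metis mult_1_right)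
  then have "pos_semidef D ?Y" using ampliation_1[OF Xc, of "\<lambda>A. c \<cdot>\<^sub>m \<Psi> A - \<Phi> A"] Y by simp
  then have "0 \<le> (?Y *\<^sub>v v) \<bullet>c v" using v by (simp add: pos_semidef_def)
  then show ?thesis by (simp add: quad_form_eq[OF Y v] quad_form_diff[OF c(2,1)])
qed

text \<open>\<open>vec_ZK n\<close> vectorises \<open>Z Y\<^sup>\<otimes>\<^sup>n\<close>; the remaining \<open>k - 2\<close> copies carry an identity in the test input
  and a basis vector in the test vector.\<close>

definition vec_ZK :: "nat \<Rightarrow> complex mat" where
  "vec_ZK n = mat (2 ^ n * 2 ^ n) 1
     (\<lambda>(x, _). pauli_Z_sign (x div 2 ^ n) * kron_pow pauli_Y n $$ (x div 2 ^ n, x mod 2 ^ n))"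

definition test_mat :: "nat \<Rightarrow> nat \<Rightarrow> complex mat" where
  "test_mat n M = kron (vec_ZK n) (1\<^sub>m M)"

definition test_vec :: "nat \<Rightarrow> nat \<Rightarrow> complex vec" where
  "test_vec n M = vec (2 ^ n * 2 ^ n * M) (\<lambda>x. vec_ZK n $$ (x div M, 0) * (if x mod M = 0 then 1 else 0))"

lemma vec_ZK_carrier: "vec_ZK n \<in> carrier_mat (2 ^ n * 2 ^ n) 1"
  by (simp add: vec_ZK_def)

lemma gate_group_transpose:
  assumes U: "U \<in> gate_group n" and cb: "c < 2 ^ n" "b < 2 ^ n"
  shows "(\<Sum>d<2^n. kron_pow pauli_Y n $$ (c, d) * U $$ (b, d)) = (\<Sum>e<2^n. cnj (U $$ (e, c)) * kron_pow pauli_Y n $$ (e, b))"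
proof -
  let ?K = "kron_pow pauli_Y n" and ?N = "(2::nat) ^ n"
  have u: "U \<in> unitary_group ?N" by (rule gate_group_unitary[OF U])
  have C: "U \<in> carrier_mat ?N ?N" "?K \<in> carrier_mat ?N ?N" "mat_adjoint U \<in> carrier_mat ?N ?N" "transpose_mat U \<in> carrier_mat ?N ?N"
    using unitary_group_carrier[OF u] by auto
  have "mat_adjoint U * (U * ?K * transpose_mat U) = (mat_adjoint U * U) * (?K * transpose_mat U)"
    using C by (simp add: assoc_mult_mat[of _ ?N ?N _ ?N _ ?N] square_mult_carrier[of _ ?N])
  also have "\<dots> = ?K * transpose_mat U"
    using u square_mult_carrier[OF C(2,4)] by (simp add: unitary_group_def)
  finally have eq: "?K * transpose_mat U = mat_adjoint U * ?K"
    using U by (simp add: gate_group_def bilinear_isometry_group_def)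
  have "(?K * transpose_mat U) $$ (c, b) = (\<Sum>d<?N. ?K $$ (c, d) * transpose_mat U $$ (d, b))"
    using cb C by (intro mat_mult_index) auto
  also have "\<dots> = (\<Sum>d<?N. ?K $$ (c, d) * U $$ (b, d))"
    using cb C by (intro sum.cong refl) auto
  finally have 1: "(?K * transpose_mat U) $$ (c, b) = (\<Sum>d<?N. ?K $$ (c, d) * U $$ (b, d))" .
  have "(mat_adjoint U * ?K) $$ (c, b) = (\<Sum>e<?N. mat_adjoint U $$ (c, e) * ?K $$ (e, b))"
    using cb C by (intro mat_mult_index) auto
  also have "\<dots> = (\<Sum>e<?N. cnj (U $$ (e, c)) * ?K $$ (e, b))"
    using cb C by (intro sum.cong refl) auto
  finally show ?thesis using 1 eq by simp
qed

text \<open>With K the power of Y, U \<otimes> U sends the vectorisation of Z K to that of U Z K U^T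
  = U Z U\<dagger> K. Its inner product with the vectorisation of Z K is tr(Z U Z U\<dagger>),
  because K is unitary.\<close>

lemma vec_ZK_overlap:
  assumes U: "U \<in> gate_group n"
  shows "(\<Sum>p<2^n * 2^n. cnj (vec_ZK n $$ (p, 0)) * (kron U U * vec_ZK n) $$ (p, 0)) = Z_return (2 ^ n) U"
proof -
  let ?K = "kron_pow pauli_Y n" and ?N = "(2::nat) ^ n" and ?z = pauli_Z_sign
  have u: "U \<in> unitary_group ?N" by (rule gate_group_unitary[OF U])
  note Uc = unitary_group_carrier[OF u]
  have K: "?K \<in> unitary_group ?N" by (rule kron_pow_unitary[OF pauli_Y_unitary])
  have T: "(kron U U * vec_ZK n) $$ (p, 0) = (\<Sum>e<?N. \<Sum>c<?N. U $$ (p div ?N, c) * ?z c * cnj (U $$ (e, c)) * ?K $$ (e, p mod ?N))"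
    if p: "p < ?N * ?N" for p
  proof -
    note b = div_mod_bounds[OF p]
    have "(kron U U * vec_ZK n) $$ (p, 0) = (\<Sum>y<?N * ?N. kron U U $$ (p, y) * vec_ZK n $$ (y, 0))"
      using p kron_carrier[OF Uc Uc] vec_ZK_carrier by (intro mat_mult_index) auto
    also have "\<dots> = (\<Sum>y<?N * ?N. U $$ (p div ?N, y div ?N) * U $$ (p mod ?N, y mod ?N) *
        (?z (y div ?N) * ?K $$ (y div ?N, y mod ?N)))"
      using p Uc by (intro sum.cong refl) (simp add: kron_index vec_ZK_def)
    also have "\<dots> = (\<Sum>c<?N. \<Sum>d<?N. U $$ (p div ?N, c) * U $$ (p mod ?N, d) * (?z c * ?K $$ (c, d)))"
      by (rule sum_div_mod)
    also have "\<dots> = (\<Sum>c<?N. U $$ (p div ?N, c) * ?z c * (\<Sum>d<?N. ?K $$ (c, d) * U $$ (p mod ?N, d)))"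
      by (simp add: sum_distrib_left ac_simps)
    \<comment> \<open>Here the symplectic condition enters: K U^T is replaced by U\<dagger>
      K.\<close>
    also have "\<dots> = (\<Sum>c<?N. U $$ (p div ?N, c) * ?z c * (\<Sum>e<?N. cnj (U $$ (e, c)) * ?K $$ (e, p mod ?N)))"
      using b by (intro sum.cong refl) (simp add: gate_group_transpose[OF U])
    also have "\<dots> = (\<Sum>c<?N. \<Sum>e<?N. U $$ (p div ?N, c) * ?z c * cnj (U $$ (e, c)) * ?K $$ (e, p mod ?N))"
      by (simp add: sum_distrib_left ac_simps)
    finally show ?thesis by (subst sum.swap)
  qed
  have "(\<Sum>p<?N * ?N. cnj (vec_ZK n $$ (p, 0)) * (kron U U * vec_ZK n) $$ (p, 0)) =
    (\<Sum>p<?N * ?N. (?z (p div ?N) * cnj (?K $$ (p div ?N, p mod ?N))) *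
      (\<Sum>e<?N. \<Sum>c<?N. U $$ (p div ?N, c) * ?z c * cnj (U $$ (e, c)) * ?K $$ (e, p mod ?N)))"
  proof (rule sum.cong[OF refl])
    fix p assume p: "p \<in> {..<?N * ?N}"
    then have "cnj (vec_ZK n $$ (p, 0)) = ?z (p div ?N) * cnj (?K $$ (p div ?N, p mod ?N))"
      by (simp add: vec_ZK_def)
    then show "cnj (vec_ZK n $$ (p, 0)) * (kron U U * vec_ZK n) $$ (p, 0) =
      (?z (p div ?N) * cnj (?K $$ (p div ?N, p mod ?N))) *
      (\<Sum>e<?N. \<Sum>c<?N. U $$ (p div ?N, c) * ?z c * cnj (U $$ (e, c)) * ?K $$ (e, p mod ?N))"
      using p by (simp only: T lessThan_iff)
  qed
  also have "\<dots> = (\<Sum>a<?N. \<Sum>b<?N. (?z a * cnj (?K $$ (a, b))) *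
      (\<Sum>e<?N. \<Sum>c<?N. U $$ (a, c) * ?z c * cnj (U $$ (e, c)) * ?K $$ (e, b)))"
    by (rule sum_div_mod)
  also have "\<dots> = (\<Sum>a<?N. \<Sum>b<?N. \<Sum>e<?N. (\<Sum>c<?N. ?z a * (U $$ (a, c) * ?z c * cnj (U $$ (e, c)))) * (?K $$ (e, b) * cnj (?K $$ (a, b))))"
    by (simp add: sum_distrib_left sum_distrib_right ac_simps)
  also have "\<dots> = (\<Sum>a<?N. \<Sum>e<?N. (\<Sum>c<?N. ?z a * (U $$ (a, c) * ?z c * cnj (U $$ (e, c)))) * (\<Sum>b<?N. ?K $$ (e, b) * cnj (?K $$ (a, b))))"
    by (subst sum.swap) (simp add: sum_distrib_left)
  \<comment> \<open>The sum over b is an entry of K K\<dagger> = 1, so K disappears.\<close>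
  also have "\<dots> = (\<Sum>a<?N. \<Sum>e<?N. if e = a then (\<Sum>c<?N. ?z a * (U $$ (a, c) * ?z c * cnj (U $$ (e, c)))) else 0)"
    by (intro sum.cong refl) (simp add: unitary_group_rows[OF K])
  also have "\<dots> = (\<Sum>a<?N. \<Sum>c<?N. ?z a * (U $$ (a, c) * ?z c * cnj (U $$ (a, c))))"
    by simp
  also have "\<dots> = (\<Sum>i<?N. \<Sum>j<?N. if j = i then ?z i * conj_Z ?N U i i else 0)"
    unfolding conj_Z_def by (subst sum.swap) (simp add: sum_distrib_left ac_simps)
  also have "\<dots> = Z_return ?N U"
    unfolding Z_return_def overlap_def by (intro sum.cong refl) auto
  finally show ?thesis .
qed

text \<open>On the first two copies the test gives the squared return amplitude. On the other k - 2
  copies, with R the power of U acting there, the identity input and the first basis vector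
  contribute the squared norm of row 0 of R, which is 1. Every k \<ge> 2 thus reduces to the second
  moment.\<close>

lemma quad_form_test:
  assumes U: "U \<in> gate_group n" and k: "k \<ge> 2"
  defines "M \<equiv> (2 ^ n) ^ (k - 2)"
  shows "quad_form ((2 ^ n) ^ k) (kron_pow U k * (test_mat n M * mat_adjoint (test_mat n M)) * kron_pow (mat_adjoint U) k) (test_vec n M)
    = of_real ((cmod (Z_return (2 ^ n) U))\<^sup>2)"
proof -
  let ?N = "(2::nat) ^ n"
  define R where "R = kron_pow U (k - 2)"
  have u: "U \<in> unitary_group ?N" by (rule gate_group_unitary[OF U])
  note Uc = unitary_group_carrier[OF u]
  have Ru: "R \<in> unitary_group M" unfolding R_def M_def by (rule kron_pow_unitary[OF u])
  note Rc = unitary_group_carrier[OF Ru]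
  have D: "?N ^ k = ?N * ?N * M"
    unfolding M_def using k by (metis le_add_diff_inverse power_add power2_eq_square)
  have M: "M > 0" by (simp add: M_def)
  obtain k' where k': "k = Suc (Suc k')" using k by (metis Suc_le_D numeral_2_eq_2 Suc_le_mono)
  have KU: "kron_pow U k = kron (kron U U) R" unfolding R_def k' by (simp add: kron_assoc)
  define P where "P = kron U U * vec_ZK n"
  have UU: "kron U U \<in> carrier_mat (?N * ?N) (?N * ?N)" by (rule kron_carrier[OF Uc Uc])
  have Pc: "P \<in> carrier_mat (?N * ?N) 1" unfolding P_def by (rule mult_carrier_mat[OF UU vec_ZK_carrier])
  have F: "test_mat n M \<in> carrier_mat (?N * ?N * M) (1 * M)"
    unfolding test_mat_def by (rule kron_carrier[OF vec_ZK_carrier]) simp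
  have KUc: "kron_pow U k \<in> carrier_mat (?N * ?N * M) (?N * ?N * M)" unfolding KU by (rule kron_carrier[OF UU Rc])
  define H where "H = kron P R"
  have H: "H \<in> carrier_mat (?N * ?N * M) (1 * M)" unfolding H_def by (rule kron_carrier[OF Pc Rc])
  have KF: "kron_pow U k * test_mat n M = H"
    unfolding KU test_mat_def H_def P_def using kron_mult[OF UU Rc vec_ZK_carrier one_carrier_mat] Rc by simp
  have "kron_pow U k * (test_mat n M * mat_adjoint (test_mat n M)) * kron_pow (mat_adjoint U) k =
    (kron_pow U k * test_mat n M) * (mat_adjoint (test_mat n M) * mat_adjoint (kron_pow U k))"
    unfolding kron_pow_adjoint
    using assoc_mult_mat[OF KUc F mat_adjoint_carrier[OF F]]
      assoc_mult_mat[OF mult_carrier_mat[OF KUc F] mat_adjoint_carrier[OF F] mat_adjoint_carrier[OF KUc]]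
    by simp
  also have "\<dots> = H * mat_adjoint H"
    unfolding KF[symmetric] mat_adjoint_mult[OF KUc F] ..
  finally have eq: "kron_pow U k * (test_mat n M * mat_adjoint (test_mat n M)) * kron_pow (mat_adjoint U) k = H * mat_adjoint H" .
  have v: "test_vec n M \<in> carrier_vec (?N * ?N * M)" by (simp add: test_vec_def)
  have t: "(\<Sum>i<?N * ?N * M. cnj (H $$ (i, t)) * test_vec n M $ i) = cnj (R $$ (0, t)) * cnj (Z_return ?N U)"
    if t: "t < M" for t
  proof -
    have "(\<Sum>i<?N * ?N * M. cnj (H $$ (i, t)) * test_vec n M $ i) =
      (\<Sum>i<?N * ?N * M. cnj (P $$ (i div M, 0)) * cnj (R $$ (i mod M, t)) *
        (vec_ZK n $$ (i div M, 0) * (if i mod M = 0 then 1 else 0)))"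
      using t Pc Rc by (intro sum.cong refl) (auto simp: H_def kron_index test_vec_def)
    also have "\<dots> = (\<Sum>p<?N * ?N. \<Sum>q<M. cnj (P $$ (p, 0)) * cnj (R $$ (q, t)) * (vec_ZK n $$ (p, 0) * (if q = 0 then 1 else 0)))"
      by (rule sum_div_mod)
    also have "\<dots> = (\<Sum>p<?N * ?N. \<Sum>q<M. if q = 0 then cnj (P $$ (p, 0)) * cnj (R $$ (q, t)) * vec_ZK n $$ (p, 0) else 0)"
      by (intro sum.cong refl) simp
    also have "\<dots> = (\<Sum>p<?N * ?N. cnj (P $$ (p, 0)) * cnj (R $$ (0, t)) * vec_ZK n $$ (p, 0))"
      using M by simp
    also have "\<dots> = cnj (R $$ (0, t)) * cnj (\<Sum>p<?N * ?N. cnj (vec_ZK n $$ (p, 0)) * P $$ (p, 0))"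
      by (simp add: sum_distrib_left ac_simps)
    also have "(\<Sum>p<?N * ?N. cnj (vec_ZK n $$ (p, 0)) * P $$ (p, 0)) = Z_return ?N U"
      unfolding P_def by (rule vec_ZK_overlap[OF U])
    finally show ?thesis .
  qed
  have r: "(\<Sum>t<M. (cmod (R $$ (0, t)))\<^sup>2) = 1"
  proof -
    have "complex_of_real (\<Sum>t<M. (cmod (R $$ (0, t)))\<^sup>2) = 1"
      using unitary_group_rows[OF Ru M M] by (simp add: complex_norm_square del: of_real_power)
    then show ?thesis by (simp only: of_real_eq_1_iff)
  qed
  have "quad_form (?N ^ k) (H * mat_adjoint H) (test_vec n M) =
    of_real (\<Sum>t<1 * M. (cmod (\<Sum>i<?N * ?N * M. cnj (H $$ (i, t)) * test_vec n M $ i))\<^sup>2)"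
    unfolding D by (rule quad_form_gram[OF H v])
  also have "(\<Sum>t<1 * M. (cmod (\<Sum>i<?N * ?N * M. cnj (H $$ (i, t)) * test_vec n M $ i))\<^sup>2) =
    (\<Sum>t<M. (cmod (R $$ (0, t)))\<^sup>2 * (cmod (Z_return ?N U))\<^sup>2)"
    by (intro sum.cong) (simp_all add: t norm_mult power_mult_distrib)
  also have "\<dots> = (cmod (Z_return ?N U))\<^sup>2"
    unfolding sum_distrib_right[symmetric] r by simp
  finally show ?thesis unfolding eq .
qed

text \<open>The twirls over E and over the Haar measure are tested with the same input and vector,
  and \<open>quad_form_test\<close> evaluates both. The squared modulus is a scalar of degree two in
  U and in its conjugate, which is why second-order designs control it.\<close>

lemma design_Z_return_le:
  assumes E: "relative_error_design (2 ^ n) (USp n) k \<epsilon> E" and k: "k \<ge> 2"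
  obtains \<mu> where "haar_measure (2 ^ n) (gate_group n) \<mu>" "ensemble_on (2 ^ n) (gate_group n) E"
    "(\<integral>U. (cmod (Z_return (2 ^ n) U))\<^sup>2 \<partial>E) \<le> (1 + \<epsilon>) * (\<integral>U. (cmod (Z_return (2 ^ n) U))\<^sup>2 \<partial>\<mu>)"
proof -
  obtain \<mu> where e: "ensemble_on (2 ^ n) (gate_group n) E" and h: "haar_measure (2 ^ n) (gate_group n) \<mu>"
    and cp: "cp_le ((2 ^ n) ^ k) (twirl (2 ^ n) k E) (\<lambda>A. complex_of_real (1 + \<epsilon>) \<cdot>\<^sub>m twirl (2 ^ n) k \<mu> A)"
    using E unfolding relative_error_design_def USp_eq_gate_group by blast
  define M :: nat where "M = (2 ^ n) ^ (k - 2)"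
  let ?D = "((2::nat) ^ n) ^ k"
  have D: "?D = 2 ^ n * 2 ^ n * M"
    unfolding M_def using k by (metis le_add_diff_inverse power_add power2_eq_square)
  let ?F = "test_mat n M"
  have F: "?F \<in> carrier_mat ?D (1 * M)"
    unfolding D test_mat_def by (rule kron_carrier[OF vec_ZK_carrier]) simp
  have X: "pos_semidef ?D (?F * mat_adjoint ?F)" by (rule pos_semidef_gram[OF F])
  have v: "test_vec n M \<in> carrier_vec ?D" unfolding D by (simp add: test_vec_def)
  have q: "quad_form ?D (twirl (2 ^ n) k \<nu> (?F * mat_adjoint ?F)) (test_vec n M) =
      complex_of_real (\<integral>U. (cmod (Z_return (2 ^ n) U))\<^sup>2 \<partial>\<nu>)"
    if \<nu>: "ensemble_on (2 ^ n) (gate_group n) \<nu>" for \<nu>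
  proof -
    let ?Q = "\<lambda>U. quad_form ?D (kron_pow U k * (?F * mat_adjoint ?F) * kron_pow (mat_adjoint U) k) (test_vec n M)"
    have "bdd_meas_mat \<nu> ?D ?D (\<lambda>U. kron_pow U k * (?F * mat_adjoint ?F) * kron_pow (mat_adjoint U) k)"
      by (rule bdd_meas_mat_twirl[OF \<nu> gate_group_subset_unitary]) (use X in \<open>simp add: pos_semidef_def\<close>)
    then have Q: "bdd_meas \<nu> ?Q"
      unfolding quad_form_def by (intro bdd_meas_intros) (auto simp: bdd_meas_mat_def)
    have Zm: "bdd_meas \<nu> (\<lambda>U. (cmod (Z_return (2 ^ n) U))\<^sup>2)"
      unfolding Z_return_def by (intro bdd_meas_norm_square bdd_meas_overlap[OF \<nu> gate_group_subset_unitary])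
    have "quad_form ?D (twirl (2 ^ n) k \<nu> (?F * mat_adjoint ?F)) (test_vec n M) = (\<integral>U. ?Q U \<partial>\<nu>)"
      by (rule quad_form_twirl[OF \<nu> gate_group_subset_unitary]) (use X in \<open>simp add: pos_semidef_def\<close>)
    also have "\<dots> = (\<integral>U. complex_of_real ((cmod (Z_return (2 ^ n) U))\<^sup>2) \<partial>\<nu>)"
    proof (rule integral_cong_AE)
      show "?Q \<in> borel_measurable \<nu>" using Q by (simp add: bdd_meas_def)
      have "(\<lambda>U. (cmod (Z_return (2 ^ n) U))\<^sup>2) \<in> borel_measurable \<nu>" using Zm by (simp add: bdd_meas_def)
      then show "(\<lambda>U. complex_of_real ((cmod (Z_return (2 ^ n) U))\<^sup>2)) \<in> borel_measurable \<nu>"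
        by measurable
      show "AE U in \<nu>. ?Q U = complex_of_real ((cmod (Z_return (2 ^ n) U))\<^sup>2)"
        using ensemble_on_AE[OF \<nu>] unfolding M_def by eventually_elim (rule quad_form_test[OF _ k])
    qed
    also have "\<dots> = complex_of_real (\<integral>U. (cmod (Z_return (2 ^ n) U))\<^sup>2 \<partial>\<nu>)"
      by (rule integral_complex_of_real)
    finally show ?thesis .
  qed
  have "complex_of_real (\<integral>U. (cmod (Z_return (2 ^ n) U))\<^sup>2 \<partial>E) \<le>
    complex_of_real (1 + \<epsilon>) * complex_of_real (\<integral>U. (cmod (Z_return (2 ^ n) U))\<^sup>2 \<partial>\<mu>)"
    using cp_le_quad_form[OF cp X v twirl_carrier twirl_carrier]
    unfolding q[OF e] q[OF haar_measure_ensemble[OF h]] .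
  then have "(\<integral>U. (cmod (Z_return (2 ^ n) U))\<^sup>2 \<partial>E) \<le> (1 + \<epsilon>) * (\<integral>U. (cmod (Z_return (2 ^ n) U))\<^sup>2 \<partial>\<mu>)"
    unfolding of_real_mult[symmetric] by (simp add: less_eq_complex_def)
  with h e show ?thesis by (rule that)
qed

text \<open>The additive 3 is the logarithm of 8 = 2 * 4: the factor 2 bounds 1 + \<epsilon>, the
  factor 4 comes from the Haar estimate.\<close>

lemma design_depth_ge:
  assumes \<epsilon>: "\<epsilon> < 1" and k: "k \<ge> 2" and n: "n \<ge> 2"
    and E: "relative_error_design (2 ^ n) (USp n) k \<epsilon> E"
    and B: "generalized_random_brickwork n \<Gamma> r d E"
  shows "n \<le> 2 * r * d + 3"
proof -
  obtain \<mu> where h: "haar_measure (2 ^ n) (gate_group n) \<mu>" and e: "ensemble_on (2 ^ n) (gate_group n) E"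
    and le: "(\<integral>U. (cmod (Z_return (2 ^ n) U))\<^sup>2 \<partial>E) \<le> (1 + \<epsilon>) * (\<integral>U. (cmod (Z_return (2 ^ n) U))\<^sup>2 \<partial>\<mu>)"
    using design_Z_return_le[OF E k] .
  interpret prob_space E by (rule ensemble_on_prob[OF e])
  have int: "integrable E (\<lambda>U. (cmod (Z_return (2 ^ n) U))\<^sup>2)"
    unfolding Z_return_def
    by (intro bdd_meas_integrable[OF finite_measure_axioms] bdd_meas_norm_square bdd_meas_overlap[OF e gate_group_subset_unitary])
  have "ennreal ((2 ^ n)\<^sup>2 * (1 / 4 ^ r) ^ d) \<le> ennreal (\<integral>U. (cmod (Z_return (2 ^ n) U))\<^sup>2 \<partial>E)"
    using random_brickwork_return[OF B] n nn_integral_eq_integral[OF int] by simp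
  then have "(2 ^ n)\<^sup>2 * (1 / 4 ^ r) ^ d \<le> (\<integral>U. (cmod (Z_return (2 ^ n) U))\<^sup>2 \<partial>E)"
    by (subst (asm) ennreal_le_iff) (auto intro: integral_nonneg_AE)
  also have "\<dots> \<le> (1 + \<epsilon>) * (\<integral>U. (cmod (Z_return (2 ^ n) U))\<^sup>2 \<partial>\<mu>)" by (rule le)
  also have "\<dots> \<le> 2 * (\<integral>U. (cmod (Z_return (2 ^ n) U))\<^sup>2 \<partial>\<mu>)"
    using \<epsilon> by (intro mult_right_mono integral_nonneg_AE) auto
  also have "\<dots> \<le> 2 * (4 * 2 ^ n)"
    using haar_Z_return_le[OF h n] by simp
  finally have "2 ^ n * (2 ^ n * (1 / 4 ^ r) ^ d) \<le> 2 ^ n * (8 :: real)"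
    by (simp add: power2_eq_square)
  then have "2 ^ n * (1 / 4 ^ r) ^ d \<le> (8 :: real)"
    by (subst (asm) mult_le_cancel_left_pos) auto
  then have "2 ^ n \<le> (8 :: real) * (4 ^ r) ^ d"
    by (simp add: power_divide divide_simps)
  also have "\<dots> = 2 ^ (2 * r * d + 3)"
    by (simp add: power_add power_mult)
  finally show ?thesis by simp
qed

theorem theoremS24:
  fixes \<epsilon> :: real and r :: nat
  assumes "\<epsilon> < 1"
  shows "\<exists>c>0. \<forall>\<^sub>F n in sequentially. odd n \<longrightarrow>
    (\<forall>k \<Gamma> d E. k \<ge> 2 \<longrightarrow> architecture n \<Gamma> \<longrightarrow>
       relative_error_design (2 ^ n) (USp n) k \<epsilon> E \<longrightarrow>
       generalized_random_brickwork n \<Gamma> r d E \<longrightarrow>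
       real d \<ge> c * real n)"
\<comment> \<open>For n \<ge> 6 the additive 3 is at most n / 2, so n \<le> 2 r d + 3 gives n \<le>
  4 r d. Using r + 1 in place of r keeps the constant positive at r = 0.\<close>
proof (intro exI[of _ "1 / (4 * (real r + 1))"] conjI)
  show "1 / (4 * (real r + 1)) > 0" by simp
  have "real d \<ge> 1 / (4 * (real r + 1)) * real n"
    if "n \<ge> 6" "k \<ge> 2" "relative_error_design (2 ^ n) (USp n) k \<epsilon> E" "generalized_random_brickwork n \<Gamma> r d E"
    for n k \<Gamma> d E
  proof -
    have "n \<le> 2 * r * d + 3"
      using that by (intro design_depth_ge[OF assms]) auto
    then have "real n \<le> 2 * real r * real d + 3"
      by (metis of_nat_le_iff of_nat_add of_nat_mult of_nat_numeral)
    moreover have "real n \<ge> 6" using that(1) by simp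
    ultimately have "real n \<le> 4 * (real r + 1) * real d"
      by (simp add: algebra_simps)
    then show ?thesis by (simp add: field_simps)
  qed
  then show "\<forall>\<^sub>F n in sequentially. odd n \<longrightarrow>
    (\<forall>k \<Gamma> d E. k \<ge> 2 \<longrightarrow> architecture n \<Gamma> \<longrightarrow>
       relative_error_design (2 ^ n) (USp n) k \<epsilon> E \<longrightarrow>
       generalized_random_brickwork n \<Gamma> r d E \<longrightarrow>
       real d \<ge> 1 / (4 * (real r + 1)) * real n)"
    unfolding eventually_sequentially by blast
qed

end
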